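(* Let $G$ be a finite simple graph and $I(G)$ its edge ideal (over a field $\mathbb{K}$). Then $I(G)$ is strand connected in each of the following cases: (1) $G$ is a chordal graph; (2) $G=W_n=x*C_n$ is the wheel graph ($n\ge 3$); (3) $G=J_{2,n}$ is the Jahangir graph on $2n+1$ vertices ($n\ge 2$); (4) $G=F_{m,n}$ is a fan graph ($m\ge 1$, $n\ge 2$); (5) $G$ is a unicyclic graph whose induced cycle has length $n$ with $n\neq 3k+2$ for every $k\ge 1$.
   Context: $I(G)=(uv:\{u,v\}\in E(G))$ is an ideal of the standard graded polynomial ring $R$ over $\mathbb{K}$ whose variables are the vertices of $G$. For a homogeneous ideal $I\subset R$, the $j$-strand of $I$ is the set $\{i:\beta_{i,i+j}^R(R/I)\neq 0\}$. A non-empty $j$-strand is connected if it equals the integer interval between its minimum and its maximum. $I$ is strand connected if every non-empty strand is connected. A graph is chordal if it has no induced cycle of length at least $4$. $C_n$ is the cycle and $P_n$ the path on $n$ vertices. For a graph $H$, $U\subseteq V(H)$ and a new vertex $x$, $x*_U H$ is the graph with vertex set $V(H)\cup\{x\}$ and edge set $E(H)\cup\{\{x,u\}:u\in U\}$; $x*H=x*_{V(H)}H$. The Jahangir graph is $J_{2,n}=x*_U C_{2n}$, where $U$ is a vertex cover of $C_{2n}$ of size $n$. The fan graph is $F_{m,n}=x_1*_U(\cdots*_U(x_m*_U P_n))$ with $U=V(P_n)$ (so each of the $m$ distinct new vertices $x_i$ is joined exactly to the vertices of $P_n$). A block of a graph is a maximal nontrivial connected induced subgraph which has no cut vertex; a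 graph is unicyclic if exactly one of its blocks is a cycle and each other block is an edge. *)

theory Defs
  imports "HOL-Library.Poly_Mapping"
begin

section \<open>Finite simple graphs\<close>

record 'v ugraph =
  verts :: "'v set"
  edges :: "'v set set"

definition fin_simple_graph :: "'v ugraph \<Rightarrow> bool" where
  "fin_simple_graph G \<longleftrightarrow> finite (verts G) \<and> (\<forall>e\<in>edges G. e \<subseteq> verts G \<and> card e = 2)"

definition induced :: "'v ugraph \<Rightarrow> 'v set \<Rightarrow> 'v ugraph" where
  "induced G S = \<lparr>verts = verts G \<inter> S, edges = {e \<in> edges G. e \<subseteq> S}\<rparr>"

definition ugraph_iso :: "'v ugraph \<Rightarrow> 'w ugraph \<Rightarrow> bool" where
  "ugraph_iso G H \<longleftrightarrow> (\<exists>f. bij_betw f (verts G) (verts H) \<and>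
     (\<forall>x\<in>verts G. \<forall>y\<in>verts G. {x, y} \<in> edges G \<longleftrightarrow> {f x, f y} \<in> edges H))"

text \<open>\<open>cycle_graph n\<close> is the cycle on \<open>n\<close> vertices only for \<open>n \<ge> 3\<close>; every use below
  guarantees this.\<close>

definition cycle_graph :: "nat \<Rightarrow> nat ugraph" where
  "cycle_graph n = \<lparr>verts = {..<n}, edges = {{i, (i + 1) mod n} | i. i < n}\<rparr>"

definition path_graph :: "nat \<Rightarrow> nat ugraph" where
  "path_graph n = \<lparr>verts = {..<n}, edges = {{i, i + 1} | i. i + 1 < n}\<rparr>"

definition has_induced_cycle :: "'v ugraph \<Rightarrow> nat \<Rightarrow> bool" where
  "has_induced_cycle G n \<longleftrightarrow>
     n \<ge> 3 \<and> (\<exists>S. S \<subseteq> verts G \<and> ugraph_iso (induced G S) (cycle_graph n))"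

definition chordal :: "'v ugraph \<Rightarrow> bool" where
  "chordal G \<longleftrightarrow> \<not> (\<exists>n\<ge>4. has_induced_cycle G n)"

text \<open>The graph \<open>x *\<^sub>U H\<close>; it is only used for \<open>x \<notin> verts H\<close> and \<open>U \<subseteq> verts H\<close>.\<close>

definition add_cone :: "'v \<Rightarrow> 'v set \<Rightarrow> 'v ugraph \<Rightarrow> 'v ugraph" where
  "add_cone x U H = \<lparr>verts = insert x (verts H), edges = edges H \<union> {{x, u} | u. u \<in> U}\<rparr>"

definition is_wheel :: "nat \<Rightarrow> 'v ugraph \<Rightarrow> bool" where
  "is_wheel n G \<longleftrightarrow> (\<exists>H x. fin_simple_graph H \<and> ugraph_iso H (cycle_graph n) \<and> x \<notin> verts H \<and>
     G = add_cone x (verts H) H)"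

definition vertex_cover :: "'v ugraph \<Rightarrow> 'v set \<Rightarrow> bool" where
  "vertex_cover H U \<longleftrightarrow> U \<subseteq> verts H \<and> (\<forall>e\<in>edges H. e \<inter> U \<noteq> {})"

definition is_jahangir :: "nat \<Rightarrow> 'v ugraph \<Rightarrow> bool" where
  "is_jahangir n G \<longleftrightarrow> (\<exists>H x U. fin_simple_graph H \<and> ugraph_iso H (cycle_graph (2 * n)) \<and>
     x \<notin> verts H \<and> vertex_cover H U \<and> card U = n \<and> G = add_cone x U H)"

definition is_fan :: "nat \<Rightarrow> nat \<Rightarrow> 'v ugraph \<Rightarrow> bool" where
  "is_fan m n G \<longleftrightarrow> (\<exists>H xs. fin_simple_graph H \<and> ugraph_iso H (path_graph n) \<and> length xs = m \<and>
     distinct xs \<and> set xs \<inter> verts H = {} \<and> G = foldr (\<lambda>x. add_cone x (verts H)) xs H)"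

definition reachable :: "'v ugraph \<Rightarrow> 'v \<Rightarrow> 'v \<Rightarrow> bool" where
  "reachable G x y \<longleftrightarrow> x \<in> verts G \<and> y \<in> verts G \<and> (x, y) \<in> {(u, v). {u, v} \<in> edges G}\<^sup>*"

definition connected_ugraph :: "'v ugraph \<Rightarrow> bool" where
  "connected_ugraph G \<longleftrightarrow> verts G \<noteq> {} \<and> (\<forall>x\<in>verts G. \<forall>y\<in>verts G. reachable G x y)"

definition cut_vertex :: "'v ugraph \<Rightarrow> 'v \<Rightarrow> bool" where
  "cut_vertex G v \<longleftrightarrow> v \<in> verts G \<and> (\<exists>x\<in>verts G - {v}. \<exists>y\<in>verts G - {v}.
     reachable G x y \<and> \<not> reachable (induced G (verts G - {v})) x y)"

text \<open>Blocks are represented by their vertex sets; nontrivial means having at least two vertices.\<close>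

definition nonseparable :: "'v ugraph \<Rightarrow> 'v set \<Rightarrow> bool" where
  "nonseparable G B \<longleftrightarrow> B \<subseteq> verts G \<and> card B \<ge> 2 \<and> connected_ugraph (induced G B) \<and>
     \<not> (\<exists>v. cut_vertex (induced G B) v)"

definition is_block :: "'v ugraph \<Rightarrow> 'v set \<Rightarrow> bool" where
  "is_block G B \<longleftrightarrow> nonseparable G B \<and> \<not> (\<exists>B'. nonseparable G B' \<and> B \<subset> B')"

definition cycle_block :: "'v ugraph \<Rightarrow> 'v set \<Rightarrow> bool" where
  "cycle_block G B \<longleftrightarrow> is_block G B \<and> (\<exists>n\<ge>3. ugraph_iso (induced G B) (cycle_graph n))"

definition unicyclic :: "'v ugraph \<Rightarrow> bool" where
  "unicyclic G \<longleftrightarrow> (\<exists>!B. cycle_block G B) \<and>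
     (\<forall>B. is_block G B \<and> \<not> cycle_block G B \<longrightarrow> B \<in> edges G)"


section \<open>Graded polynomial ring and edge ideal\<close>

type_synonym ('v, 'k) mpoly = "('v \<Rightarrow>\<^sub>0 nat) \<Rightarrow>\<^sub>0 'k"

definition mvar :: "'v \<Rightarrow> ('v, 'k::field) mpoly" where
  "mvar x = Poly_Mapping.single (Poly_Mapping.single x 1) 1"

text \<open>The standard graded ring with variable set \<open>V\<close>, as a subring of the polynomials in all
  variables of type \<open>'v\<close>.\<close>

definition polyring :: "'v set \<Rightarrow> ('v, 'k::field) mpoly set" where
  "polyring V = {p. \<forall>m\<in>Poly_Mapping.keys p. Poly_Mapping.keys m \<subseteq> V}"

definition mdeg :: "('v \<Rightarrow>\<^sub>0 nat) \<Rightarrow> nat" where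
  "mdeg m = (\<Sum>x\<in>Poly_Mapping.keys m. Poly_Mapping.lookup m x)"

definition homogeneous_of :: "int \<Rightarrow> ('v, 'k::field) mpoly \<Rightarrow> bool" where
  "homogeneous_of d p \<longleftrightarrow> (\<forall>m\<in>Poly_Mapping.keys p. int (mdeg m) = d)"

definition ideal_gen :: "'v set \<Rightarrow> ('v, 'k::field) mpoly set \<Rightarrow> ('v, 'k) mpoly set" where
  "ideal_gen V S = {\<Sum>s\<in>T. c s * s | T c. finite T \<and> T \<subseteq> S \<and> (\<forall>s\<in>T. c s \<in> polyring V)}"

definition edge_ideal :: "'v ugraph \<Rightarrow> ('v, 'k::field) mpoly set" where
  "edge_ideal G = ideal_gen (verts G) {mvar u * mvar v | u v. {u, v} \<in> edges G}"


section \<open>Minimal graded free resolutions and graded Betti numbers\<close>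

text \<open>
  The data of a complex of graded free modules \<open>\<dots> \<rightarrow> F\<^sub>2 \<rightarrow> F\<^sub>1 \<rightarrow> F\<^sub>0 \<rightarrow> R/I\<close> over
  \<open>R = polyring V\<close>.  The module \<open>F\<^sub>i\<close> is \<open>R(- gdeg F i 0) \<oplus> \<dots> \<oplus> R(- gdeg F i (rnk F i - 1))\<close>;
  the map \<open>F\<^bsub>i+1\<^esub> \<rightarrow> F\<^sub>i\<close> is given by the matrix \<open>dmat F i\<close>, with \<open>rnk F i\<close> rows and
  \<open>rnk F (i + 1)\<close> columns; the map \<open>F\<^sub>0 \<rightarrow> R/I\<close> sends the basis vector number \<open>a\<close> to the
  residue class of \<open>aug F a\<close>.
\<close>

record (overloaded) ('v, 'k::zero) free_cplx =
  rnk :: "nat \<Rightarrow> nat"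
  gdeg :: "nat \<Rightarrow> nat \<Rightarrow> int"
  dmat :: "nat \<Rightarrow> nat \<Rightarrow> nat \<Rightarrow> ('v, 'k) mpoly"
  aug :: "nat \<Rightarrow> ('v, 'k) mpoly"

definition free_mod :: "'v set \<Rightarrow> nat \<Rightarrow> (nat \<Rightarrow> ('v, 'k::field) mpoly) set" where
  "free_mod V r = {w. (\<forall>a<r. w a \<in> polyring V) \<and> (\<forall>a\<ge>r. w a = 0)}"

definition dmap :: "('v, 'k::field) free_cplx \<Rightarrow> nat \<Rightarrow>
    (nat \<Rightarrow> ('v, 'k) mpoly) \<Rightarrow> nat \<Rightarrow> ('v, 'k) mpoly" where
  "dmap F i w = (\<lambda>a. if a < rnk F i then \<Sum>b<rnk F (i + 1). dmat F i a b * w b else 0)"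

definition augmap :: "('v, 'k::field) free_cplx \<Rightarrow> (nat \<Rightarrow> ('v, 'k) mpoly) \<Rightarrow> ('v, 'k) mpoly" where
  "augmap F w = (\<Sum>a<rnk F 0. w a * aug F a)"

text \<open>The second and third conjuncts say that all maps are homogeneous of degree \<open>0\<close>.\<close>

definition graded_free_cplx :: "'v set \<Rightarrow> ('v, 'k::field) free_cplx \<Rightarrow> bool" where
  "graded_free_cplx V F \<longleftrightarrow>
     (\<forall>i. \<forall>a<rnk F i. \<forall>b<rnk F (i + 1). dmat F i a b \<in> polyring V) \<and>
     (\<forall>i. \<forall>a<rnk F i. \<forall>b<rnk F (i + 1).
        homogeneous_of (gdeg F (i + 1) b - gdeg F i a) (dmat F i a b)) \<and>
     (\<forall>a<rnk F 0. aug F a \<in> polyring V \<and> homogeneous_of (gdeg F 0 a) (aug F a))"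

definition graded_free_resolution ::
    "'v set \<Rightarrow> ('v, 'k::field) mpoly set \<Rightarrow> ('v, 'k) free_cplx \<Rightarrow> bool" where
  "graded_free_resolution V I F \<longleftrightarrow> graded_free_cplx V F \<and>
     (\<forall>p\<in>polyring V. \<exists>w\<in>free_mod V (rnk F 0). p - augmap F w \<in> I) \<and>
     {w \<in> free_mod V (rnk F 0). augmap F w \<in> I} = dmap F 0 ` free_mod V (rnk F 1) \<and>
     (\<forall>i. {w \<in> free_mod V (rnk F (i + 1)). dmap F i w = (\<lambda>_. 0)}
        = dmap F (i + 1) ` free_mod V (rnk F (i + 2)))"

text \<open>Minimality: \<open>d(F\<^bsub>i+1\<^esub>) \<subseteq> \<mm>F\<^sub>i\<close> for all \<open>i \<ge> 0\<close>, where \<open>\<mm>\<close> is the ideal of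
  polynomials in \<open>R\<close> with constant term \<open>0\<close>.\<close>

definition minimal_graded_free_resolution ::
    "'v set \<Rightarrow> ('v, 'k::field) mpoly set \<Rightarrow> ('v, 'k) free_cplx \<Rightarrow> bool" where
  "minimal_graded_free_resolution V I F \<longleftrightarrow> graded_free_resolution V I F \<and>
     (\<forall>i. \<forall>a<rnk F i. \<forall>b<rnk F (i + 1). Poly_Mapping.lookup (dmat F i a b) 0 = 0)"

text \<open>If \<open>F\<close> is a minimal graded free resolution of \<open>R/I\<close>, then \<open>betti F i j\<close>, the number of
  summands \<open>R(-j)\<close> of \<open>F\<^sub>i\<close>, is the graded Betti number of \<open>R/I\<close> in homological degree \<open>i\<close> and
  internal degree \<open>j\<close>.\<close>

definition betti :: "('v, 'k::field) free_cplx \<Rightarrow> nat \<Rightarrow> int \<Rightarrow> nat" where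
  "betti F i j = card {a. a < rnk F i \<and> gdeg F i a = j}"

definition strand :: "('v, 'k::field) free_cplx \<Rightarrow> int \<Rightarrow> nat set" where
  "strand F j = {i. betti F i (int i + j) \<noteq> 0}"

definition connected_strand :: "nat set \<Rightarrow> bool" where
  "connected_strand S \<longleftrightarrow> S = {Min S..Max S}"

text \<open>The minimal graded free resolution of \<open>R/I\<close> exists for every homogeneous ideal \<open>I\<close> and is
  unique up to isomorphism of graded complexes, so the Betti numbers do not depend on \<open>F\<close>.
  For infinite \<open>S\<close> the value of \<open>Max S\<close> is irrelevant: \<open>connected_strand S\<close> is then false.\<close>

definition strand_connected :: "'v set \<Rightarrow> ('v, 'k::field) mpoly set \<Rightarrow> bool" where
  "strand_connected V I \<longleftrightarrow> (\<forall>F. minimal_graded_free_resolution V I F \<longrightarrow>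
     (\<forall>j. strand F j \<noteq> {} \<longrightarrow> connected_strand (strand F j)))"

end

theory Submission
  imports Defs
begin

text \<open>Koszul homology identifies the graded Betti numbers of \<open>R/I(G)\<close> with the reduced cohomology of
  independence complexes (Hochster's formula), so the \<open>j\<close>-strand is, up to a shift by \<open>j\<close>, the set
  of sizes of the induced subgraphs whose independence complex has nonzero cohomology in degree
  \<open>j - 1\<close>. Suppose that \<open>y\<close> is adjacent to \<open>x\<close> and that every other neighbour of \<open>y\<close> is a neighbour of \<open>x\<close>.
  Then the inclusion of the link of \<open>x\<close> into the deletion of \<open>x\<close> factors through a cone, the long exact
  sequence of the pair splits, and vertices can be removed one by one, down to an induced
  matching of size \<open>j\<close>, without losing cohomology. If there is no such pair, then every induced path can
  be prolonged until it closes up to an induced cycle of length at least 4. So chordal graphs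
  always have such a pair, and a unicyclic graph lacks one only when it is reduced to its cycle, whose
  cohomology is known. Finally, a vertex whose non-neighbours are independent does not affect
  cohomology in positive degrees; this reduces wheels, Jahangir graphs and fans to cycles and paths.\<close>

abbreviation "lookup \<equiv> Poly_Mapping.lookup"
abbreviation "keys \<equiv> Poly_Mapping.keys"
abbreviation "single \<equiv> Poly_Mapping.single"

text \<open>A linear order on an arbitrary type, which only serves to fix the signs of the differentials.\<close>

definition vlt :: "'v \<Rightarrow> 'v \<Rightarrow> bool" where
  "vlt u v \<longleftrightarrow> u \<noteq> v \<and> (u, v) \<in> (SOME r. well_order_on UNIV r)"

lemma vlt_irrefl [simp]: "\<not> vlt v v"
  by (simp add: vlt_def)

lemma vlt_total: "u \<noteq> v \<Longrightarrow> vlt u v \<longleftrightarrow> \<not> vlt v u"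
proof -
  assume "u \<noteq> v"
  have "well_order_on UNIV (SOME r :: 'a rel. well_order_on UNIV r)"
    by (rule someI_ex) (rule well_order_on)
  hence "antisym (SOME r :: 'a rel. well_order_on UNIV r)" "total_on UNIV (SOME r :: 'a rel. well_order_on UNIV r)"
    by (auto simp: well_order_on_def linear_order_on_def partial_order_on_def)
  with \<open>u \<noteq> v\<close> show ?thesis
    unfolding vlt_def antisym_def total_on_def by blast
qed

definition esgn :: "'v set \<Rightarrow> 'v \<Rightarrow> 'r::comm_ring_1" where
  "esgn T v = (- 1) ^ card {u \<in> T. vlt u v}"

lemma esgn_sq [simp]: "esgn T v * esgn T v = 1"
  by (simp add: esgn_def flip: power_mult_distrib)

lemma esgn_sq_left [simp]: "esgn T v * (esgn T v * a) = a"
  by (simp flip: mult.assoc)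

lemma esgn_cancel: "esgn T v * a = esgn T v * b \<longleftrightarrow> a = b"
  by (metis esgn_sq_left)

lemma esgn_insert:
  assumes "finite T" "u \<notin> T"
  shows "esgn (insert u T) v = (if vlt u v then - esgn T v else esgn T v)"
proof -
  have "{w \<in> insert u T. vlt w v} = (if vlt u v then insert u {w \<in> T. vlt w v} else {w \<in> T. vlt w v})"
    by auto
  thus ?thesis using assms by (simp add: esgn_def)
qed

lemma esgn_insert_same [simp]: "esgn (insert v T) v = esgn T v"
proof -
  have "{w \<in> insert v T. vlt w v} = {w \<in> T. vlt w v}" by auto
  thus ?thesis by (simp add: esgn_def)
qed

lemma esgn_anticomm:
  assumes "finite T" "u \<notin> T" "v \<notin> T" "u \<noteq> v"
  shows "esgn T v * esgn (insert v T) u = - (esgn T u * esgn (insert u T) v)"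
  using assms vlt_total[of u v] by (simp add: esgn_insert)

lemma esgn_Diff:
  assumes "finite X" "T \<subseteq> X"
  shows "esgn (X - T) v = esgn X v * (esgn T v :: 'b::comm_ring_1)"
proof -
  have 1: "{u \<in> X - T. vlt u v} = {u \<in> X. vlt u v} - {u \<in> T. vlt u v}" by auto
  have 2: "{u \<in> T. vlt u v} \<subseteq> {u \<in> X. vlt u v}" using assms by auto
  have fin: "finite {u \<in> X. vlt u v}" "finite {u \<in> T. vlt u v}"
    using assms finite_subset[OF assms(2,1)] by auto
  have "card {u \<in> X. vlt u v} = card {u \<in> X - T. vlt u v} + card {u \<in> T. vlt u v}"
    unfolding 1 using card_Diff_subset[OF fin(2) 2] card_mono[OF fin(1) 2] by simp
  hence "esgn X v = esgn (X - T) v * (esgn T v :: 'b)"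
    by (simp add: esgn_def power_add)
  thus ?thesis by (simp add: mult.assoc)
qed

lemma sum_antisym_eq_0:
  fixes c :: "'a \<Rightarrow> 'a \<Rightarrow> 'b::ab_group_add"
  assumes "finite A" "\<And>u v. u \<in> A \<Longrightarrow> v \<in> A \<Longrightarrow> u \<noteq> v \<Longrightarrow> c u v = - c v u"
  shows "(\<Sum>u\<in>A. \<Sum>v\<in>A - {u}. c u v) = 0"
  using assms
proof (induction A)
  case (insert a A)
  have "(\<Sum>v\<in>insert a A - {u}. c u v) = c u a + (\<Sum>v\<in>A - {u}. c u v)" if "u \<in> A" for u
  proof -
    have "insert a A - {u} = insert a (A - {u})" using that insert.hyps by auto
    thus ?thesis using insert.hyps by simp
  qed
  hence "(\<Sum>u\<in>A. \<Sum>v\<in>insert a A - {u}. c u v) = (\<Sum>u\<in>A. c u a) + (\<Sum>u\<in>A. \<Sum>v\<in>A - {u}. c u v)"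
    by (simp add: sum.distrib)
  also have "(\<Sum>u\<in>A. \<Sum>v\<in>A - {u}. c u v) = 0"
    using insert.IH insert.prems by blast
  also have "(\<Sum>u\<in>A. c u a) = (\<Sum>u\<in>A. - c a u)"
    using insert.hyps insert.prems by (intro sum.cong) auto
  finally show ?case using insert.hyps
    by (simp add: sum_negf)
qed simp

section \<open>Simplicial cohomology\<close>

definition cob :: "('v set \<Rightarrow> 'r::comm_ring_1) \<Rightarrow> 'v set \<Rightarrow> 'r" where
  "cob f T = (\<Sum>v\<in>T. esgn T v * f (T - {v}))"

definition simp_cplx :: "'v set set \<Rightarrow> bool" where
  "simp_cplx D \<longleftrightarrow> (\<forall>T\<in>D. finite T) \<and> (\<forall>T\<in>D. \<forall>S. S \<subseteq> T \<longrightarrow> S \<in> D)"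

text \<open>\<open>j\<close> is the cardinality of the faces, so this is the reduced cohomology in degree \<open>j - 1\<close>.\<close>

definition cohom_nz :: "'k::field itself \<Rightarrow> 'v set set \<Rightarrow> nat \<Rightarrow> bool" where
  "cohom_nz K D j \<longleftrightarrow> (\<exists>f :: 'v set \<Rightarrow> 'k. (\<forall>T\<in>D. card T = Suc j \<longrightarrow> cob f T = 0) \<and>
     \<not> (\<exists>h. \<forall>S\<in>D. card S = j \<longrightarrow> f S = cob h S))"

lemma not_cohom_nzD:
  fixes f :: "'v set \<Rightarrow> 'k::field"
  assumes "\<not> cohom_nz TYPE('k) D j" "\<And>T. T \<in> D \<Longrightarrow> card T = Suc j \<Longrightarrow> cob f T = 0"
  shows "\<exists>h. \<forall>S\<in>D. card S = j \<longrightarrow> f S = cob h S"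
  using assms unfolding cohom_nz_def by meson

lemma cohom_nzE:
  assumes "cohom_nz TYPE('k::field) D j"
  obtains f :: "'v set \<Rightarrow> 'k::field" where "\<And>T. T \<in> D \<Longrightarrow> card T = Suc j \<Longrightarrow> cob f T = 0"
    "\<And>h. (\<And>S. S \<in> D \<Longrightarrow> card S = j \<Longrightarrow> f S = cob h S) \<Longrightarrow> False"
  using assms unfolding cohom_nz_def by meson

lemma cob_cong: "(\<And>v. v \<in> T \<Longrightarrow> f (T - {v}) = g (T - {v})) \<Longrightarrow> cob f T = cob g T"
  by (simp add: cob_def)

lemma cob_add: "cob (\<lambda>S. f S + g S) T = cob f T + cob g T"
  by (simp add: cob_def algebra_simps sum.distrib)

lemma cob_diff: "cob (\<lambda>S. f S - g S) T = cob f T - cob g T"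
  by (simp add: cob_def algebra_simps sum_subtractf)

lemma cob_cob:
  fixes f :: "'v set \<Rightarrow> 'b::comm_ring_1"
  assumes "finite T" shows "cob (cob f) T = 0"
proof -
  have "cob (cob f) T = (\<Sum>u\<in>T. \<Sum>v\<in>T - {u}. esgn T u * (esgn (T - {u}) v * f (T - {u} - {v})))"
    by (simp add: cob_def sum_distrib_left)
  also have "\<dots> = 0"
  proof (rule sum_antisym_eq_0[OF assms])
    fix u v assume uv: "u \<in> T" "v \<in> T" "u \<noteq> v"
    define S where "S = T - {u} - {v}"
    have fin: "finite S" and ni: "u \<notin> S" "v \<notin> S" using assms by (auto simp: S_def)
    have eq: "T = insert u (insert v S)" "T - {u} = insert v S" "T - {v} = insert u S" "T - {v} - {u} = S"
      using uv by (auto simp: S_def)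
    have sg: "esgn T u = (esgn (insert v S) u :: 'b)" "esgn T v = (esgn (insert u S) v :: 'b)"
      unfolding eq(1) by (simp, metis esgn_insert_same insert_commute)
    have *: "esgn T u * esgn (T - {u}) v = - (esgn T v * (esgn (T - {v}) u :: 'b))"
      unfolding sg unfolding eq(2,3) using esgn_anticomm[OF fin ni uv(3), where 'b='b] by (simp add: mult.commute)
    show "esgn T u * (esgn (T - {u}) v * f (T - {u} - {v})) = - (esgn T v * (esgn (T - {v}) u * f (T - {v} - {u})))"
      unfolding S_def[symmetric] unfolding eq(4) using * by (simp flip: mult.assoc)
  qed
  finally show ?thesis .
qed

lemma cob_insert:
  assumes "finite T" "x \<notin> T"
  shows "esgn T x * cob f (insert x T) = f T - cob (\<lambda>S. esgn S x * f (insert x S)) T"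
proof -
  have "esgn T x * (esgn (insert x T) v * f (insert x T - {v})) =
      - (esgn T v * (esgn (T - {v}) x * f (insert x (T - {v}))))" if v: "v \<in> T" for v
  proof -
    define S where "S = T - {v}"
    have S: "T = insert v S" "v \<notin> S" "finite S" "x \<notin> S" "x \<noteq> v" using v assms by (auto simp: S_def)
    have eq: "insert x T - {v} = insert x S" using S by auto
    have "esgn T x * esgn (insert x T) v = - (esgn T v * (esgn S x :: 'b))"
      using S vlt_total[of x v] by (simp add: esgn_insert)
    thus ?thesis unfolding eq S_def[symmetric] by (simp flip: mult.assoc)
  qed
  hence "(\<Sum>v\<in>T. esgn T x * (esgn (insert x T) v * f (insert x T - {v}))) =
      - cob (\<lambda>S. esgn S x * f (insert x S)) T"
    by (simp add: cob_def sum_negf)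
  moreover have "insert x T - {x} = T" using assms by auto
  ultimately show ?thesis using assms
    by (simp add: cob_def[of f] sum_distrib_left algebra_simps)
qed

lemma cohom_nz_cone:
  fixes D :: "'v set set"
  assumes D: "simp_cplx D" and v: "\<And>T. T \<in> D \<Longrightarrow> insert v T \<in> D"
  shows "\<not> cohom_nz TYPE('k::field) D j"
proof
  assume "cohom_nz TYPE('k::field) D j"
  then obtain f :: "'v set \<Rightarrow> 'k" where f: "\<And>T. T \<in> D \<Longrightarrow> card T = Suc j \<Longrightarrow> cob f T = 0"
    and nh: "\<And>h. (\<And>S. S \<in> D \<Longrightarrow> card S = j \<Longrightarrow> f S = cob h S) \<Longrightarrow> False" by (rule cohom_nzE) blast
  define h where "h S = esgn S v * f (insert v S)" for S
  define h' where "h' S = (if v \<in> S then 0 else h S)" for S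
  have "f S = cob h' S" if S: "S \<in> D" "card S = j" for S
  proof -
    have fin: "finite S" using D S by (auto simp: simp_cplx_def)
    show ?thesis
    proof (cases "v \<in> S")
      case False
      have "esgn S v * cob f (insert v S) = f S - cob h S"
        unfolding h_def by (rule cob_insert[OF fin False])
      moreover have "cob f (insert v S) = 0" using f[OF v[OF S(1)]] fin False S(2) by simp
      moreover have "cob h' S = cob h S" using False by (auto simp: h'_def intro: cob_cong)
      ultimately show ?thesis by simp
    next
      case True
      have "cob h' S = (\<Sum>u\<in>S. if u = v then esgn S v * h (S - {v}) else 0)"
        unfolding cob_def using True by (intro sum.cong) (auto simp: h'_def)
      also have "\<dots> = esgn S v * h (S - {v})" using fin True by simp
      also have "esgn S v = (esgn (S - {v}) v :: 'k)" by (metis True esgn_insert_same insert_Diff)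
      also have "esgn (S - {v}) v * h (S - {v}) = f S" using True by (simp add: h_def insert_absorb)
      finally show ?thesis by simp
    qed
  qed
  with nh show False by blast
qed

lemma cohom_nz_delete_or_link:
  fixes D :: "'v set set"
  assumes D: "simp_cplx D" and nz: "cohom_nz TYPE('k::field) D (Suc j)"
  shows "cohom_nz TYPE('k::field) {T \<in> D. x \<notin> T} (Suc j) \<or> cohom_nz TYPE('k::field) {T. x \<notin> T \<and> insert x T \<in> D} j"
proof (rule ccontr)
  assume "\<not> ?thesis"
  hence del: "\<not> cohom_nz TYPE('k::field) {T \<in> D. x \<notin> T} (Suc j)" and lk: "\<not> cohom_nz TYPE('k::field) {T. x \<notin> T \<and> insert x T \<in> D} j" by auto
  from nz obtain f :: "'v set \<Rightarrow> 'k" where f: "\<And>T. T \<in> D \<Longrightarrow> card T = Suc (Suc j) \<Longrightarrow> cob f T = 0"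
    and nh: "\<And>h. (\<And>S. S \<in> D \<Longrightarrow> card S = Suc j \<Longrightarrow> f S = cob h S) \<Longrightarrow> False" by (rule cohom_nzE) blast
  have "T \<in> {T \<in> D. x \<notin> T} \<Longrightarrow> card T = Suc (Suc j) \<Longrightarrow> cob f T = 0" for T using f by blast
  from not_cohom_nzD[OF del this] obtain h1 where "\<forall>S. S \<in> {T \<in> D. x \<notin> T} \<longrightarrow> card S = Suc j \<longrightarrow> f S = cob h1 S" by blast
  hence h1: "\<And>S. S \<in> {T \<in> D. x \<notin> T} \<Longrightarrow> card S = Suc j \<Longrightarrow> f S = cob h1 S" by blast
  have finD: "\<And>T. T \<in> D \<Longrightarrow> finite T" and sub: "\<And>S T. T \<in> D \<Longrightarrow> S \<subseteq> T \<Longrightarrow> S \<in> D"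
    using D by (auto simp: simp_cplx_def)
  define g where "g S = f S - cob h1 S" for S
  have g0: "g S = 0" if "S \<in> D" "x \<notin> S" "card S = Suc j" for S using h1 that by (simp add: g_def)
  have cg: "cob g T = 0" if "T \<in> D" "card T = Suc (Suc j)" for T
    unfolding g_def cob_diff using f that cob_cob[OF finD] by simp
  define g' where "g' S = esgn S x * g (insert x S)" for S
  have "cob g' S = 0" if S: "x \<notin> S" "insert x S \<in> D" "card S = Suc j" for S
  proof -
    have fin: "finite S" using S finD by fastforce
    have "esgn S x * cob g (insert x S) = g S - cob g' S"
      unfolding g'_def by (rule cob_insert[OF fin S(1)])
    moreover have "cob g (insert x S) = 0" using cg[OF S(2)] S fin by simp
    moreover have "g S = 0" using g0 S sub by blast
    ultimately show ?thesis by simp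
  qed
  hence "T \<in> {T. x \<notin> T \<and> insert x T \<in> D} \<Longrightarrow> card T = Suc j \<Longrightarrow> cob g' T = 0" for T by blast
  from not_cohom_nzD[OF lk this] obtain k where "\<forall>S. S \<in> {T. x \<notin> T \<and> insert x T \<in> D} \<longrightarrow> card S = j \<longrightarrow> g' S = cob k S" by blast
  hence k: "\<And>S. S \<in> {T. x \<notin> T \<and> insert x T \<in> D} \<Longrightarrow> card S = j \<Longrightarrow> g' S = cob k S" by blast
  define k' where "k' S = (if x \<in> S then - esgn S x * k (S - {x}) else 0)" for S
  have "f S = cob (\<lambda>S. h1 S + k' S) S" if S: "S \<in> D" "card S = Suc j" for S
  proof -
    have fin: "finite S" using finD S by blast
    have "g S = cob k' S"
    proof (cases "x \<in> S")
      case False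
      hence "cob k' S = cob (\<lambda>_. 0) S" by (intro cob_cong) (simp add: k'_def)
      thus ?thesis using g0 False S by (simp add: cob_def)
    next
      case True
      define R where "R = S - {x}"
      have R: "S = insert x R" "x \<notin> R" "finite R" "card R = j" using True fin S by (auto simp: R_def)
      have "esgn R x * cob k' (insert x R) = k' R - cob (\<lambda>S. esgn S x * k' (insert x S)) R"
        by (rule cob_insert[OF R(3,2)])
      also have "k' R = 0" using R by (simp add: k'_def)
      also have "cob (\<lambda>S. esgn S x * k' (insert x S)) R = cob (\<lambda>S. 0 - k S) R"
        using R by (intro cob_cong) (simp add: k'_def)
      also have "0 - \<dots> = cob k R" by (subst cob_diff) (simp add: cob_def)
      also have "\<dots> = esgn R x * g (insert x R)" using k[of R] R S by (simp add: g'_def)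
      finally show ?thesis unfolding R(1) esgn_cancel ..
    qed
    thus ?thesis unfolding g_def cob_add diff_eq_eq by (simp only: add.commute)
  qed
  with nh show False by blast
qed

text \<open>The hypothesis makes the inclusion of the link of \<open>x\<close> into the deletion of \<open>x\<close> factor
  through a cone with apex \<open>y\<close>, hence trivial on cohomology.\<close>

lemma cohom_nz_of_link:
  fixes D :: "'v set set"
  assumes D: "simp_cplx D" and nz: "cohom_nz TYPE('k::field) {T. x \<notin> T \<and> insert x T \<in> D} j"
    and xy: "x \<noteq> y" and y: "\<And>T. x \<notin> T \<Longrightarrow> insert x T \<in> D \<Longrightarrow> insert y T \<in> D"
  shows "cohom_nz TYPE('k::field) D (Suc j)"
proof (rule ccontr)
  assume nn: "\<not> ?thesis"
  have finD: "\<And>T. T \<in> D \<Longrightarrow> finite T" and sub: "\<And>S T. T \<in> D \<Longrightarrow> S \<subseteq> T \<Longrightarrow> S \<in> D"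
    using D by (auto simp: simp_cplx_def)
  from nz obtain f :: "'v set \<Rightarrow> 'k"
    where f: "\<And>T. T \<in> {T. x \<notin> T \<and> insert x T \<in> D} \<Longrightarrow> card T = Suc j \<Longrightarrow> cob f T = 0"
    and nh: "\<And>h. (\<And>S. S \<in> {T. x \<notin> T \<and> insert x T \<in> D} \<Longrightarrow> card S = j \<Longrightarrow> f S = cob h S) \<Longrightarrow> False" by (rule cohom_nzE) blast
  define F where "F S = (if x \<in> S then esgn S x * f (S - {x}) else 0)" for S
  have Fx: "cob (\<lambda>S. esgn S x * F (insert x S)) T = cob f T" if "x \<notin> T" for T
    using that by (intro cob_cong) (simp add: F_def)
  have "cob F T = 0" if T: "T \<in> D" "card T = Suc (Suc j)" for T
  proof (cases "x \<in> T")
    case False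
    hence "cob F T = cob (\<lambda>_. 0) T" by (intro cob_cong) (simp add: F_def)
    thus ?thesis by (simp add: cob_def)
  next
    case True
    define R where "R = T - {x}"
    have R: "T = insert x R" "x \<notin> R" "finite R" "card R = Suc j" using True finD T by (auto simp: R_def)
    have "esgn R x * cob F (insert x R) = F R - cob f R"
      unfolding cob_insert[OF R(3,2)] Fx[OF R(2)] ..
    also have "\<dots> = 0" using f R T by (simp add: F_def)
    finally have "esgn R x * cob F (insert x R) = esgn R x * 0" by simp
    thus ?thesis unfolding R(1) esgn_cancel .
  qed
  from not_cohom_nzD[OF nn this] obtain H where "\<forall>S. S \<in> D \<longrightarrow> card S = Suc j \<longrightarrow> F S = cob H S" by blast
  hence H: "\<And>S. S \<in> D \<Longrightarrow> card S = Suc j \<Longrightarrow> F S = cob H S" by blast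
  define C where "C = {T. x \<notin> T \<and> (insert x (T - {y}) \<in> D)}"
  have C: "simp_cplx C" unfolding simp_cplx_def C_def
  proof (intro conjI ballI allI impI)
    fix T assume "T \<in> {T. x \<notin> T \<and> insert x (T - {y}) \<in> D}"
    hence "finite (insert x (T - {y}))" using finD[of "insert x (T - {y})"] by simp
    thus "finite T" by simp
  next
    fix T S assume T: "T \<in> {T. x \<notin> T \<and> insert x (T - {y}) \<in> D}" and "S \<subseteq> T"
    hence "insert x (S - {y}) \<subseteq> insert x (T - {y})" by auto
    with T have "insert x (S - {y}) \<in> D" using sub[of "insert x (T - {y})" "insert x (S - {y})"] by simp
    thus "S \<in> {T. x \<notin> T \<and> insert x (T - {y}) \<in> D}" using T \<open>S \<subseteq> T\<close> by auto
  qed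
  have CD: "T \<in> D" if "T \<in> C" for T
  proof -
    have "insert y (T - {y}) \<in> D" using y[of "T - {y}"] that by (simp add: C_def)
    thus ?thesis by (rule sub) auto
  qed
  have nC: "\<not> cohom_nz TYPE('k) C j"
  proof (rule cohom_nz_cone[OF C])
    show "insert y T \<in> C" if "T \<in> C" for T using that xy by (auto simp: C_def)
  qed
  have "cob H T = 0" if "T \<in> C" "card T = Suc j" for T
    using H[OF CD] that by (simp add: F_def C_def)
  from not_cohom_nzD[OF nC this] obtain k where "\<forall>S. S \<in> C \<longrightarrow> card S = j \<longrightarrow> H S = cob k S" by blast
  hence k: "\<And>S. S \<in> C \<Longrightarrow> card S = j \<Longrightarrow> H S = cob k S" by blast
  define h where "h S = k S - esgn S x * H (insert x S)" for S
  have "f S = cob h S" if S: "x \<notin> S" "insert x S \<in> D" "card S = j" for S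
  proof -
    have fin: "finite S" using finD S by fastforce
    have "S - {y} \<subseteq> S" by auto
    hence "S \<in> C" using S sub[of "insert x S" "insert x (S - {y})"] by (auto simp: C_def)
    hence "H S = cob k S" using k S by blast
    have "esgn S x * cob H (insert x S) = esgn S x * F (insert x S)" using H[OF S(2)] S fin by simp
    hence "f S = esgn S x * cob H (insert x S)" using S by (simp add: F_def)
    also have "\<dots> = H S - cob (\<lambda>S. esgn S x * H (insert x S)) S"
      by (rule cob_insert[OF fin S(1)])
    finally show ?thesis unfolding h_def cob_diff using \<open>H S = cob k S\<close> by simp
  qed
  with nh show False by blast
qed

lemma cohom_nz_0_iff:
  fixes D :: "'v set set"
  assumes D: "simp_cplx D"
  shows "cohom_nz TYPE('k::field) D 0 \<longleftrightarrow> D = {{}}"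
proof -
  have c0: "cob h {} = 0" for h :: "'v set \<Rightarrow> 'k" by (simp add: cob_def)
  show ?thesis
  proof
    assume nz: "cohom_nz TYPE('k::field) D 0"
    then obtain f :: "'v set \<Rightarrow> 'k" where f: "\<And>T. T \<in> D \<Longrightarrow> card T = Suc 0 \<Longrightarrow> cob f T = 0"
    and nh: "\<And>h. (\<And>S. S \<in> D \<Longrightarrow> card S = 0 \<Longrightarrow> f S = cob h S) \<Longrightarrow> False" by (rule cohom_nzE) blast
    have z: "S \<in> D \<Longrightarrow> card S = 0 \<Longrightarrow> S = {}" for S using D by (auto simp: simp_cplx_def)
    have 1: "{} \<in> D" "f {} \<noteq> 0" using nh z c0 by metis+
    show "D = {{}}"
    proof (rule ccontr)
      assume "D \<noteq> {{}}"
      then obtain T v where "T \<in> D" "v \<in> T" using 1 by auto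
      hence "{v} \<in> D" using D by (simp add: simp_cplx_def)
      from f[OF this] 1 show False by (simp add: cob_def esgn_def)
    qed
  next
    assume "D = {{}}"
    thus "cohom_nz TYPE('k::field) D 0" unfolding cohom_nz_def by (intro exI[of _ "\<lambda>_. 1"]) (auto simp: c0)
  qed
qed

section \<open>Polynomials\<close>

lemma poly_expand: "p = (\<Sum>m\<in>keys p. single m (lookup p m))"
proof (rule poly_mapping_eqI)
  fix k
  have "(\<Sum>m\<in>keys p. lookup (single m (lookup p m)) k)
    = (\<Sum>m\<in>keys p. if m = k then lookup p k else 0)"
    by (intro sum.cong) (auto simp: lookup_single when_def)
  also have "\<dots> = lookup p k"
    by (simp add: in_keys_iff)
  finally show "lookup p k =
      lookup (\<Sum>m\<in>keys p. single m (lookup p m)) k"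
    by (simp add: lookup_sum)
qed

lemma lookup_mvar_mult:
  fixes p :: "('v, 'k::field) mpoly"
  shows "lookup (mvar v * p) u =
    (if lookup u v = 0 then 0 else lookup p (u - single v 1))"
proof -
  let ?e = "single v (1::nat)"
  have "lookup (mvar v * p) u = (\<Sum>q. lookup p q when u = ?e + q)"
    by (simp add: lookup_mult prod_fun_def mvar_def lookup_single when_mult)
  also have "\<dots> = (if lookup u v = 0 then 0 else lookup p (u - ?e))"
  proof (cases "lookup u v = 0")
    case True
    have "u \<noteq> ?e + q" for q
    proof
      assume "u = ?e + q"
      hence "lookup u v = 1 + lookup q v"
        by (simp add: lookup_add)
      thus False using True by simp
    qed
    thus ?thesis using True by simp
  next
    case False
    have "u = ?e + q \<longleftrightarrow> q = u - ?e" for q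
    proof
      assume "q = u - ?e"
      thus "u = ?e + q" using False
        by (intro poly_mapping_eqI) (auto simp: lookup_add lookup_minus lookup_single when_def)
    qed simp
    thus ?thesis using False by simp
  qed
  finally show ?thesis .
qed

lemma keys_add_nat:
  fixes a b :: "'v \<Rightarrow>\<^sub>0 nat"
  shows "keys (a + b) = keys a \<union> keys b"
  by (auto simp: in_keys_iff lookup_add)

lemma polyring_0 [simp]: "0 \<in> polyring V"
  by (simp add: polyring_def)

lemma polyring_1 [simp]: "1 \<in> polyring V"
  by (simp add: polyring_def)

lemma polyring_add: "p \<in> polyring V \<Longrightarrow> q \<in> polyring V \<Longrightarrow> p + q \<in> polyring V"
  using keys_add[of p q] by (auto simp: polyring_def)

lemma polyring_uminus: "p \<in> polyring V \<Longrightarrow> - p \<in> polyring V"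
  by (auto simp: polyring_def in_keys_iff)

lemma polyring_diff: "p \<in> polyring V \<Longrightarrow> q \<in> polyring V \<Longrightarrow> p - q \<in> polyring V"
  using polyring_add[of p V "- q"] polyring_uminus[of q V] by simp

lemma polyring_mult: "p \<in> polyring V \<Longrightarrow> q \<in> polyring V \<Longrightarrow> p * q \<in> polyring V"
  using keys_mult[of p q] by (fastforce simp: polyring_def keys_add_nat)

lemma polyring_sum: "(\<And>x. x \<in> A \<Longrightarrow> f x \<in> polyring V) \<Longrightarrow> sum f A \<in> polyring V"
  by (induction A rule: infinite_finite_induct) (auto intro: polyring_add)

lemma polyring_mvar: "v \<in> V \<Longrightarrow> mvar v \<in> polyring V"
  by (auto simp: polyring_def mvar_def)

lemma esgn_cases: "esgn T v = 1 \<or> esgn T v = - 1"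
  by (cases "even (card {u \<in> T. vlt u v})") (simp_all add: esgn_def)

lemma polyring_esgn [simp]: "esgn T v \<in> polyring V"
  by (metis esgn_cases polyring_1 polyring_uminus)

lemma mdeg_add: "mdeg (a + b) = mdeg a + mdeg b"
  unfolding mdeg_def by (rule setsum_keys_plus_distrib) auto

lemma mdeg_single [simp]: "mdeg (single x n) = n"
  by (simp add: mdeg_def)

lemma homogeneous_mvar: "homogeneous_of 1 (mvar v)"
  by (simp add: homogeneous_of_def mvar_def)

definition hcomp :: "int \<Rightarrow> ('v, 'k::field) mpoly \<Rightarrow> ('v, 'k) mpoly" where
  "hcomp d p = Poly_Mapping.mapp (\<lambda>m c. if int (mdeg m) = d then c else 0) p"

lemma lookup_hcomp:
  "lookup (hcomp d p) m = (if int (mdeg m) = d then lookup p m else 0)"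
  by (auto simp: hcomp_def lookup_mapp when_def in_keys_iff)

lemma hcomp_0 [simp]: "hcomp d 0 = 0"
  by (rule poly_mapping_eqI) (simp add: lookup_hcomp)

lemma hcomp_add: "hcomp d (p + q) = hcomp d p + hcomp d q"
  by (rule poly_mapping_eqI) (simp add: lookup_hcomp lookup_add)

lemma hcomp_diff: "hcomp d (p - q) = hcomp d p - hcomp d q"
  by (rule poly_mapping_eqI) (simp add: lookup_hcomp lookup_minus)

lemma hcomp_sum: "hcomp d (sum f A) = (\<Sum>x\<in>A. hcomp d (f x))"
  by (induction A rule: infinite_finite_induct) (auto simp: hcomp_add)

lemma keys_hcomp: "keys (hcomp d p) = {m \<in> keys p. int (mdeg m) = d}"
  by (auto simp: in_keys_iff lookup_hcomp split: if_splits)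

lemma hcomp_polyring: "p \<in> polyring V \<Longrightarrow> hcomp d p \<in> polyring V"
  by (auto simp: polyring_def keys_hcomp)

lemma hcomp_eq_self_iff: "hcomp d p = p \<longleftrightarrow> homogeneous_of d p"
proof -
  have "hcomp d p = p \<longleftrightarrow> (\<forall>m. lookup (hcomp d p) m = lookup p m)"
    by (auto intro: poly_mapping_eqI)
  thus ?thesis by (auto simp: lookup_hcomp homogeneous_of_def in_keys_iff)
qed

lemma hcomp_mult:
  assumes "homogeneous_of a q"
  shows "hcomp d (q * p) = q * hcomp (d - a) p"
proof -
  define r where "r = p - hcomp (d - a) p"
  have "homogeneous_of d (q * hcomp (d - a) p)"
    unfolding homogeneous_of_def
  proof
    fix m assume "m \<in> keys (q * hcomp (d - a) p)"
    then obtain m1 m2 where "m = m1 + m2" "m1 \<in> keys q" "m2 \<in> keys (hcomp (d - a) p)"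
      using keys_mult by blast
    thus "int (mdeg m) = d" using assms by (auto simp: homogeneous_of_def keys_hcomp mdeg_add)
  qed
  moreover have "hcomp d (q * r) = 0"
  proof (rule poly_mapping_eqI)
    fix m
    show "lookup (hcomp d (q * r)) m = lookup 0 m"
    proof (rule ccontr)
      assume "\<not> ?thesis"
      hence m: "int (mdeg m) = d" "m \<in> keys (q * r)"
        by (auto simp: lookup_hcomp in_keys_iff split: if_splits)
      then obtain m1 m2 where "m = m1 + m2" "m1 \<in> keys q" "m2 \<in> keys r"
        using keys_mult by blast
      thus False using assms m
        by (auto simp: homogeneous_of_def in_keys_iff r_def lookup_minus lookup_hcomp mdeg_add split: if_splits)
    qed
  qed
  moreover have "q * p = q * hcomp (d - a) p + q * r" by (simp add: r_def algebra_simps)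
  ultimately show ?thesis by (simp add: hcomp_add hcomp_eq_self_iff)
qed

lemma lookup_esgn_mult:
  fixes p :: "('v, 'k::field) mpoly"
  shows "lookup (esgn T v * p) m = esgn T v * lookup p m"
  unfolding esgn_def by (cases "even (card {u \<in> T. vlt u v})") simp_all

lemma hcomp_esgn_mult: "hcomp d (esgn T v * p) = esgn T v * hcomp d p"
  by (rule poly_mapping_eqI) (simp add: lookup_esgn_mult lookup_hcomp)

lemma lookup_mult_0_eq_0:
  fixes p q :: "('v, 'k::field) mpoly"
  assumes "lookup p 0 = 0"
  shows "lookup (p * q) 0 = 0"
proof (rule ccontr)
  assume "\<not> ?thesis"
  then obtain a b where "0 = a + b" "a \<in> keys p"
    using keys_mult[of p q] by (auto simp: in_keys_iff)
  hence "a = 0" using keys_add_nat[of a b] by auto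
  thus False using assms \<open>a \<in> keys p\<close> by (simp add: in_keys_iff)
qed

section \<open>Edge ideals are monomial\<close>

definition indep :: "'v set set \<Rightarrow> 'v set \<Rightarrow> bool" where
  "indep E S \<longleftrightarrow> (\<forall>e\<in>E. \<not> e \<subseteq> S)"

lemma ideal_gen_0: "0 \<in> ideal_gen V S"
  unfolding ideal_gen_def by (intro CollectI exI[of _ "{}"]) simp

lemma ideal_gen_mult: "c \<in> polyring V \<Longrightarrow> s \<in> S \<Longrightarrow> c * s \<in> ideal_gen V S"
  unfolding ideal_gen_def by (intro CollectI exI[of _ "{s}"] exI[of _ "\<lambda>_. c"]) simp

lemma ideal_gen_add:
  assumes "p \<in> ideal_gen V S" "q \<in> ideal_gen V S"
  shows "p + q \<in> ideal_gen V S"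
proof -
  obtain T1 c1 where 1: "p = (\<Sum>s\<in>T1. c1 s * s)" "finite T1" "T1 \<subseteq> S" "\<forall>s\<in>T1. c1 s \<in> polyring V"
    using assms(1) unfolding ideal_gen_def by blast
  obtain T2 c2 where 2: "q = (\<Sum>s\<in>T2. c2 s * s)" "finite T2" "T2 \<subseteq> S" "\<forall>s\<in>T2. c2 s \<in> polyring V"
    using assms(2) unfolding ideal_gen_def by blast
  define c where "c s = (if s \<in> T1 then c1 s else 0) + (if s \<in> T2 then c2 s else 0)" for s
  have "p = (\<Sum>s\<in>T1 \<union> T2. (if s \<in> T1 then c1 s else 0) * s)"
    unfolding 1(1) using 1(2) 2(2) by (intro sum.mono_neutral_cong_left) auto
  moreover have "q = (\<Sum>s\<in>T1 \<union> T2. (if s \<in> T2 then c2 s else 0) * s)"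
    unfolding 2(1) using 1(2) 2(2) by (intro sum.mono_neutral_cong_left) auto
  ultimately have "p + q = (\<Sum>s\<in>T1 \<union> T2. c s * s)"
    by (simp add: c_def sum.distrib distrib_right)
  moreover have "\<forall>s\<in>T1 \<union> T2. c s \<in> polyring V"
    using 1 2 by (auto simp: c_def intro: polyring_add)
  ultimately show ?thesis unfolding ideal_gen_def using 1 2
    by (intro CollectI exI[of _ "T1 \<union> T2"] exI[of _ c]) auto
qed

lemma ideal_gen_sum: "(\<And>x. x \<in> A \<Longrightarrow> f x \<in> ideal_gen V S) \<Longrightarrow> sum f A \<in> ideal_gen V S"
  by (induction A rule: infinite_finite_induct) (auto intro: ideal_gen_add ideal_gen_0)

lemma edge_ideal_iff:
  fixes p :: "('v, 'k::field) mpoly"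
  assumes G: "fin_simple_graph G"
  shows "p \<in> edge_ideal G \<longleftrightarrow> p \<in> polyring (verts G) \<and>
    (\<forall>m\<in>keys p. \<not> indep (edges G) (keys m))"
proof
  assume "p \<in> edge_ideal G"
  then obtain T and c :: "('v, 'k) mpoly \<Rightarrow> ('v, 'k) mpoly" where T: "p = (\<Sum>s\<in>T. c s * s)" "finite T"
    "T \<subseteq> {mvar u * mvar v | u v. {u, v} \<in> edges G}" "\<forall>s\<in>T. c s \<in> polyring (verts G)"
    unfolding edge_ideal_def ideal_gen_def by blast
  have "c s * s \<in> polyring (verts G) \<and>
      (\<forall>m\<in>keys (c s * s). \<not> indep (edges G) (keys m))" if "s \<in> T" for s
  proof -
    obtain u v where uv: "s = mvar u * mvar v" "{u, v} \<in> edges G" using T(3) \<open>s \<in> T\<close> by blast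
    have s: "s = single (single u 1 + single v 1) 1"
      by (simp add: uv mvar_def mult_single)
    have "{u, v} \<subseteq> verts G" using G uv by (auto simp: fin_simple_graph_def)
    hence "s \<in> polyring (verts G)" unfolding uv by (intro polyring_mult polyring_mvar) auto
    moreover have "\<not> indep (edges G) (keys m)" if m: "m \<in> keys (c s * s)" for m
    proof -
      obtain a where "m = a + (single u 1 + single v 1)"
        using keys_mult[of "c s" s] m by (auto simp: s)
      hence "{u, v} \<subseteq> keys m" by (auto simp: keys_add_nat)
      thus ?thesis using uv(2) unfolding indep_def by blast
    qed
    ultimately show ?thesis using T \<open>s \<in> T\<close> polyring_mult by blast
  qed
  moreover have "keys p \<subseteq> (\<Union>s\<in>T. keys (c s * s))"
    unfolding T(1) by (rule keys_sum)
  ultimately show "p \<in> polyring (verts G) \<and>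
    (\<forall>m\<in>keys p. \<not> indep (edges G) (keys m))"
    unfolding polyring_def by blast
next
  assume p: "p \<in> polyring (verts G) \<and> (\<forall>m\<in>keys p. \<not> indep (edges G) (keys m))"
  have "single m (lookup p m) \<in> edge_ideal G" if m: "m \<in> keys p" for m
  proof -
    obtain e where e: "e \<in> edges G" "e \<subseteq> keys m" using p m unfolding indep_def by blast
    then obtain u v where uv: "e = {u, v}" "u \<noteq> v"
      using G by (auto simp: fin_simple_graph_def card_2_iff)
    define m' where "m' = m - (single u 1 + single v 1)"
    have eq: "m = m' + (single u 1 + single v 1)"
    proof (rule poly_mapping_eqI)
      have "lookup m u \<noteq> 0" "lookup m v \<noteq> 0"
        using e uv by (auto simp: in_keys_iff)
      thus "lookup m k = lookup (m' + (single u 1 + single v 1)) k" for k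
        using uv by (auto simp: m'_def lookup_add lookup_minus lookup_single when_def)
    qed
    have "keys m \<subseteq> verts G" using p m by (auto simp: polyring_def)
    moreover have "keys m' \<subseteq> keys m"
      unfolding m'_def by (auto simp: in_keys_iff lookup_minus)
    ultimately have "keys m' \<subseteq> verts G" by blast
    hence "single m' (lookup p m) \<in> polyring (verts G)"
      by (auto simp: polyring_def split: if_splits)
    hence "single m' (lookup p m) * (mvar u * mvar v) \<in> edge_ideal G"
      unfolding edge_ideal_def using e(1) unfolding uv(1) by (intro ideal_gen_mult) blast+
    moreover have "single m (lookup p m) =
        single m' (lookup p m) * (mvar u * mvar v)"
      unfolding mvar_def mult_single mult_1_right eq[symmetric] ..
    ultimately show ?thesis by simp
  qed
  hence "(\<Sum>m\<in>keys p. single m (lookup p m)) \<in> edge_ideal G"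
    unfolding edge_ideal_def by (intro ideal_gen_sum) auto
  thus "p \<in> edge_ideal G" unfolding poly_expand[symmetric] .
qed

section \<open>Koszul complexes\<close>

text \<open>Chains of homological degree \<open>p\<close> with values in the free module of rank \<open>r\<close>: the value
  at \<open>S\<close> is the coefficient of the wedge product of the basis vectors indexed by \<open>S\<close>.\<close>

definition KC :: "'v set \<Rightarrow> nat \<Rightarrow> nat \<Rightarrow> ('v set \<Rightarrow> nat \<Rightarrow> ('v, 'k::field) mpoly) set" where
  "KC V r p = {g. \<forall>T. g T \<in> free_mod V r \<and> (T \<subseteq> V \<and> card T = p \<or> g T = (\<lambda>_. 0))}"

definition kbd :: "'v set \<Rightarrow> ('v set \<Rightarrow> nat \<Rightarrow> ('v, 'k::field) mpoly) \<Rightarrow> 'v set \<Rightarrow> nat \<Rightarrow> ('v, 'k) mpoly" where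
  "kbd V g T a = (\<Sum>v\<in>V - T. esgn T v * (mvar v * g (insert v T) a))"

definition mat_map :: "nat \<Rightarrow> nat \<Rightarrow> (nat \<Rightarrow> nat \<Rightarrow> ('v, 'k::field) mpoly) \<Rightarrow> (nat \<Rightarrow> ('v, 'k) mpoly) \<Rightarrow> nat \<Rightarrow> ('v, 'k) mpoly" where
  "mat_map r r' M w = (\<lambda>a. if a < r then \<Sum>b<r'. M a b * w b else 0)"

definition prj :: "(nat \<Rightarrow> int) \<Rightarrow> int \<Rightarrow> nat \<Rightarrow> ('v set \<Rightarrow> nat \<Rightarrow> ('v, 'k::field) mpoly) \<Rightarrow> 'v set \<Rightarrow> nat \<Rightarrow> ('v, 'k) mpoly" where
  "prj gd d p g = (\<lambda>S a. hcomp (d - int p - gd a) (g S a))"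

lemma free_mod_0 [simp]: "(\<lambda>_. 0) \<in> free_mod V r"
  by (simp add: free_mod_def)

lemma free_mod_diff: "w \<in> free_mod V r \<Longrightarrow> w' \<in> free_mod V r \<Longrightarrow> (\<lambda>a. w a - w' a) \<in> free_mod V r"
  by (simp add: free_mod_def polyring_diff)

lemma free_mod_polyring: "w \<in> free_mod V r \<Longrightarrow> w a \<in> polyring V"
  by (cases "a < r") (auto simp: free_mod_def)

lemma KC_free_mod: "g \<in> KC V r p \<Longrightarrow> g T \<in> free_mod V r"
  by (simp add: KC_def)

lemma KC_eq_0: "g \<in> KC V r p \<Longrightarrow> \<not> (T \<subseteq> V \<and> card T = p) \<Longrightarrow> g T = (\<lambda>_. 0)"
  by (auto simp: KC_def)

lemma KCI: "(\<And>T. g T \<in> free_mod V r) \<Longrightarrow> (\<And>T. \<not> (T \<subseteq> V \<and> card T = p) \<Longrightarrow> g T = (\<lambda>_. 0)) \<Longrightarrow> g \<in> KC V r p"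
  by (auto simp: KC_def)

lemma KC_diff:
  assumes "g \<in> KC V r p" "h \<in> KC V r p" shows "(\<lambda>S a. g S a - h S a) \<in> KC V r p"
proof (rule KCI)
  show "(\<lambda>a. g T a - h T a) \<in> free_mod V r" for T
    using assms by (intro free_mod_diff KC_free_mod)
  show "(\<lambda>a. g T a - h T a) = (\<lambda>_. 0)" if "\<not> (T \<subseteq> V \<and> card T = p)" for T
    using assms[THEN KC_eq_0, OF that] by simp
qed

lemma kbd_free_mod:
  assumes "\<And>T. g T \<in> free_mod V r" shows "kbd V g T \<in> free_mod V r"
  unfolding free_mod_def kbd_def
proof (intro CollectI conjI allI impI)
  fix a
  show "(\<Sum>v\<in>V - T. esgn T v * (mvar v * g (insert v T) a)) \<in> polyring V"
    using free_mod_polyring[OF assms]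
    by (intro polyring_sum polyring_mult polyring_esgn polyring_mvar) auto
  assume "r \<le> a"
  hence "g S a = 0" for S using assms by (auto simp: free_mod_def)
  thus "(\<Sum>v\<in>V - T. esgn T v * (mvar v * g (insert v T) a)) = 0" by simp
qed

lemma kbd_KC_free_mod: "g \<in> KC V r p \<Longrightarrow> kbd V g T \<in> free_mod V r"
  by (intro kbd_free_mod KC_free_mod)

lemma kbd_KC:
  assumes "finite V" "g \<in> KC V r (Suc p)" shows "kbd V g \<in> KC V r p"
proof (rule KCI)
  show "kbd V g T \<in> free_mod V r" for T using assms(2) by (intro kbd_free_mod KC_free_mod)
  show "kbd V g T = (\<lambda>_. 0)" if T: "\<not> (T \<subseteq> V \<and> card T = p)" for T
  proof -
    have "g (insert v T) = (\<lambda>_. 0)" if "v \<in> V - T" for v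
    proof (rule KC_eq_0[OF assms(2)])
      show "\<not> (insert v T \<subseteq> V \<and> card (insert v T) = Suc p)"
        using T that finite_subset[OF _ assms(1)] by (cases "T \<subseteq> V") auto
    qed
    thus ?thesis by (simp add: kbd_def fun_eq_iff)
  qed
qed

lemma kbd_KC_0:
  assumes "finite V" "g \<in> KC V r 0" shows "kbd V g = (\<lambda>_ _. 0)"
proof (intro ext)
  fix T a
  have "g (insert v T) = (\<lambda>_. 0)" if "v \<in> V - T" for v
  proof (rule KC_eq_0[OF assms(2)])
    show "\<not> (insert v T \<subseteq> V \<and> card (insert v T) = 0)"
      using finite_subset[OF _ assms(1), of "insert v T"] by (cases "insert v T \<subseteq> V") auto
  qed
  thus "kbd V g T a = 0" by (simp add: kbd_def)
qed

lemma kbd_kbd: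
  assumes "finite V" "g \<in> KC V r p" shows "kbd V (kbd V g) = (\<lambda>_ _. 0)"
proof (intro ext)
  fix T a
  show "kbd V (kbd V g) T a = 0"
  proof (cases "T \<subseteq> V")
    case True
    hence fin: "finite T" using assms(1) finite_subset by auto
    have "kbd V (kbd V g) T a = (\<Sum>u\<in>V - T. \<Sum>v\<in>V - T - {u}. esgn T u * (mvar u *
       (esgn (insert u T) v * (mvar v * g (insert v (insert u T)) a))))"
      unfolding kbd_def sum_distrib_left
      by (intro sum.cong refl) auto
    also have "\<dots> = 0"
    proof (rule sum_antisym_eq_0)
      show "finite (V - T)" using assms by simp
      fix u v assume uv: "u \<in> V - T" "v \<in> V - T" "u \<noteq> v"
      have a: "esgn T u * esgn (insert u T) v = - (esgn T v * (esgn (insert v T) u :: ('a, 'b) mpoly))"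
        using esgn_anticomm[OF fin, of v u] uv by auto
      have "esgn T u * (mvar u * (esgn (insert u T) v * (mvar v * g (insert v (insert u T)) a)))
        = (esgn T u * esgn (insert u T) v) * (mvar u * mvar v * g (insert v (insert u T)) a)"
        by (simp only: ac_simps)
      also have "\<dots> = - ((esgn T v * esgn (insert v T) u) * (mvar u * mvar v * g (insert u (insert v T)) a))"
        unfolding a insert_commute[of u v T] by simp
      also have "(esgn T v * esgn (insert v T) u) * (mvar u * mvar v * g (insert u (insert v T)) a) =
        esgn T v * (mvar v * (esgn (insert v T) u * (mvar u * g (insert u (insert v T)) a)))"
        by (simp only: ac_simps)
      finally show "esgn T u * (mvar u * (esgn (insert u T) v * (mvar v * g (insert v (insert u T)) a)))
         = - (esgn T v * (mvar v * (esgn (insert v T) u * (mvar u * g (insert u (insert v T)) a))))" .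
    qed
    finally show ?thesis .
  next
    case False
    hence "g (insert v (insert u T)) = (\<lambda>_. 0)" for u v
      by (intro KC_eq_0[OF assms(2)]) auto
    thus ?thesis by (simp add: kbd_def)
  qed
qed

lemma kbd_diff: "kbd V (\<lambda>S a. g S a - h S a) = (\<lambda>S a. kbd V g S a - kbd V h S a)"
  by (simp add: kbd_def fun_eq_iff right_diff_distrib sum_subtractf)

lemma kbd_mat_map: "kbd V (\<lambda>S. mat_map r r' M (g S)) T = mat_map r r' M (kbd V g T)"
proof
  fix a
  show "kbd V (\<lambda>S. mat_map r r' M (g S)) T a = mat_map r r' M (kbd V g T) a"
  proof (cases "a < r")
    case True
    have "kbd V (\<lambda>S. mat_map r r' M (g S)) T a =
        (\<Sum>v\<in>V - T. \<Sum>b<r'. M a b * (esgn T v * (mvar v * g (insert v T) b)))"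
      using True by (simp add: kbd_def mat_map_def sum_distrib_left mult.left_commute)
    also have "\<dots> = (\<Sum>b<r'. \<Sum>v\<in>V - T. M a b * (esgn T v * (mvar v * g (insert v T) b)))"
      by (rule sum.swap)
    finally show ?thesis using True by (simp add: kbd_def mat_map_def sum_distrib_left)
  qed (simp add: kbd_def mat_map_def)
qed

lemma mat_map_diff: "mat_map r r' M (\<lambda>a. w a - w' a) = (\<lambda>a. mat_map r r' M w a - mat_map r r' M w' a)"
  by (simp add: mat_map_def fun_eq_iff right_diff_distrib sum_subtractf)

lemma mat_map_0 [simp]: "mat_map r r' M (\<lambda>_. 0) = (\<lambda>_. 0)"
  by (simp add: mat_map_def fun_eq_iff)

lemma mat_map_free_mod:
  assumes "\<And>a b. a < r \<Longrightarrow> b < r' \<Longrightarrow> M a b \<in> polyring V" "w \<in> free_mod V r'"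
  shows "mat_map r r' M w \<in> free_mod V r"
  using assms unfolding free_mod_def mat_map_def by (auto intro!: polyring_sum polyring_mult)

lemma mat_map_KC:
  assumes "\<And>a b. a < r \<Longrightarrow> b < r' \<Longrightarrow> M a b \<in> polyring V" "g \<in> KC V r' p"
  shows "(\<lambda>S. mat_map r r' M (g S)) \<in> KC V r p"
proof (rule KCI)
  show "mat_map r r' M (g T) \<in> free_mod V r" for T
    using assms(1) KC_free_mod[OF assms(2)] by (rule mat_map_free_mod)
  show "mat_map r r' M (g T) = (\<lambda>_. 0)" if "\<not> (T \<subseteq> V \<and> card T = p)" for T
    using KC_eq_0[OF assms(2) that] by simp
qed

lemma prj_KC:
  assumes "g \<in> KC V r p" shows "prj gd d q g \<in> KC V r p"
proof (rule KCI)
  show "prj gd d q g T \<in> free_mod V r" for T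
    using KC_free_mod[OF assms, of T] by (auto simp: prj_def free_mod_def hcomp_polyring)
  show "prj gd d q g T = (\<lambda>_. 0)" if "\<not> (T \<subseteq> V \<and> card T = p)" for T
    using KC_eq_0[OF assms that] by (simp add: prj_def)
qed

lemma prj_prj: "prj gd d p (prj gd d p g) = prj gd d p g"
proof (intro ext)
  fix S a
  have "hcomp e (hcomp e q) = hcomp e q" for e and q :: "('a, 'b) mpoly"
    by (rule poly_mapping_eqI) (simp add: lookup_hcomp)
  thus "prj gd d p (prj gd d p g) S a = prj gd d p g S a" by (simp add: prj_def)
qed

lemma prj_diff: "prj gd d p (\<lambda>S a. g S a - h S a) = (\<lambda>S a. prj gd d p g S a - prj gd d p h S a)"
  by (simp add: prj_def hcomp_diff)

lemma kbd_prj: "kbd V (prj gd d (Suc p) g) = prj gd d p (kbd V g)"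
proof (intro ext)
  fix T a
  have "mvar v * hcomp (d - int (Suc p) - gd a) q = hcomp (d - int p - gd a) (mvar v * q)" for v and q :: "('a, 'b) mpoly"
    by (subst hcomp_mult[OF homogeneous_mvar]) (simp add: algebra_simps)
  thus "kbd V (prj gd d (Suc p) g) T a = prj gd d p (kbd V g) T a"
    by (simp only: kbd_def prj_def hcomp_sum hcomp_esgn_mult)
qed

lemma mat_map_prj:
  assumes "\<And>a b. a < r \<Longrightarrow> b < r' \<Longrightarrow> homogeneous_of (gd' b - gd a) (M a b)"
  shows "(\<lambda>S. mat_map r r' M (prj gd' d p g S)) = prj gd d p (\<lambda>S. mat_map r r' M (g S))"
proof (intro ext)
  fix T a
  show "mat_map r r' M (prj gd' d p g T) a = prj gd d p (\<lambda>S. mat_map r r' M (g S)) T a"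
  proof (cases "a < r")
    case True
    have "M a b * hcomp (d - int p - gd' b) q = hcomp (d - int p - gd a) (M a b * q)" if "b < r'" for b q
      by (subst hcomp_mult[OF assms[OF True that]]) (simp add: algebra_simps)
    thus ?thesis using True
      by (simp add: mat_map_def prj_def hcomp_sum)
  qed (simp add: mat_map_def prj_def)
qed

text \<open>Nonvanishing, in internal degree \<open>d\<close>, of the Koszul homology in degree \<open>p\<close> of the
  quotient by \<open>B\<close> of the free module of rank \<open>r\<close> with generators in degrees \<open>gd\<close>.\<close>

definition koszul_nz :: "'v set \<Rightarrow> nat \<Rightarrow> (nat \<Rightarrow> int) \<Rightarrow> (nat \<Rightarrow> ('v, 'k::field) mpoly) set \<Rightarrow> nat \<Rightarrow> int \<Rightarrow> bool" where
  "koszul_nz V r gd B p d \<longleftrightarrow> (\<exists>g\<in>KC V r p. prj gd d p g = g \<and> (\<forall>T. kbd V g T \<in> B) \<and>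
     (\<forall>h\<in>KC V r (Suc p). \<exists>S. (\<lambda>a. g S a - kbd V h S a) \<notin> B))"

section \<open>Multidegrees\<close>

definition chi :: "'v set \<Rightarrow> ('v \<Rightarrow>\<^sub>0 nat)" where
  "chi S = (\<Sum>v\<in>S. single v 1)"

lemma lookup_chi: "finite S \<Longrightarrow> lookup (chi S) v = (if v \<in> S then 1 else 0)"
  by (simp add: chi_def lookup_sum lookup_single when_def)

lemma keys_chi: "finite S \<Longrightarrow> keys (chi S) = S"
  by (auto simp: in_keys_iff lookup_chi split: if_splits)

lemma mdeg_chi: "finite S \<Longrightarrow> mdeg (chi S) = card S"
  by (simp add: mdeg_def keys_chi lookup_chi)

lemma chi_insert: "finite S \<Longrightarrow> v \<notin> S \<Longrightarrow> chi (insert v S) = chi S + single v 1"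
  by (simp add: chi_def add.commute)

lemma chi_diff: "finite W \<Longrightarrow> S \<subseteq> W \<Longrightarrow> chi W - chi S = chi (W - S)"
  using finite_subset[of S W] by (intro poly_mapping_eqI) (auto simp: lookup_minus lookup_chi)

lemma diff_chi_add:
  assumes "S \<subseteq> keys m" shows "m - chi S + chi S = m"
proof (rule poly_mapping_eqI)
  have fin: "finite S" using finite_subset[OF assms finite_keys] .
  show "lookup (m - chi S + chi S) v = lookup m v" for v
    using assms by (auto simp: lookup_add lookup_minus lookup_chi[OF fin] in_keys_iff)
qed

definition bd :: "'v set \<Rightarrow> ('v set \<Rightarrow> 'k::field) \<Rightarrow> 'v set \<Rightarrow> 'k" where
  "bd X c T = (\<Sum>v\<in>X - T. esgn T v * c (insert v T))"

definition eps :: "'v set \<Rightarrow> 'v set \<Rightarrow> 'k::field" where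
  "eps X T = (\<Prod>v\<in>T. esgn X v)"

lemma eps_sq [simp]: "eps X T * eps X T = 1"
  by (simp add: eps_def flip: prod.distrib)

lemma eps_cancel: "eps X T * a = eps X T * b \<longleftrightarrow> a = b"
  by (metis eps_sq mult.assoc mult_1)

text \<open>Complementation turns the Koszul differential in a squarefree multidegree into the simplicial
  coboundary map, up to the signs \<open>eps\<close>.\<close>

lemma cob_compl:
  assumes "finite X" "T \<subseteq> X"
  shows "cob (\<lambda>S. eps X S * c (X - S)) T = eps X T * bd X c (X - T)"
proof -
  have fin: "finite T" using assms finite_subset by auto
  have "cob (\<lambda>S. eps X S * c (X - S)) T = (\<Sum>v\<in>T. eps X T * (esgn (X - T) v * c (insert v (X - T))))"
    unfolding cob_def
  proof (intro sum.cong refl)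
    fix v assume v: "v \<in> T"
    have "eps X T = esgn X v * (eps X (T - {v}) :: 'b)"
      unfolding eps_def using fin v by (rule prod.remove)
    hence "eps X (T - {v}) = esgn X v * (eps X T :: 'b)" by simp
    moreover have "X - (T - {v}) = insert v (X - T)" using v assms by auto
    moreover have "esgn (X - T) v = esgn X v * (esgn T v :: 'b)" using esgn_Diff[OF assms] .
    ultimately show "esgn T v * (eps X (T - {v}) * c (X - (T - {v}))) =
        eps X T * (esgn (X - T) v * c (insert v (X - T)))"
      by (simp only: ac_simps)
  qed
  also have "\<dots> = eps X T * bd X c (X - T)"
    using double_diff[OF assms(2) order.refl] by (simp add: bd_def sum_distrib_left)
  finally show ?thesis .
qed

lemma not_cohom_nz_bd:
  fixes c :: "'v set \<Rightarrow> 'k::field"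
  assumes X: "finite X" and D: "D \<subseteq> Pow X" and p: "p \<le> card X"
    and nnz: "\<not> cohom_nz TYPE('k) D (card X - p)"
    and c: "\<And>T. T \<subseteq> X \<Longrightarrow> X - T \<in> D \<Longrightarrow> Suc (card T) = p \<Longrightarrow> bd X c T = 0"
  obtains h where "\<And>S. S \<subseteq> X \<Longrightarrow> X - S \<in> D \<Longrightarrow> card S = p \<Longrightarrow> c S = bd X h S"
proof -
  have "cob (\<lambda>S. eps X S * c (X - S)) T = 0" if T: "T \<in> D" "card T = Suc (card X - p)" for T
  proof -
    have TX: "T \<subseteq> X" using T D by auto
    have "card (X - T) = card X - card T" using TX X by (simp add: card_Diff_subset finite_subset)
    moreover have "card T \<le> card X" using TX X by (rule card_mono[rotated])
    ultimately have "Suc (card (X - T)) = p" using T p by simp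
    moreover have "X - (X - T) = T" using TX by auto
    ultimately have "bd X c (X - T) = 0" using c[of "X - T"] T by simp
    thus ?thesis using cob_compl[OF X TX, of c] by simp
  qed
  from not_cohom_nzD[OF nnz this] obtain h
    where h: "\<forall>S\<in>D. card S = card X - p \<longrightarrow> eps X S * c (X - S) = cob h S" by blast
  define k where "k S = eps X (X - S) * h (X - S)" for S
  show ?thesis
  proof (rule that[of k])
    fix S assume S: "S \<subseteq> X" "X - S \<in> D" "card S = p"
    have c2: "X - (X - S) = S" using S by auto
    have "card (X - S) = card X - p" using S X by (simp add: card_Diff_subset finite_subset)
    hence "eps X (X - S) * c S = cob h (X - S)" using h S c2 by auto
    also have "\<dots> = cob (\<lambda>S. eps X S * k (X - S)) (X - S)"
    proof (rule cob_cong)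
      fix v assume "v \<in> X - S"
      have "X - (X - (X - S - {v})) = X - S - {v}" by auto
      thus "h (X - S - {v}) = eps X (X - S - {v}) * k (X - (X - S - {v}))"
        by (simp add: k_def flip: mult.assoc)
    qed
    also have "\<dots> = eps X (X - S) * bd X k S"
      using cob_compl[OF X Diff_subset, of k S] c2 by simp
    finally show "c S = bd X k S" by (simp only: eps_cancel)
  qed
qed

lemma cohom_nz_bd:
  assumes X: "finite X" and D: "D \<subseteq> Pow X" and p: "p \<le> card X"
    and nz: "cohom_nz TYPE('k::field) D (card X - p)"
  obtains c :: "'v set \<Rightarrow> 'k::field"
  where "\<And>T. T \<subseteq> X \<Longrightarrow> X - T \<in> D \<Longrightarrow> Suc (card T) = p \<Longrightarrow> bd X c T = 0"
    "\<And>h. (\<And>S. S \<subseteq> X \<Longrightarrow> X - S \<in> D \<Longrightarrow> card S = p \<Longrightarrow> c S = bd X h S) \<Longrightarrow> False"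
proof -
  from nz obtain f :: "'v set \<Rightarrow> 'k" where f: "\<And>T. T \<in> D \<Longrightarrow> card T = Suc (card X - p) \<Longrightarrow> cob f T = 0"
    and nh: "\<And>h. (\<And>S. S \<in> D \<Longrightarrow> card S = card X - p \<Longrightarrow> f S = cob h S) \<Longrightarrow> False" by (rule cohom_nzE) blast
  define c where "c S = eps X (X - S) * f (X - S)" for S
  have fc: "f S = eps X S * c (X - S)" if "S \<subseteq> X" for S
  proof -
    have "X - (X - S) = S" using that by auto
    thus ?thesis by (simp add: c_def flip: mult.assoc)
  qed
  show ?thesis
  proof (rule that[of c])
    fix T assume T: "T \<subseteq> X" "X - T \<in> D" "Suc (card T) = p"
    have c2: "X - (X - T) = T" using T by auto
    have "card (X - T) = Suc (card X - p)" using T X p by (simp add: card_Diff_subset finite_subset)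
    hence "0 = cob f (X - T)" using f[OF T(2)] by simp
    also have "\<dots> = cob (\<lambda>S. eps X S * c (X - S)) (X - T)"
      by (rule cob_cong) (rule fc, auto)
    also have "\<dots> = eps X (X - T) * bd X c T"
      using cob_compl[OF X Diff_subset, of c T] c2 by simp
    finally show "bd X c T = 0" by (metis eps_cancel mult_zero_right)
  next
    fix h assume h: "\<And>S. S \<subseteq> X \<Longrightarrow> X - S \<in> D \<Longrightarrow> card S = p \<Longrightarrow> c S = bd X h S"
    show False
    proof (rule nh[of "\<lambda>S. eps X S * h (X - S)"])
      fix S assume S: "S \<in> D" "card S = card X - p"
      have SX: "S \<subseteq> X" using S D by auto
      have "X - (X - S) = S" using SX by auto
      moreover have "card (X - S) = p" using S SX X p by (simp add: card_Diff_subset finite_subset)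
      ultimately have "c (X - S) = bd X h (X - S)" using h[of "X - S"] S by auto
      thus "f S = cob (\<lambda>S. eps X S * h (X - S)) S"
        using fc[OF SX] cob_compl[OF X SX, of h] by simp
    qed
  qed
qed

definition kb :: "'v set \<Rightarrow> ('v set \<Rightarrow> ('v, 'k::field) mpoly) \<Rightarrow> 'v set \<Rightarrow> ('v, 'k) mpoly" where
  "kb V q T = (\<Sum>v\<in>V - T. esgn T v * (mvar v * q (insert v T)))"

lemma kbd_kb: "kbd V g T a = kb V (\<lambda>S. g S a) T"
  by (simp add: kbd_def kb_def)

lemma lookup_kb:
  assumes V: "finite V" and m: "keys m \<subseteq> V" and T: "T \<subseteq> keys m"
  shows "lookup (kb V q T) (m - chi T) =
    bd (keys m) (\<lambda>S. lookup (q S) (m - chi S)) T"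
proof -
  have fin: "finite T" using finite_subset[OF T finite_keys] .
  have "lookup (kb V q T) (m - chi T) =
     (\<Sum>v\<in>V - T. if v \<in> keys m then
        esgn T v * lookup (q (insert v T)) (m - chi (insert v T)) else 0)"
    unfolding kb_def lookup_sum
  proof (intro sum.cong refl)
    fix v assume v: "v \<in> V - T"
    have "lookup (m - chi T) v = lookup m v"
      using v fin by (simp add: lookup_minus lookup_chi)
    moreover have "m - chi T - single v 1 = m - chi (insert v T)"
      using v fin by (simp add: chi_insert diff_diff_add)
    ultimately show "lookup (esgn T v * (mvar v * q (insert v T))) (m - chi T) =
       (if v \<in> keys m then
        esgn T v * lookup (q (insert v T)) (m - chi (insert v T)) else 0)"
      by (simp add: lookup_esgn_mult lookup_mvar_mult in_keys_iff)
  qed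
  also have "\<dots> = (\<Sum>v\<in>keys m - T. esgn T v * lookup (q (insert v T)) (m - chi (insert v T)))"
    using V m by (intro sum.mono_neutral_cong_right) auto
  finally show ?thesis by (simp add: bd_def)
qed

text \<open>The simplicial complex whose cohomology computes the Koszul homology of \<open>R/I\<close> in multidegree
  \<open>m\<close>.\<close>

definition mcplx :: "'v set set \<Rightarrow> ('v \<Rightarrow>\<^sub>0 nat) \<Rightarrow> 'v set set" where
  "mcplx E m = {S. S \<subseteq> keys m \<and>
     indep E (keys (m - chi (keys m - S)))}"

lemma keys_diff_chi:
  "finite S \<Longrightarrow> keys (m - chi S) = {v. (if v \<in> S then 1 else 0) < lookup m v}"
  by (auto simp: in_keys_iff lookup_minus lookup_chi split: if_splits)

lemma indep_mono: "indep E S \<Longrightarrow> T \<subseteq> S \<Longrightarrow> indep E T"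
  by (auto simp: indep_def)

lemma simp_cplx_mcplx: "simp_cplx (mcplx E m)"
  unfolding simp_cplx_def
proof (intro conjI ballI allI impI)
  fix T assume T: "T \<in> mcplx E m"
  thus "finite T" unfolding mcplx_def using finite_subset[OF _ finite_keys] by blast
  fix S assume S: "S \<subseteq> T"
  hence "keys (m - chi (keys m - S)) \<subseteq> keys (m - chi (keys m - T))"
    by (auto simp: keys_diff_chi split: if_splits)
  thus "S \<in> mcplx E m" using T S indep_mono unfolding mcplx_def by blast
qed

lemma not_cohom_nz_mcplx:
  assumes "v \<in> keys m" "lookup m v \<noteq> 1 \<or> E = {}"
  shows "\<not> cohom_nz TYPE('k::field) (mcplx E m) j"
proof (rule cohom_nz_cone[OF simp_cplx_mcplx])
  fix T assume T: "T \<in> mcplx E m"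
  have "keys (m - chi (keys m - insert v T)) = keys (m - chi (keys m - T))"
    if "lookup m v \<noteq> 1"
    using assms(1) that by (auto simp: keys_diff_chi in_keys_iff split: if_splits)
  thus "insert v T \<in> mcplx E m" using T assms by (auto simp: mcplx_def indep_def)
qed

definition ind_cplx :: "'v set set \<Rightarrow> 'v set \<Rightarrow> 'v set set" where
  "ind_cplx E W = {S. S \<subseteq> W \<and> indep E S}"

lemma mcplx_chi:
  assumes "finite W" shows "mcplx E (chi W) = ind_cplx E W"
proof -
  have "keys (chi W - chi (W - S)) = S" if "S \<subseteq> W" for S
  proof -
    have "W - (W - S) = S" using that by auto
    thus ?thesis using that chi_diff[OF assms, of "W - S"] keys_chi[OF finite_subset[OF that assms]] by simp
  qed
  thus ?thesis by (auto simp: mcplx_def ind_cplx_def keys_chi[OF assms])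
qed

lemma koszul_trivial:
  fixes q :: "'v set \<Rightarrow> ('v, 'k::field) mpoly"
  assumes V: "finite V" and qV: "\<And>S. q S \<in> polyring V"
    and q0: "\<And>S. \<not> (S \<subseteq> V \<and> card S = p) \<Longrightarrow> q S = 0"
    and cyc: "\<And>T u. u \<in> keys (kb V q T) \<Longrightarrow> \<not> indep E (keys u)"
    and nnz: "\<And>m S. keys m \<subseteq> V \<Longrightarrow> S \<subseteq> keys m \<Longrightarrow> card S = p \<Longrightarrow>
      lookup (q S) (m - chi S) \<noteq> 0 \<Longrightarrow> \<not> cohom_nz TYPE('k) (mcplx E m) (card (keys m) - p)"
  obtains h where "\<And>S. h S \<in> polyring V" "\<And>S. \<not> (S \<subseteq> V \<and> card S = Suc p) \<Longrightarrow> h S = 0"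
    "\<And>S u. u \<in> keys (q S - kb V h S) \<Longrightarrow> \<not> indep E (keys u)"
proof -
  define L where "L = {m. keys m \<subseteq> V \<and> (\<exists>S. S \<subseteq> keys m \<and> card S = p \<and>
      lookup (q S) (m - chi S) \<noteq> 0)}"
  have finL: "finite L"
  proof (rule finite_subset)
    show "L \<subseteq> (\<Union>S\<in>Pow V. (\<lambda>u. u + chi S) ` keys (q S))"
    proof
      fix m assume "m \<in> L"
      then obtain S where S: "keys m \<subseteq> V" "S \<subseteq> keys m" "lookup (q S) (m - chi S) \<noteq> 0"
        by (auto simp: L_def)
      moreover have "m = m - chi S + chi S" using diff_chi_add[OF S(2)] by simp
      ultimately show "m \<in> (\<Union>S\<in>Pow V. (\<lambda>u. u + chi S) ` keys (q S))"
        by (intro UN_I[of S] image_eqI[of _ _ "m - chi S"]) (auto simp: in_keys_iff)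
    qed
    show "finite (\<Union>S\<in>Pow V. (\<lambda>u. u + chi S) ` keys (q S))" using V by auto
  qed
  have "\<exists>h :: 'v set \<Rightarrow> 'k. (m \<notin> L \<longrightarrow> h = (\<lambda>_. 0)) \<and> (keys m \<subseteq> V \<longrightarrow>
     (\<forall>S. S \<subseteq> keys m \<longrightarrow> card S = p \<longrightarrow> indep E (keys (m - chi S)) \<longrightarrow>
      lookup (q S) (m - chi S) = bd (keys m) h S))" (is "\<exists>h. ?P h") for m
  proof (cases "m \<in> L")
    case False
    have "?P (\<lambda>_. 0)" using False by (auto simp: L_def bd_def)
    thus ?thesis by blast
  next
    case True
    then obtain S0 where m: "keys m \<subseteq> V" and S0: "S0 \<subseteq> keys m" "card S0 = p"
        "lookup (q S0) (m - chi S0) \<noteq> 0" by (auto simp: L_def)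
    have p: "p \<le> card (keys m)" using S0 card_mono[of "keys m" S0] by simp
    have c2: "keys m - (keys m - S) = S" if "S \<subseteq> keys m" for S
      using that by auto
    have "bd (keys m) (\<lambda>S. lookup (q S) (m - chi S)) T = 0"
      if T: "T \<subseteq> keys m" "keys m - T \<in> mcplx E m" for T
    proof (rule ccontr)
      assume "\<not> ?thesis"
      hence "m - chi T \<in> keys (kb V q T)"
        using lookup_kb[OF V m T(1), of q] by (simp add: in_keys_iff)
      from cyc[OF this] show False using T c2 by (simp add: mcplx_def)
    qed
    then obtain h where "\<And>S. S \<subseteq> keys m \<Longrightarrow> keys m - S \<in> mcplx E m \<Longrightarrow> card S = p \<Longrightarrow>
        lookup (q S) (m - chi S) = bd (keys m) h S"
      using not_cohom_nz_bd[OF finite_keys _ p nnz[OF m S0], of "\<lambda>S. lookup (q S) (m - chi S)"]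
      by (auto simp: mcplx_def)
    hence "?P h" using True c2 by (simp add: mcplx_def)
    thus ?thesis by blast
  qed
  then obtain H :: "('v \<Rightarrow>\<^sub>0 nat) \<Rightarrow> 'v set \<Rightarrow> 'k" where H0: "\<And>m. m \<notin> L \<Longrightarrow> H m = (\<lambda>_. 0)"
    and H: "\<And>m S. keys m \<subseteq> V \<Longrightarrow> S \<subseteq> keys m \<Longrightarrow> card S = p \<Longrightarrow>
      indep E (keys (m - chi S)) \<Longrightarrow>
      lookup (q S) (m - chi S) = bd (keys m) (H m) S" by metis
  define h where "h S = (if S \<subseteq> V \<and> card S = Suc p then Abs_poly_mapping (\<lambda>u. H (u + chi S) S) else 0)" for S
  have lh: "lookup (h S) u = H (u + chi S) S" if "S \<subseteq> V" "card S = Suc p" for S u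
  proof -
    have "finite {u. H (u + chi S) S \<noteq> 0}"
    proof (rule finite_subset)
      show "{u. H (u + chi S) S \<noteq> 0} \<subseteq> (\<lambda>m. m - chi S) ` L"
        using H0 by (force intro!: image_eqI[where x = "_ + chi S"])
    qed (use finL in simp)
    thus ?thesis using that by (simp add: h_def)
  qed
  show ?thesis
  proof (rule that[of h])
    show hV: "h S \<in> polyring V" for S
    proof (cases "S \<subseteq> V \<and> card S = Suc p")
      case True
      show ?thesis unfolding polyring_def
      proof (intro CollectI ballI)
        fix u assume "u \<in> keys (h S)"
        hence "u + chi S \<in> L" using True lh H0 by (fastforce simp: in_keys_iff)
        thus "keys u \<subseteq> V" by (auto simp: L_def keys_add_nat)
      qed
    next
      case False
      show ?thesis unfolding h_def if_not_P[OF False] by (rule polyring_0)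
    qed
    show h0: "h S = 0" if "\<not> (S \<subseteq> V \<and> card S = Suc p)" for S
      unfolding h_def if_not_P[OF that] ..
    fix S u assume u: "u \<in> keys (q S - kb V h S)"
    show "\<not> indep E (keys u)"
    proof
      assume ind: "indep E (keys u)"
      show False
      proof (cases "S \<subseteq> V \<and> card S = p")
        case False
        have "h (insert v S) = 0" if "v \<in> V - S" for v
          using that False finite_subset[OF _ V, of S] by (intro h0) auto
        hence "kb V h S = 0" by (simp add: kb_def)
        thus False using u q0[OF False] by simp
      next
        case True
        have fin: "finite S" using True V finite_subset by auto
        define m where "m = u + chi S"
        have "kb V h S \<in> polyring V" unfolding kb_def
          by (intro polyring_sum polyring_mult polyring_esgn polyring_mvar hV) auto
        hence "q S - kb V h S \<in> polyring V" using qV polyring_diff by blast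
        hence m: "keys m \<subseteq> V" "S \<subseteq> keys m"
          using u True by (auto simp: m_def keys_add_nat keys_chi[OF fin] polyring_def)
        have mu: "m - chi S = u" by (simp add: m_def)
        have "lookup (kb V h S) u = bd (keys m) (\<lambda>S. lookup (h S) (m - chi S)) S"
          using lookup_kb[OF V m] mu by simp
        also have "\<dots> = bd (keys m) (H m) S" unfolding bd_def
        proof (intro sum.cong refl)
          fix v assume v: "v \<in> keys m - S"
          have "insert v S \<subseteq> keys m" "insert v S \<subseteq> V" "card (insert v S) = Suc p"
            using v m True fin by auto
          thus "esgn S v * lookup (h (insert v S)) (m - chi (insert v S)) = esgn S v * H m (insert v S)"
            by (simp add: lh diff_chi_add)
        qed
        also have "\<dots> = lookup (q S) u" using H[OF m] True ind mu by simp
        finally show False using u by (simp add: in_keys_iff lookup_minus)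
      qed
    qed
  qed
qed

lemma koszul_exact:
  fixes g :: "'v set \<Rightarrow> nat \<Rightarrow> ('v, 'k::field) mpoly"
  assumes V: "finite V" and g: "g \<in> KC V r p" and z: "kbd V g = (\<lambda>_ _. 0)"
    and p0: "\<And>a. p = 0 \<Longrightarrow> lookup (g {} a) 0 = 0"
  obtains h where "h \<in> KC V r (Suc p)" "kbd V h = g"
proof -
  have "\<exists>h. (\<forall>S. h S \<in> polyring V) \<and> (\<forall>S. \<not> (S \<subseteq> V \<and> card S = Suc p) \<longrightarrow> h S = 0) \<and>
    (\<forall>S. g S a = kb V h S)" for a
  proof -
    obtain h where h: "\<And>S. h S \<in> polyring V" "\<And>S. \<not> (S \<subseteq> V \<and> card S = Suc p) \<Longrightarrow> h S = 0"
      "\<And>S u. u \<in> keys (g S a - kb V h S) \<Longrightarrow> \<not> indep {} (keys u)"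
    proof (rule koszul_trivial[OF V, of "\<lambda>S. g S a" p "{}"])
      show "g S a \<in> polyring V" for S by (rule free_mod_polyring[OF KC_free_mod[OF g]])
      show "g S a = 0" if "\<not> (S \<subseteq> V \<and> card S = p)" for S using KC_eq_0[OF g that] by simp
      show "\<not> indep {} (keys u)" if "u \<in> keys (kb V (\<lambda>S. g S a) T)" for T u
        using that kbd_kb[of V g T a] by (simp add: z)
      fix m S assume S: "S \<subseteq> keys m" "card S = p" "lookup (g S a) (m - chi S) \<noteq> 0"
      have "keys m \<noteq> {}"
      proof
        assume m: "keys m = {}"
        hence "S = {}" "p = 0" "m - chi S = 0" using S
          by (auto simp: chi_def intro!: poly_mapping_eqI simp: in_keys_iff lookup_minus)
        thus False using S p0 by simp
      qed
      then obtain v where "v \<in> keys m" by blast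
      thus "\<not> cohom_nz TYPE('k) (mcplx {} m) (card (keys m) - p)" by (intro not_cohom_nz_mcplx) auto
    qed blast
    have "g S a = kb V h S" for S
    proof -
      have "u \<notin> keys (g S a - kb V h S)" for u using h(3)[of u S] by (auto simp: indep_def)
      hence "g S a - kb V h S = 0" by (intro poly_mapping_eqI) (simp add: in_keys_iff)
      thus ?thesis by simp
    qed
    with h(1,2) show ?thesis by blast
  qed
  then obtain H where H: "\<And>a S. H a S \<in> polyring V" "\<And>a S. \<not> (S \<subseteq> V \<and> card S = Suc p) \<Longrightarrow> H a S = 0"
    "\<And>a S. g S a = kb V (H a) S" by metis
  define h where "h S a = (if a < r then H a S else 0)" for S a
  have "h \<in> KC V r (Suc p)"
  proof (rule KCI)
    show "h T \<in> free_mod V r" for T using H(1) by (simp add: h_def free_mod_def)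
    show "h T = (\<lambda>_. 0)" if "\<not> (T \<subseteq> V \<and> card T = Suc p)" for T using H(2)[OF that] by (auto simp: h_def)
  qed
  moreover have "kbd V h = g"
  proof (intro ext)
    fix T a
    show "kbd V h T a = g T a"
    proof (cases "a < r")
      case True
      thus ?thesis using H(3) by (simp add: kbd_kb h_def)
    next
      case False
      hence "g T a = 0" using KC_free_mod[OF g, of T] by (simp add: free_mod_def)
      thus ?thesis using False by (simp add: kbd_def h_def)
    qed
  qed
  ultimately show ?thesis by (rule that)
qed

lemma koszul_nzE:
  assumes "koszul_nz V r gd B p d"
  obtains g where "g \<in> KC V r p" "prj gd d p g = g" "\<And>T. kbd V g T \<in> B"
    "\<And>h. h \<in> KC V r (Suc p) \<Longrightarrow> (\<And>S. (\<lambda>a. g S a - kbd V h S a) \<in> B) \<Longrightarrow> False"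
  using assms unfolding koszul_nz_def by blast

lemma koszul_nzI:
  assumes "g \<in> KC V r p" "prj gd d p g = g" "\<And>T. kbd V g T \<in> B"
    "\<And>h. h \<in> KC V r (Suc p) \<Longrightarrow> (\<And>S. (\<lambda>a. g S a - kbd V h S a) \<in> B) \<Longrightarrow> False"
  shows "koszul_nz V r gd B p d"
  using assms unfolding koszul_nz_def by blast

lemma KC_lift:
  assumes b: "\<And>S. b S \<in> mat_map r r' M ` free_mod V r'" and b0: "\<And>S. \<not> (S \<subseteq> V \<and> card S = p) \<Longrightarrow> b S = (\<lambda>_. 0)"
  shows "\<exists>g\<in>KC V r' p. \<forall>S. mat_map r r' M (g S) = b S"
proof -
  have "\<exists>w. w \<in> free_mod V r' \<and> mat_map r r' M w = b S \<and> (\<not> (S \<subseteq> V \<and> card S = p) \<longrightarrow> w = (\<lambda>_. 0))" for S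
  proof (cases "S \<subseteq> V \<and> card S = p")
    case True
    from b[of S] obtain w where "b S = mat_map r r' M w" "w \<in> free_mod V r'" by (rule imageE)
    thus ?thesis using True by (intro exI[of _ w]) simp
  next
    case False
    thus ?thesis using b0[OF False] by (intro exI[of _ "\<lambda>_. 0"]) simp
  qed
  then obtain g where "\<And>S. g S \<in> free_mod V r'" "\<And>S. mat_map r r' M (g S) = b S"
    "\<And>S. \<not> (S \<subseteq> V \<and> card S = p) \<Longrightarrow> g S = (\<lambda>_. 0)" by metis
  thus ?thesis by (intro bexI[of _ g] allI KCI)
qed

lemma koszul_nz_shift:
  fixes M :: "nat \<Rightarrow> nat \<Rightarrow> ('v, 'k::field) mpoly"
  assumes V: "finite V" and M: "\<And>a b. a < r \<Longrightarrow> b < r' \<Longrightarrow> M a b \<in> polyring V"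
    and hom: "\<And>a b. a < r \<Longrightarrow> b < r' \<Longrightarrow> homogeneous_of (gd' b - gd a) (M a b)"
    and min: "\<And>a b. a < r \<Longrightarrow> b < r' \<Longrightarrow> lookup (M a b) 0 = 0"
    and B': "B' = {w \<in> free_mod V r'. mat_map r r' M w = (\<lambda>_. 0)}"
  shows "koszul_nz V r gd (mat_map r r' M ` free_mod V r') (Suc p) d \<longleftrightarrow> koszul_nz V r' gd' B' p d"
proof
  assume "koszul_nz V r gd (mat_map r r' M ` free_mod V r') (Suc p) d"
  then obtain h where h: "h \<in> KC V r (Suc p)" "prj gd d (Suc p) h = h" "\<And>T. kbd V h T \<in> mat_map r r' M ` free_mod V r'"
    "\<And>k. k \<in> KC V r (Suc (Suc p)) \<Longrightarrow> (\<And>S. (\<lambda>a. h S a - kbd V k S a) \<in> mat_map r r' M ` free_mod V r') \<Longrightarrow> False"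
    by (rule koszul_nzE) blast
  from KC_lift[OF h(3) KC_eq_0[OF kbd_KC[OF V h(1)]]]
  obtain g0 where g0: "g0 \<in> KC V r' p" "\<forall>S. mat_map r r' M (g0 S) = kbd V h S" by (rule bexE)
  define g where "g = prj gd' d p g0"
  have gK: "g \<in> KC V r' p" unfolding g_def by (rule prj_KC[OF g0(1)])
  have gm: "mat_map r r' M (g S) = kbd V h S" for S
  proof -
    have "(\<lambda>S. mat_map r r' M (g S)) = prj gd d p (kbd V h)"
      unfolding g_def using mat_map_prj[where gd=gd and gd'=gd', OF hom] g0(2)[rule_format] by simp
    also have "\<dots> = kbd V h" using h(2) kbd_prj[of V gd d p h] by simp
    finally show ?thesis by metis
  qed
  show "koszul_nz V r' gd' B' p d"
  proof (rule koszul_nzI[OF gK])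
    show "prj gd' d p g = g" by (simp add: g_def prj_prj)
    show "kbd V g T \<in> B'" for T
    proof -
      have "mat_map r r' M (kbd V g T) = kbd V (kbd V h) T" using kbd_mat_map[of V r r' M g T] gm by simp
      also have "\<dots> = (\<lambda>_. 0)" using kbd_kbd[OF V h(1)] by metis
      finally show ?thesis unfolding B' using kbd_KC_free_mod[OF gK] by blast
    qed
    fix k assume k: "k \<in> KC V r' (Suc p)" "\<And>S. (\<lambda>a. g S a - kbd V k S a) \<in> B'"
    define l where "l = (\<lambda>S a. h S a - mat_map r r' M (k S) a)"
    have l: "l \<in> KC V r (Suc p)" unfolding l_def by (intro KC_diff h mat_map_KC M k)
    have "kbd V l = (\<lambda>_ _. 0)"
    proof (intro ext)
      fix S a
      have "kbd V l S a = mat_map r r' M (g S) a - mat_map r r' M (kbd V k S) a"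
        unfolding l_def kbd_diff kbd_mat_map gm ..
      also have "\<dots> = mat_map r r' M (\<lambda>a. g S a - kbd V k S a) a" unfolding mat_map_diff ..
      also have "\<dots> = 0" using k(2)[of S] unfolding B' by simp
      finally show "kbd V l S a = 0" .
    qed
    then obtain n where n: "n \<in> KC V r (Suc (Suc p))" "kbd V n = l"
      using koszul_exact[OF V l] by blast
    show False
    proof (rule h(4)[OF n(1)])
      fix S
      have "(\<lambda>a. h S a - kbd V n S a) = mat_map r r' M (k S)" unfolding n(2) l_def by simp
      thus "(\<lambda>a. h S a - kbd V n S a) \<in> mat_map r r' M ` free_mod V r'" using KC_free_mod[OF k(1)] by auto
    qed
  qed
next
  assume "koszul_nz V r' gd' B' p d"
  then obtain g where g: "g \<in> KC V r' p" "prj gd' d p g = g" "\<And>T. kbd V g T \<in> B'"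
    "\<And>k. k \<in> KC V r' (Suc p) \<Longrightarrow> (\<And>S. (\<lambda>a. g S a - kbd V k S a) \<in> B') \<Longrightarrow> False"
    by (rule koszul_nzE) blast
  define e where "e = (\<lambda>S. mat_map r r' M (g S))"
  have e: "e \<in> KC V r p" unfolding e_def by (rule mat_map_KC[OF M g(1)])
  have "kbd V e = (\<lambda>_ _. 0)" using g(3) unfolding e_def B' kbd_mat_map fun_eq_iff by auto
  moreover have "lookup (e {} a) 0 = 0" for a
    using min by (auto simp: e_def mat_map_def lookup_sum intro!: sum.neutral lookup_mult_0_eq_0)
  ultimately obtain h0 where h0: "h0 \<in> KC V r (Suc p)" "kbd V h0 = e"
    using koszul_exact[OF V e] by blast
  define h where "h = prj gd d (Suc p) h0"
  have hK: "h \<in> KC V r (Suc p)" unfolding h_def by (rule prj_KC[OF h0(1)])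
  have he: "kbd V h = e"
  proof -
    have "kbd V h = prj gd d p e" unfolding h_def kbd_prj h0(2) ..
    also have "\<dots> = (\<lambda>S. mat_map r r' M (prj gd' d p g S))"
      unfolding e_def using mat_map_prj[where gd=gd and gd'=gd', OF hom] by metis
    finally show ?thesis unfolding g(2) e_def .
  qed
  show "koszul_nz V r gd (mat_map r r' M ` free_mod V r') (Suc p) d"
  proof (rule koszul_nzI[OF hK])
    show "prj gd d (Suc p) h = h" by (simp add: h_def prj_prj)
    show "kbd V h T \<in> mat_map r r' M ` free_mod V r'" for T
      unfolding he e_def using KC_free_mod[OF g(1)] by blast
    fix k assume k: "k \<in> KC V r (Suc (Suc p))" "\<And>S. (\<lambda>a. h S a - kbd V k S a) \<in> mat_map r r' M ` free_mod V r'"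
    have hk: "(\<lambda>S a. h S a - kbd V k S a) \<in> KC V r (Suc p)" by (intro KC_diff hK kbd_KC V k)
    from KC_lift[OF k(2) KC_eq_0[OF hk]] obtain n
      where n: "n \<in> KC V r' (Suc p)" "\<forall>S. mat_map r r' M (n S) = (\<lambda>a. h S a - kbd V k S a)" by (rule bexE)
    show False
    proof (rule g(4)[OF n(1)])
      fix S
      have "mat_map r r' M (\<lambda>a. g S a - kbd V n S a) = (\<lambda>a. e S a - kbd V (\<lambda>S. mat_map r r' M (n S)) S a)"
        unfolding mat_map_diff kbd_mat_map e_def ..
      also have "\<dots> = (\<lambda>a. e S a - (kbd V h S a - kbd V (kbd V k) S a))"
        unfolding n(2)[rule_format] kbd_diff ..
      also have "\<dots> = (\<lambda>_. 0)" using kbd_kbd[OF V k(1)] by (simp add: he)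
      finally show "(\<lambda>a. g S a - kbd V n S a) \<in> B'"
        unfolding B' using free_mod_diff[OF KC_free_mod[OF g(1)] kbd_KC_free_mod[OF n(1)]] by blast
    qed
  qed
qed

lemma koszul_nz_iso:
  fixes M :: "nat \<Rightarrow> nat \<Rightarrow> ('v, 'k::field) mpoly"
  assumes V: "finite V" and M: "\<And>a b. a < r \<Longrightarrow> b < r' \<Longrightarrow> M a b \<in> polyring V"
    and hom: "\<And>a b. a < r \<Longrightarrow> b < r' \<Longrightarrow> homogeneous_of (gd' b - gd a) (M a b)"
    and B': "B' = {w \<in> free_mod V r'. mat_map r r' M w \<in> B}"
    and sur: "\<And>w. w \<in> free_mod V r \<Longrightarrow> \<exists>w'\<in>free_mod V r'. (\<lambda>a. w a - mat_map r r' M w' a) \<in> B"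
    and B0: "(\<lambda>_. 0) \<in> B"
    and Bdiff: "\<And>w w'. w \<in> B \<Longrightarrow> w' \<in> B \<Longrightarrow> (\<lambda>a. w a - w' a) \<in> B"
    and Bkbd: "\<And>q T. (\<And>S. q S \<in> B) \<Longrightarrow> kbd V q T \<in> B"
    and Bprj: "\<And>q T d p. (\<And>S. q S \<in> B) \<Longrightarrow> prj gd d p q T \<in> B"
  shows "koszul_nz V r gd B p d \<longleftrightarrow> koszul_nz V r' gd' B' p d"
proof -
  have Badd: "(\<lambda>a. w a + w' a) \<in> B" if "w \<in> B" "w' \<in> B" for w w'
    using Bdiff[OF that(1) Bdiff[OF B0 that(2)]] by simp
  have lift: "\<exists>g. g \<in> KC V r' p \<and> (\<forall>S. (\<lambda>a. z S a - mat_map r r' M (g S) a) \<in> B)" if z: "z \<in> KC V r p" for z p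
  proof -
    have "\<exists>w. w \<in> free_mod V r' \<and> (\<lambda>a. z S a - mat_map r r' M w a) \<in> B \<and> (\<not> (S \<subseteq> V \<and> card S = p) \<longrightarrow> w = (\<lambda>_. 0))" for S
    proof (cases "S \<subseteq> V \<and> card S = p")
      case True
      from sur[OF KC_free_mod[OF z, of S]] obtain w
        where "w \<in> free_mod V r'" "(\<lambda>a. z S a - mat_map r r' M w a) \<in> B" by (rule bexE)
      thus ?thesis using True by (intro exI[of _ w]) simp
    next
      case False
      thus ?thesis using KC_eq_0[OF z False] B0 by (intro exI[of _ "\<lambda>_. 0"]) simp
    qed
    hence "\<exists>g. \<forall>S. g S \<in> free_mod V r' \<and> (\<lambda>a. z S a - mat_map r r' M (g S) a) \<in> B \<and>
        (\<not> (S \<subseteq> V \<and> card S = p) \<longrightarrow> g S = (\<lambda>_. 0))" by (intro choice allI)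
    then obtain g where g: "\<forall>S. g S \<in> free_mod V r' \<and> (\<lambda>a. z S a - mat_map r r' M (g S) a) \<in> B \<and>
        (\<not> (S \<subseteq> V \<and> card S = p) \<longrightarrow> g S = (\<lambda>_. 0))" by (rule exE)
    hence "g S \<in> free_mod V r'" "(\<lambda>a. z S a - mat_map r r' M (g S) a) \<in> B"
      "\<not> (S \<subseteq> V \<and> card S = p) \<Longrightarrow> g S = (\<lambda>_. 0)" for S by simp_all
    thus ?thesis by (intro exI[of _ g] conjI allI KCI)
  qed
  show ?thesis
  proof
    assume "koszul_nz V r' gd' B' p d"
    then obtain g where g: "g \<in> KC V r' p" "prj gd' d p g = g" "\<And>T. kbd V g T \<in> B'"
      "\<And>k. k \<in> KC V r' (Suc p) \<Longrightarrow> (\<And>S. (\<lambda>a. g S a - kbd V k S a) \<in> B') \<Longrightarrow> False"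
      by (rule koszul_nzE) blast
    define z where "z = (\<lambda>S. mat_map r r' M (g S))"
    show "koszul_nz V r gd B p d"
    proof (rule koszul_nzI[of z])
      show "z \<in> KC V r p" unfolding z_def by (rule mat_map_KC[OF M g(1)])
      show "prj gd d p z = z"
        unfolding z_def using mat_map_prj[where gd=gd and gd'=gd' and d=d and p=p and g=g, OF hom] g(2) by metis
      show "kbd V z T \<in> B" for T using g(3)[of T] unfolding z_def kbd_mat_map B' by blast
      fix h assume h: "h \<in> KC V r (Suc p)" "\<And>S. (\<lambda>a. z S a - kbd V h S a) \<in> B"
      obtain h' where h': "h' \<in> KC V r' (Suc p)" "\<And>S. (\<lambda>a. h S a - mat_map r r' M (h' S) a) \<in> B"
        using lift[OF h(1)] by blast
      show False
      proof (rule g(4)[OF h'(1)])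
        fix S
        have "mat_map r r' M (\<lambda>a. g S a - kbd V h' S a) =
          (\<lambda>a. (z S a - kbd V h S a) + kbd V (\<lambda>S a. h S a - mat_map r r' M (h' S) a) S a)"
          unfolding mat_map_diff kbd_diff kbd_mat_map z_def by (simp add: fun_eq_iff)
        also have "\<dots> \<in> B" by (intro Badd h(2) Bkbd h'(2))
        finally show "(\<lambda>a. g S a - kbd V h' S a) \<in> B'"
          unfolding B' using free_mod_diff[OF KC_free_mod[OF g(1)] kbd_KC_free_mod[OF h'(1)]] by blast
      qed
    qed
  next
    assume "koszul_nz V r gd B p d"
    then obtain z where z: "z \<in> KC V r p" "prj gd d p z = z" "\<And>T. kbd V z T \<in> B"
      "\<And>k. k \<in> KC V r (Suc p) \<Longrightarrow> (\<And>S. (\<lambda>a. z S a - kbd V k S a) \<in> B) \<Longrightarrow> False"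
      by (rule koszul_nzE) blast
    from lift[OF z(1)] obtain g0
      where "g0 \<in> KC V r' p \<and> (\<forall>S. (\<lambda>a. z S a - mat_map r r' M (g0 S) a) \<in> B)" by (rule exE)
    hence g0: "g0 \<in> KC V r' p" "(\<lambda>a. z S a - mat_map r r' M (g0 S) a) \<in> B" for S by simp_all
    define g where "g = prj gd' d p g0"
    have gK: "g \<in> KC V r' p" unfolding g_def by (rule prj_KC[OF g0(1)])
    have zg: "(\<lambda>a. z S a - mat_map r r' M (g S) a) \<in> B" for S
    proof -
      have mp: "(\<lambda>S. mat_map r r' M (g S)) = prj gd d p (\<lambda>S. mat_map r r' M (g0 S))"
        unfolding g_def by (rule mat_map_prj[OF hom])
      have z2: "prj gd d p z S a = z S a" for a unfolding z(2) ..
      have mp2: "mat_map r r' M (g S) a = prj gd d p (\<lambda>S. mat_map r r' M (g0 S)) S a" for a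
        using fun_cong[OF fun_cong[OF mp]] .
      have "(\<lambda>a. z S a - mat_map r r' M (g S) a) = prj gd d p (\<lambda>S a. z S a - mat_map r r' M (g0 S) a) S"
        unfolding prj_diff z2 mp2 ..
      thus ?thesis using Bprj[of "\<lambda>S a. z S a - mat_map r r' M (g0 S) a" d p S, OF g0(2)] by simp
    qed
    show "koszul_nz V r' gd' B' p d"
    proof (rule koszul_nzI[OF gK])
      show "prj gd' d p g = g" by (simp add: g_def prj_prj)
      show "kbd V g T \<in> B'" for T
      proof -
        have "mat_map r r' M (kbd V g T) = (\<lambda>a. kbd V z T a - kbd V (\<lambda>S a. z S a - mat_map r r' M (g S) a) T a)"
          unfolding kbd_diff kbd_mat_map by simp
        also have "\<dots> \<in> B" by (intro Bdiff z(3) Bkbd zg)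
        finally show ?thesis unfolding B' using kbd_KC_free_mod[OF gK] by blast
      qed
      fix h assume h: "h \<in> KC V r' (Suc p)" "\<And>S. (\<lambda>a. g S a - kbd V h S a) \<in> B'"
      show False
      proof (rule z(4)[of "\<lambda>S. mat_map r r' M (h S)"])
        show "(\<lambda>S. mat_map r r' M (h S)) \<in> KC V r (Suc p)" by (rule mat_map_KC[OF M h(1)])
        fix S
        have "(\<lambda>a. z S a - kbd V (\<lambda>S. mat_map r r' M (h S)) S a) =
            (\<lambda>a. (z S a - mat_map r r' M (g S) a) + mat_map r r' M (\<lambda>a. g S a - kbd V h S a) a)"
          unfolding mat_map_diff kbd_mat_map by simp
        also have "\<dots> \<in> B" using h(2)[of S] unfolding B' by (intro Badd zg) blast
        finally show "(\<lambda>a. z S a - kbd V (\<lambda>S. mat_map r r' M (h S)) S a) \<in> B" .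
      qed
    qed
  qed
qed

section \<open>Hochster's formula\<close>

lemma homogeneous_of_0 [simp]: "homogeneous_of d 0"
  by (simp add: homogeneous_of_def)

lemma hcomp_1: "hcomp 0 1 = 1"
  by (rule poly_mapping_eqI) (simp add: lookup_hcomp lookup_one when_def mdeg_def)

lemma lookup_kbd_0: "lookup (kbd V h T a) 0 = 0"
  unfolding kbd_def by (simp add: lookup_sum lookup_esgn_mult lookup_mvar_mult)

lemma koszul_nz_0:
  fixes M :: "nat \<Rightarrow> nat \<Rightarrow> ('v, 'k::field) mpoly"
  assumes V: "finite V"
    and min: "\<And>a b. a < r \<Longrightarrow> b < r' \<Longrightarrow> lookup (M a b) 0 = 0"
  shows "koszul_nz V r gd (mat_map r r' M ` free_mod V r') 0 d \<longleftrightarrow> (\<exists>a<r. gd a = d)"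
proof
  have B0: "(\<lambda>_. 0) \<in> mat_map r r' M ` free_mod V r'" by (rule image_eqI[of _ _ "\<lambda>_. 0"]) simp_all
  {
    assume "koszul_nz V r gd (mat_map r r' M ` free_mod V r') 0 d"
    then obtain g where g: "g \<in> KC V r 0" "prj gd d 0 g = g"
      "\<And>k. k \<in> KC V r (Suc 0) \<Longrightarrow> (\<And>S. (\<lambda>a. g S a - kbd V k S a) \<in> mat_map r r' M ` free_mod V r') \<Longrightarrow> False"
      by (rule koszul_nzE) blast
    show "\<exists>a<r. gd a = d"
    proof (rule ccontr)
      assume *: "\<not> ?thesis"
      have "lookup (g {} a) 0 = 0" for a
      proof (cases "a < r")
        case True
        have "g {} a = hcomp (d - gd a) (g {} a)"
          using fun_cong[OF fun_cong[OF g(2), of "{}"], of a] by (simp add: prj_def)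
        hence "lookup (g {} a) 0 = lookup (hcomp (d - gd a) (g {} a)) 0" by (rule arg_cong)
        also have "\<dots> = 0" using * True by (auto simp: lookup_hcomp mdeg_def)
        finally show ?thesis .
      next
        case False
        thus ?thesis using KC_free_mod[OF g(1), of "{}"] by (simp add: free_mod_def)
      qed
      then obtain h where h: "h \<in> KC V r (Suc 0)" "kbd V h = g"
        using koszul_exact[OF V g(1) kbd_KC_0[OF V g(1)]] by metis
      show False by (rule g(3)[OF h(1)]) (simp add: h(2) B0)
    qed
  }
  assume "\<exists>a<r. gd a = d"
  then obtain a0 where a0: "a0 < r" "gd a0 = d" by blast
  define g :: "'v set \<Rightarrow> nat \<Rightarrow> ('v, 'k) mpoly" where "g S a = (if S = {} \<and> a = a0 then 1 else 0)" for S a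
  have gK: "g \<in> KC V r 0"
  proof (rule KCI)
    show "g T \<in> free_mod V r" for T using a0 by (auto simp: g_def free_mod_def)
    show "g T = (\<lambda>_. 0)" if "\<not> (T \<subseteq> V \<and> card T = 0)" for T using that by (auto simp: g_def fun_eq_iff)
  qed
  show "koszul_nz V r gd (mat_map r r' M ` free_mod V r') 0 d"
  proof (rule koszul_nzI[OF gK])
    show "prj gd d 0 g = g" using a0 by (auto simp: prj_def g_def fun_eq_iff hcomp_1)
    show "kbd V g T \<in> mat_map r r' M ` free_mod V r'" for T using kbd_KC_0[OF V gK] B0 by simp
    fix h assume "\<And>S. (\<lambda>a. g S a - kbd V h S a) \<in> mat_map r r' M ` free_mod V r'"
    from this[of "{}"] obtain w where "(\<lambda>a. g {} a - kbd V h {} a) = mat_map r r' M w" by (rule imageE)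
    from fun_cong[OF this, of a0] have "g {} a0 = kbd V h {} a0 + (\<Sum>b<r'. M a0 b * w b)"
      using a0 by (simp add: mat_map_def algebra_simps)
    hence "lookup (g {} a0) 0 = 0 + (\<Sum>b<r'. lookup (M a0 b * w b) 0)"
      by (simp only: lookup_add lookup_sum lookup_kbd_0)
    also have "\<dots> = 0" using min a0 by (auto intro!: sum.neutral lookup_mult_0_eq_0)
    finally show False by (simp add: g_def)
  qed
qed

definition mono_ideal :: "'v set \<Rightarrow> 'v set set \<Rightarrow> ('v, 'k::field) mpoly set" where
  "mono_ideal V E = {p \<in> polyring V. \<forall>m\<in>keys p. \<not> indep E (keys m)}"

lemma mono_ideal_0 [simp]: "0 \<in> mono_ideal V E"
  by (simp add: mono_ideal_def)

lemma mono_ideal_add: "p \<in> mono_ideal V E \<Longrightarrow> q \<in> mono_ideal V E \<Longrightarrow> p + q \<in> mono_ideal V E"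
  using keys_add[of p q] by (auto simp: mono_ideal_def polyring_add)

lemma mono_ideal_uminus: "p \<in> mono_ideal V E \<Longrightarrow> - p \<in> mono_ideal V E"
  by (auto simp: mono_ideal_def polyring_uminus in_keys_iff)

lemma mono_ideal_diff: "p \<in> mono_ideal V E \<Longrightarrow> q \<in> mono_ideal V E \<Longrightarrow> p - q \<in> mono_ideal V E"
  using mono_ideal_add[of p V E "- q"] mono_ideal_uminus[of q V E] by simp

lemma mono_ideal_mult:
  assumes "p \<in> polyring V" "q \<in> mono_ideal V E" shows "p * q \<in> mono_ideal V E"
  unfolding mono_ideal_def
proof (intro CollectI conjI ballI)
  show "p * q \<in> polyring V" using assms by (auto simp: mono_ideal_def intro: polyring_mult)
  fix m assume "m \<in> keys (p * q)"
  then obtain a b where "m = a + b" "b \<in> keys q" using keys_mult[of p q] by auto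
  hence "keys b \<subseteq> keys m" "\<not> indep E (keys b)"
    using assms(2) by (auto simp: keys_add_nat mono_ideal_def)
  thus "\<not> indep E (keys m)" using indep_mono by blast
qed

lemma mono_ideal_sum: "(\<And>x. x \<in> A \<Longrightarrow> f x \<in> mono_ideal V E) \<Longrightarrow> sum f A \<in> mono_ideal V E"
  by (induction A rule: infinite_finite_induct) (auto intro: mono_ideal_add)

lemma mono_ideal_hcomp: "p \<in> mono_ideal V E \<Longrightarrow> hcomp d p \<in> mono_ideal V E"
  by (auto simp: mono_ideal_def hcomp_polyring keys_hcomp)

lemma simp_cplx_ind: "finite W \<Longrightarrow> simp_cplx (ind_cplx E W)"
  using indep_mono finite_subset by (fastforce simp: simp_cplx_def ind_cplx_def)

lemma hochster:
  fixes E :: "'v set set"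
  assumes V: "finite V"
  shows "koszul_nz V 1 (\<lambda>_. 0) {w \<in> free_mod V 1. w 0 \<in> (mono_ideal V E :: ('v, 'k::field) mpoly set)} p d \<longleftrightarrow>
    (\<exists>W\<subseteq>V. int (card W) = d \<and> p \<le> card W \<and> cohom_nz TYPE('k) (ind_cplx E W) (card W - p))"
    (is "koszul_nz V 1 ?gd ?B p d \<longleftrightarrow> ?R")
proof
  assume "koszul_nz V 1 ?gd ?B p d"
  then obtain g :: "'v set \<Rightarrow> nat \<Rightarrow> ('v, 'k) mpoly" where g: "g \<in> KC V 1 p" "prj ?gd d p g = g" "\<And>T. kbd V g T \<in> ?B"
    "\<And>k. k \<in> KC V 1 (Suc p) \<Longrightarrow> (\<And>S. (\<lambda>a. g S a - kbd V k S a) \<in> ?B) \<Longrightarrow> False"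
    by (rule koszul_nzE) blast
  show ?R
  proof (rule ccontr)
    assume nR: "\<not> ?R"
    have gd: "int (mdeg u) = d - int p" if "lookup (g S 0) u \<noteq> 0" for S u
    proof -
      have "g S 0 = hcomp (d - int p) (g S 0)"
        using fun_cong[OF fun_cong[OF g(2), of S], of 0] by (simp add: prj_def)
      hence "lookup (g S 0) u = lookup (hcomp (d - int p) (g S 0)) u" by (rule arg_cong)
      thus ?thesis using that by (auto simp: lookup_hcomp split: if_splits)
    qed
    obtain h where h: "\<And>S. h S \<in> polyring V" "\<And>S. \<not> (S \<subseteq> V \<and> card S = Suc p) \<Longrightarrow> h S = 0"
      "\<And>S u. u \<in> keys (g S 0 - kb V h S) \<Longrightarrow> \<not> indep E (keys u)"
    proof (rule koszul_trivial[OF V, of "\<lambda>S. g S 0" p E])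
      show "g S 0 \<in> polyring V" for S by (rule free_mod_polyring[OF KC_free_mod[OF g(1)]])
      show "g S 0 = 0" if "\<not> (S \<subseteq> V \<and> card S = p)" for S using KC_eq_0[OF g(1) that] by simp
      show "\<not> indep E (keys u)" if "u \<in> keys (kb V (\<lambda>S. g S 0) T)" for T u
        using that g(3)[of T] by (simp add: mono_ideal_def kbd_kb)
      fix m S assume m: "keys m \<subseteq> V" and S: "S \<subseteq> keys m" "card S = p"
        "lookup (g S 0) (m - chi S) \<noteq> 0"
      show "\<not> cohom_nz TYPE('k) (mcplx E m) (card (keys m) - p)"
      proof (cases "\<exists>v\<in>keys m. lookup m v \<noteq> 1")
        case True
        then obtain v where "v \<in> keys m" "lookup m v \<noteq> 1" by blast
        thus ?thesis by (intro not_cohom_nz_mcplx disjI1)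
      next
        case False
        define W where "W = keys m"
        have fin: "finite W" "finite S" using S finite_subset[OF S(1)] by (auto simp: W_def)
        have mW: "m = chi W"
          using False fin(1) by (intro poly_mapping_eqI) (auto simp: lookup_chi W_def in_keys_iff)
        have "mdeg m = mdeg (m - chi S) + mdeg (chi S)"
          using diff_chi_add[OF S(1)] mdeg_add[of "m - chi S" "chi S"] by simp
        hence "int (card W) = d"
          using gd[OF S(3)] fin S(2) by (simp add: mdeg_chi mW)
        moreover have "p \<le> card W" using card_mono[OF fin(1), of S] S(1,2) by (simp add: W_def)
        moreover have "W \<subseteq> V" using m by (simp add: W_def)
        ultimately have "\<not> cohom_nz TYPE('k) (ind_cplx E W) (card W - p)" using nR by simp
        moreover have "mcplx E m = ind_cplx E W" using mcplx_chi[OF fin(1), of E] mW by simp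
        ultimately show ?thesis unfolding W_def[symmetric] by simp
      qed
    qed blast
    define h' where "h' S a = (if a = (0::nat) then h S else 0)" for S a
    have hK: "h' \<in> KC V 1 (Suc p)"
    proof (rule KCI)
      show "h' T \<in> free_mod V 1" for T using h(1) by (simp add: h'_def free_mod_def)
      show "h' T = (\<lambda>_. 0)" if "\<not> (T \<subseteq> V \<and> card T = Suc p)" for T using h(2)[OF that] by (auto simp: h'_def)
    qed
    show False
    proof (rule g(4)[OF hK])
      fix S
      have fm: "(\<lambda>a. g S a - kbd V h' S a) \<in> free_mod V 1"
        by (intro free_mod_diff KC_free_mod[OF g(1)] kbd_KC_free_mod[OF hK])
      moreover have "kbd V h' S 0 = kb V h S" by (simp add: kbd_kb h'_def)
      ultimately show "(\<lambda>a. g S a - kbd V h' S a) \<in> ?B"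
        using h(3)[of _ S] free_mod_polyring[OF fm, of 0] by (simp add: mono_ideal_def)
    qed
  qed
next
  assume ?R
  then obtain W where W: "W \<subseteq> V" "int (card W) = d" "p \<le> card W" and nz: "cohom_nz TYPE('k) (ind_cplx E W) (card W - p)" by blast
  have fin: "finite W" using W V finite_subset by auto
  have "ind_cplx E W \<subseteq> Pow W" by (auto simp: ind_cplx_def)
  from cohom_nz_bd[OF fin this W(3) nz] obtain c :: "'v set \<Rightarrow> 'k"
    where c: "\<And>T. T \<subseteq> W \<Longrightarrow> W - T \<in> ind_cplx E W \<Longrightarrow> Suc (card T) = p \<Longrightarrow> bd W c T = 0"
    "\<And>h. (\<And>S. S \<subseteq> W \<Longrightarrow> W - S \<in> ind_cplx E W \<Longrightarrow> card S = p \<Longrightarrow> c S = bd W h S) \<Longrightarrow> False" by metis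
  have kW: "keys (chi W) = W" by (rule keys_chi[OF fin])
  define q where "q S = (if S \<subseteq> W \<and> card S = p then single (chi (W - S)) (c S) else 0)" for S
  define g :: "'v set \<Rightarrow> nat \<Rightarrow> ('v, 'k) mpoly" where "g S a = (if a = 0 then q S else 0)" for S a
  have qV: "q S \<in> polyring V" for S
    using W fin by (auto simp: q_def polyring_def keys_chi split: if_splits)
  have gK: "g \<in> KC V 1 p"
  proof (rule KCI)
    show "g T \<in> free_mod V 1" for T using qV by (simp add: g_def free_mod_def)
    show "g T = (\<lambda>_. 0)" if "\<not> (T \<subseteq> V \<and> card T = p)" for T
    proof -
      have "\<not> (T \<subseteq> W \<and> card T = p)" using that W(1) by blast
      hence "q T = 0" unfolding q_def by (rule if_not_P)
      thus ?thesis by (simp add: g_def fun_eq_iff)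
    qed
  qed
  have lq: "lookup (q S) (chi W - chi S) = c S" if "S \<subseteq> W" "card S = p" for S
    using that chi_diff[OF fin] by (simp add: q_def)
  have kbd0: "kbd V g T 0 = kb V q T" for T by (simp add: kbd_kb g_def)
  show "koszul_nz V 1 ?gd ?B p d"
  proof (rule koszul_nzI[OF gK])
    have "homogeneous_of (d - int p) (q S)" for S
    proof -
      have "card (W - S) = card W - p" if "S \<subseteq> W" "card S = p"
        using that fin by (simp add: card_Diff_subset finite_subset)
      thus ?thesis using W fin by (auto simp: q_def homogeneous_of_def mdeg_chi split: if_splits)
    qed
    thus "prj ?gd d p g = g" by (auto simp: prj_def g_def fun_eq_iff hcomp_eq_self_iff)
    show "kbd V g T \<in> ?B" for T
    proof -
      have fm: "kbd V g T \<in> free_mod V 1" by (rule kbd_KC_free_mod[OF gK])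
      have "\<not> indep E (keys u)" if u: "u \<in> keys (kb V q T)" for u
      proof
        assume ind: "indep E (keys u)"
        have "\<exists>v\<in>V - T. lookup (esgn T v * (mvar v * q (insert v T))) u \<noteq> 0"
          using u unfolding in_keys_iff kb_def lookup_sum by (meson sum.neutral)
        then obtain v where v: "v \<in> V - T" "lookup u v \<noteq> 0"
            "lookup (q (insert v T)) (u - single v 1) \<noteq> 0"
          by (auto simp: lookup_esgn_mult lookup_mvar_mult split: if_splits)
        hence T: "insert v T \<subseteq> W" "card (insert v T) = p" "u - single v 1 = chi (W - insert v T)"
          by (auto simp: q_def lookup_single when_def split: if_splits)
        have finT: "finite T" using T(1) fin finite_subset by auto
        have "u = (u - single v 1) + single v 1"
          using v(2) by (intro poly_mapping_eqI) (auto simp: lookup_add lookup_minus lookup_single when_def)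
        also have "\<dots> = chi (insert v (W - insert v T))"
          unfolding T(3) using fin by (subst chi_insert) auto
        also have "insert v (W - insert v T) = W - T" using T v by auto
        finally have u_eq: "u = chi (W - T)" .
        have TW: "T \<subseteq> W" using T by auto
        have "lookup (kb V q T) u = bd W (\<lambda>S. lookup (q S) (chi W - chi S)) T"
          using lookup_kb[OF V, of "chi W" T q] W(1) TW unfolding kW u_eq chi_diff[OF fin TW] by simp
        also have "\<dots> = bd W c T" unfolding bd_def
        proof (intro sum.cong refl)
          fix w assume "w \<in> W - T"
          thus "esgn T w * lookup (q (insert w T)) (chi W - chi (insert w T)) = esgn T w * c (insert w T)"
            using T v finT by (subst lq) auto
        qed
        also have "\<dots> = 0"
        proof (rule c(1)[OF TW])
          show "W - T \<in> ind_cplx E W" using ind fin by (simp add: ind_cplx_def u_eq keys_chi)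
          show "Suc (card T) = p" using T v finT by simp
        qed
        finally show False using u by (simp add: in_keys_iff)
      qed
      thus ?thesis using fm free_mod_polyring[OF fm, of 0] by (simp add: kbd0 mono_ideal_def)
    qed
    fix h assume h: "h \<in> KC V 1 (Suc p)" "\<And>S. (\<lambda>a. g S a - kbd V h S a) \<in> ?B"
    show False
    proof (rule c(2))
      fix S assume S: "S \<subseteq> W" "W - S \<in> ind_cplx E W" "card S = p"
      let ?u = "chi W - chi S"
      have "g S 0 - kbd V h S 0 \<in> mono_ideal V E" using h(2)[of S] by simp
      moreover have "indep E (keys ?u)"
        using S fin by (simp add: chi_diff keys_chi ind_cplx_def)
      ultimately have "?u \<notin> keys (q S - kb V (\<lambda>S. h S 0) S)"
        by (auto simp: mono_ideal_def g_def kbd_kb)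
      hence "lookup (q S) ?u = lookup (kb V (\<lambda>S. h S 0) S) ?u"
        by (simp add: in_keys_iff lookup_minus)
      thus "c S = bd W (\<lambda>S. lookup (h S 0) (chi W - chi S)) S"
        using lookup_kb[OF V, of "chi W" S "\<lambda>S. h S 0"] W(1) S lq[OF S(1,3)] unfolding kW by simp
    qed
  qed
qed

lemma edge_ideal_mono_ideal:
  "fin_simple_graph G \<Longrightarrow> edge_ideal G = mono_ideal (verts G) (edges G)"
  by (rule set_eqI) (simp add: edge_ideal_iff mono_ideal_def)

lemma dmap_mat_map: "dmap F i = mat_map (rnk F i) (rnk F (i + 1)) (dmat F i)"
  by (simp add: dmap_def mat_map_def fun_eq_iff)

lemma augmap_mat_map: "mat_map 1 (rnk F 0) (\<lambda>_. aug F) w = (\<lambda>a. if a = 0 then augmap F w else 0)"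
  by (simp add: augmap_def mat_map_def fun_eq_iff mult.commute)

lemma betti_iff:
  fixes F :: "('v, 'k::field) free_cplx"
  assumes G: "fin_simple_graph G" and F: "minimal_graded_free_resolution (verts G) (edge_ideal G) F"
  shows "betti F i d \<noteq> 0 \<longleftrightarrow> (\<exists>W\<subseteq>verts G. int (card W) = d \<and> i \<le> card W \<and>
    cohom_nz TYPE('k) (ind_cplx (edges G) W) (card W - i))"
proof -
  let ?V = "verts G"
  let ?I = "mono_ideal ?V (edges G) :: ('v, 'k) mpoly set"
  have V: "finite ?V" using G by (simp add: fin_simple_graph_def)
  have I: "edge_ideal G = ?I" by (rule edge_ideal_mono_ideal[OF G])
  note F' = F[unfolded minimal_graded_free_resolution_def I]
  note res = conjunct1[OF F', unfolded graded_free_resolution_def]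
  note cplx = conjunct1[OF res, unfolded graded_free_cplx_def]
  have min: "lookup (dmat F i a b) 0 = 0" if "a < rnk F i" "b < rnk F (i + 1)" for i a b
    using conjunct2[OF F', rule_format] that .
  have dV: "dmat F i a b \<in> polyring ?V" if "a < rnk F i" "b < rnk F (i + 1)" for i a b
    using conjunct1[OF cplx, rule_format] that .
  have dh: "homogeneous_of (gdeg F (i + 1) b - gdeg F i a) (dmat F i a b)"
    if "a < rnk F i" "b < rnk F (i + 1)" for i a b
    using conjunct1[OF conjunct2[OF cplx], rule_format] that .
  have aV: "aug F a \<in> polyring ?V" and ah: "homogeneous_of (gdeg F 0 a) (aug F a)" if "a < rnk F 0" for a
    using conjunct2[OF conjunct2[OF cplx], rule_format, OF that] by simp_all
  have sur: "\<exists>w\<in>free_mod ?V (rnk F 0). p - augmap F w \<in> ?I" if "p \<in> polyring ?V" for p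
    using conjunct1[OF conjunct2[OF res], rule_format, OF that] .
  have ex0: "{w \<in> free_mod ?V (rnk F 0). augmap F w \<in> ?I} = dmap F 0 ` free_mod ?V (rnk F 1)"
    using conjunct1[OF conjunct2[OF conjunct2[OF res]]] .
  have ex: "{w \<in> free_mod ?V (rnk F (i + 1)). dmap F i w = (\<lambda>_. 0)} = dmap F (i + 1) ` free_mod ?V (rnk F (i + 2))" for i
    using conjunct2[OF conjunct2[OF conjunct2[OF res]], rule_format] .
  define B where "B i = dmap F i ` free_mod ?V (rnk F (i + 1))" for i
  have shift: "koszul_nz ?V (rnk F i) (gdeg F i) (B i) (Suc p) d \<longleftrightarrow>
      koszul_nz ?V (rnk F (i + 1)) (gdeg F (i + 1)) (B (i + 1)) p d" for i p
    unfolding B_def dmap_mat_map[of F i]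
  proof (rule koszul_nz_shift[OF V dV dh min])
    show "dmap F (i + 1) ` free_mod ?V (rnk F (i + 1 + 1)) =
      {w \<in> free_mod ?V (rnk F (i + 1)). mat_map (rnk F i) (rnk F (i + 1)) (dmat F i) w = (\<lambda>_. 0)}"
      using ex[of i] by (simp add: dmap_mat_map)
  qed
  have "koszul_nz ?V (rnk F i) (gdeg F i) (B i) p d \<longleftrightarrow> koszul_nz ?V (rnk F 0) (gdeg F 0) (B 0) (i + p) d" for p
  proof (induction i arbitrary: p)
    case (Suc i)
    show ?case using shift[of i p] Suc.IH[of "Suc p"] by simp
  qed simp
  from this[of 0] have 1: "koszul_nz ?V (rnk F i) (gdeg F i) (B i) 0 d \<longleftrightarrow> koszul_nz ?V (rnk F 0) (gdeg F 0) (B 0) i d"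
    by simp
  have 2: "koszul_nz ?V (rnk F i) (gdeg F i) (B i) 0 d \<longleftrightarrow> (\<exists>a<rnk F i. gdeg F i a = d)"
    unfolding B_def dmap_mat_map by (rule koszul_nz_0[OF V min])
  let ?B = "{w \<in> free_mod ?V 1. w 0 \<in> ?I}"
  have 3: "koszul_nz ?V 1 (\<lambda>_. 0) ?B i d \<longleftrightarrow> koszul_nz ?V (rnk F 0) (gdeg F 0) (B 0) i d"
  proof (rule koszul_nz_iso[OF V, of 1 "rnk F 0" "\<lambda>_. aug F"])
    show "aug F b \<in> polyring ?V" if "b < rnk F 0" for b using aV that .
    show "homogeneous_of (gdeg F 0 b - 0) (aug F b)" if "b < rnk F 0" for b using ah[OF that] by simp
    have mB: "mat_map 1 (rnk F 0) (\<lambda>_. aug F) w \<in> ?B \<longleftrightarrow> augmap F w \<in> ?I" if "w \<in> free_mod ?V (rnk F 0)" for w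
    proof -
      have "mat_map 1 (rnk F 0) (\<lambda>_. aug F) w \<in> free_mod ?V 1" by (intro mat_map_free_mod aV that)
      thus ?thesis using fun_cong[OF augmap_mat_map[of F w], of 0] by simp
    qed
    show "B 0 = {w \<in> free_mod ?V (rnk F 0). mat_map 1 (rnk F 0) (\<lambda>_. aug F) w \<in> ?B}"
      unfolding B_def add_0 ex0[symmetric] using mB by blast
    show "\<exists>w'\<in>free_mod ?V (rnk F 0). (\<lambda>a. w a - mat_map 1 (rnk F 0) (\<lambda>_. aug F) w' a) \<in> ?B" if w: "w \<in> free_mod ?V 1" for w
    proof -
      have "w 0 \<in> polyring ?V" using w by (rule free_mod_polyring)
      from sur[OF this] obtain w' where w': "w' \<in> free_mod ?V (rnk F 0)" "w 0 - augmap F w' \<in> ?I" by blast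
      have "mat_map 1 (rnk F 0) (\<lambda>_. aug F) w' \<in> free_mod ?V 1"
        using w'(1) by (intro mat_map_free_mod aV)
      hence "(\<lambda>a. w a - mat_map 1 (rnk F 0) (\<lambda>_. aug F) w' a) \<in> free_mod ?V 1" using w by (intro free_mod_diff)
      thus ?thesis using w' by (intro bexI[of _ w'] CollectI conjI) (simp_all add: augmap_mat_map[unfolded One_nat_def])
    qed
    show "(\<lambda>_. 0) \<in> ?B" by simp
    show "(\<lambda>a. w a - w' a) \<in> ?B" if "w \<in> ?B" "w' \<in> ?B" for w w'
      using that by (simp add: free_mod_diff mono_ideal_diff)
    show "kbd ?V q T \<in> ?B" if q: "\<And>S. q S \<in> ?B" for q T
    proof -
      have qf: "q S \<in> free_mod ?V 1" and qI: "q S 0 \<in> ?I" for S using q[of S] by simp_all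
      have "kbd ?V q T \<in> free_mod ?V 1" by (intro kbd_free_mod qf)
      moreover have "kbd ?V q T 0 \<in> ?I" unfolding kbd_def
        by (intro mono_ideal_sum mono_ideal_mult polyring_esgn polyring_mvar qI) auto
      ultimately show ?thesis by simp
    qed
    show "prj (\<lambda>_. 0) d p q T \<in> ?B" if q: "\<And>S. q S \<in> ?B" for q T d p
      using q[of T] by (auto simp: prj_def free_mod_def hcomp_polyring mono_ideal_hcomp)
  qed
  have "betti F i d \<noteq> 0 \<longleftrightarrow> (\<exists>a<rnk F i. gdeg F i a = d)" by (auto simp: betti_def)
  also have "\<dots> \<longleftrightarrow> koszul_nz ?V 1 (\<lambda>_. 0) ?B i d" using 1 2 3 by blast
  finally show ?thesis unfolding hochster[OF V] .
qed

section \<open>Nonvanishing cohomology of independence complexes\<close>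

definition nbh :: "'v set set \<Rightarrow> 'v \<Rightarrow> 'v set" where
  "nbh E x = insert x {w. {x, w} \<in> E}"

definition dominated :: "'v set set \<Rightarrow> 'v set \<Rightarrow> 'v \<Rightarrow> 'v \<Rightarrow> bool" where
  "dominated E W x y \<longleftrightarrow> x \<in> W \<and> y \<in> W \<and> {x, y} \<in> E \<and> W \<inter> nbh E y \<subseteq> nbh E x"

definition ipath :: "'v set set \<Rightarrow> 'v list \<Rightarrow> bool" where
  "ipath E xs \<longleftrightarrow> distinct xs \<and> (\<forall>i<length xs. \<forall>j<length xs. {xs ! i, xs ! j} \<in> E \<longleftrightarrow> j = Suc i \<or> i = Suc j)"

definition icyc :: "'v set set \<Rightarrow> 'v \<Rightarrow> 'v list \<Rightarrow> bool" where
  "icyc E z xs \<longleftrightarrow> ipath E xs \<and> z \<notin> set xs \<and> 2 \<le> length xs \<and>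
     (\<forall>i<length xs. {z, xs ! i} \<in> E \<longleftrightarrow> i = 0 \<or> Suc i = length xs)"

lemma ipath_Cons: "ipath E (x # xs) \<Longrightarrow> ipath E xs"
  unfolding ipath_def
proof (intro conjI allI impI)
  assume *: "distinct (x # xs) \<and> (\<forall>i<length (x # xs). \<forall>j<length (x # xs).
    ({(x # xs) ! i, (x # xs) ! j} \<in> E) = (j = Suc i \<or> i = Suc j))"
  thus "distinct xs" by simp
  fix i j assume "i < length xs" "j < length xs"
  thus "({xs ! i, xs ! j} \<in> E) = (j = Suc i \<or> i = Suc j)"
    using *[THEN conjunct2, rule_format, of "Suc i" "Suc j"] by simp
qed

lemma ipath_drop: "ipath E xs \<Longrightarrow> ipath E (drop i xs)"
proof (induction i arbitrary: xs)
  case (Suc i)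
  thus ?case by (cases xs) (auto dest: ipath_Cons)
qed simp

lemma ipath_take: "ipath E xs \<Longrightarrow> ipath E (take i xs)"
  by (simp add: ipath_def)

lemma ipath_nbh_0:
  assumes "ipath E (x # xs)" shows "set (x # xs) \<inter> nbh E x = set (take 2 (x # xs))"
proof -
  have *: "{x, xs ! i} \<in> E \<longleftrightarrow> i = 0" if "i < length xs" for i
    using assms that unfolding ipath_def by (metis (no_types, lifting) One_nat_def Suc_inject Suc_less_eq Zero_not_Suc length_Cons nth_Cons_0 nth_Cons_Suc zero_less_Suc)
  have 1: "{x, x} \<notin> E" using assms unfolding ipath_def
    by (metis length_Cons n_not_Suc_n nth_Cons_0 zero_less_Suc)
  show ?thesis
  proof (cases xs)
    case Nil thus ?thesis by (auto simp: nbh_def)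
  next
    case (Cons y ys)
    have "{x, y} \<in> E" using *[of 0] Cons by simp
    moreover have "{x, w} \<notin> E" if w: "w \<in> set ys" for w
    proof -
      obtain i where "i < length ys" "w = ys ! i" using w by (metis in_set_conv_nth)
      thus ?thesis using *[of "Suc i"] Cons by simp
    qed
    ultimately show ?thesis using Cons 1 by (auto simp: nbh_def)
  qed
qed

lemma ipath_nbh_1:
  assumes "ipath E (x # y # xs)" shows "set (x # y # xs) \<inter> nbh E y = set (take 3 (x # y # xs))"
proof -
  have "set (y # xs) \<inter> nbh E y = set (take 2 (y # xs))"
    by (rule ipath_nbh_0[OF ipath_Cons[OF assms]])
  moreover have "{x, y} \<in> E"
    using assms[unfolded ipath_def, THEN conjunct2, rule_format, of 0 1] by simp
  hence "x \<in> nbh E y" by (simp add: nbh_def insert_commute)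
  ultimately show ?thesis by auto
qed

text \<open>\<open>P W j\<close> abstracts the nonvanishing of the reduced cohomology in degree \<open>j - 1\<close> of the
  independence complex of the subgraph induced on \<open>W\<close>.\<close>

locale hochster_pred =
  fixes E :: "'v set set" and P :: "'v set \<Rightarrow> nat \<Rightarrow> bool"
  assumes edge_card: "e \<in> E \<Longrightarrow> card e = 2"
    and P_empty: "P {} j \<longleftrightarrow> j = 0"
    and P_0: "finite W \<Longrightarrow> W \<noteq> {} \<Longrightarrow> \<not> P W 0"
    and P_isolated: "finite W \<Longrightarrow> v \<in> W \<Longrightarrow> W \<inter> nbh E v \<subseteq> {v} \<Longrightarrow> \<not> P W j"
    and P_split: "finite W \<Longrightarrow> x \<in> W \<Longrightarrow> P W (Suc j) \<Longrightarrow> P (W - {x}) (Suc j) \<or> P (W - nbh E x) j"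
    and P_dominated: "finite W \<Longrightarrow> dominated E W x y \<Longrightarrow> P (W - nbh E x) j \<Longrightarrow> P W (Suc j)"
begin

definition sizes :: "'v set \<Rightarrow> nat \<Rightarrow> nat set" where
  "sizes V j = {card W | W. W \<subseteq> V \<and> P W j}"

definition size_convex :: "'v set \<Rightarrow> bool" where
  "size_convex V \<longleftrightarrow> (\<forall>j a b c. a \<in> sizes V j \<longrightarrow> b \<in> sizes V j \<longrightarrow> a \<le> c \<longrightarrow> c \<le> b \<longrightarrow> c \<in> sizes V j)"

lemma sizesI: "W \<subseteq> V \<Longrightarrow> P W j \<Longrightarrow> card W \<in> sizes V j"
  by (auto simp: sizes_def)

lemma edge_neq: "{x, y} \<in> E \<Longrightarrow> x \<noteq> y"
  using edge_card[of "{x, y}"] by auto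

lemma P_neighbour:
  assumes "finite W" "P W j" "x \<in> W"
  obtains y where "y \<in> W" "{x, y} \<in> E" "x \<noteq> y"
proof -
  have "\<not> W \<inter> nbh E x \<subseteq> {x}" using P_isolated assms by blast
  then obtain y where "y \<in> W" "y \<in> nbh E x" "y \<noteq> x" by blast
  thus ?thesis using that[of y] by (auto simp: nbh_def)
qed

lemma P_low: "finite W \<Longrightarrow> P W j \<Longrightarrow> 2 * j \<le> card W"
proof (induction "card W" arbitrary: W j rule: less_induct)
  case less
  show ?case
  proof (cases j)
    case (Suc i)
    have "W \<noteq> {}" using less.prems Suc P_empty by auto
    then obtain x where x: "x \<in> W" by blast
    obtain y where y: "y \<in> W" "{x, y} \<in> E" "x \<noteq> y" using P_neighbour[OF less.prems x] .
    from P_split[OF less.prems(1) x] less.prems(2) Suc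
    have "P (W - {x}) j \<or> P (W - nbh E x) i" by simp
    thus ?thesis
    proof
      assume P: "P (W - {x}) j"
      have "card (W - {x}) < card W" by (rule card_Diff1_less[OF less.prems(1) x])
      from less.hyps[OF this _ P] this less.prems(1) show ?thesis by simp
    next
      assume P: "P (W - nbh E x) i"
      have sub: "insert x (insert y (W - nbh E x)) \<subseteq> W" using x y by auto
      have "x \<notin> W - nbh E x" "y \<notin> W - nbh E x" using y by (auto simp: nbh_def)
      hence "card (insert x (insert y (W - nbh E x))) = card (W - nbh E x) + 2"
        using y less.prems(1) by simp
      hence c: "card (W - nbh E x) + 2 \<le> card W" using card_mono[OF less.prems(1) sub] by simp
      have "2 * i \<le> card (W - nbh E x)" by (rule less.hyps[OF _ _ P]) (use c less.prems(1) in auto)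
      thus ?thesis using c Suc by simp
    qed
  qed simp
qed

lemma P_full:
  assumes "finite W" "P W j" "2 * j \<le> s" "s \<le> card W"
    and "\<And>U x y. U \<subseteq> W \<Longrightarrow> x \<in> U \<Longrightarrow> y \<in> U \<Longrightarrow> {x, y} \<in> E \<Longrightarrow>
      (\<exists>x y. dominated E U x y) \<or> (\<forall>j. P U j \<longrightarrow> (\<exists>v\<in>U. P (U - {v}) j))"
  shows "\<exists>U\<subseteq>W. card U = s \<and> P U j"
  using assms
proof (induction "card W" arbitrary: W j s rule: less_induct)
  case less
  note fin = less.prems(1) and H = less.prems(5)
  show ?case
  proof (cases "s = card W")
    case True thus ?thesis using less.prems by blast
  next
    case False
    hence s: "s < card W" using less.prems by simp
    hence "W \<noteq> {}" by auto
    then obtain x0 where x0: "x0 \<in> W" by blast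
    obtain y0 where y0: "y0 \<in> W" "{x0, y0} \<in> E" using P_neighbour[OF fin less.prems(2) x0] .
    have "\<exists>i. j = Suc i" using P_0[OF fin \<open>W \<noteq> {}\<close>] less.prems(2) by (cases j) auto
    then obtain i where j: "j = Suc i" by blast
    have rec: "\<exists>U\<subseteq>W'. card U = t \<and> P U k" if "W' \<subset> W" "P W' k" "2 * k \<le> t" "t \<le> card W'" for W' k t
    proof (rule less.hyps)
      show "card W' < card W" using that fin psubset_card_mono by blast
      show "finite W'" using that fin finite_subset by blast
      show "(\<exists>x y. dominated E U x y) \<or> (\<forall>j. P U j \<longrightarrow> (\<exists>v\<in>U. P (U - {v}) j))"
        if "U \<subseteq> W'" "x \<in> U" "y \<in> U" "{x, y} \<in> E" for U x y
        using H[of U x y] that \<open>W' \<subset> W\<close> by blast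
    qed (use that in auto)
    have del: ?thesis if v: "v \<in> W" "P (W - {v}) j" for v
    proof -
      have "W - {v} \<subset> W" "s \<le> card (W - {v})" using v fin s by auto
      from rec[OF this(1) v(2) less.prems(3) this(2)] show ?thesis by blast
    qed
    from H[OF order.refl x0 y0] show ?thesis
    proof
      assume "\<forall>j. P W j \<longrightarrow> (\<exists>v\<in>W. P (W - {v}) j)"
      thus ?thesis using less.prems(2) del by blast
    next
      assume "\<exists>x y. dominated E W x y"
      then obtain x y where d: "dominated E W x y" by blast
      hence xy: "x \<in> W" "y \<in> W" "{x, y} \<in> E" "W \<inter> nbh E y \<subseteq> nbh E x" by (auto simp: dominated_def)
      have neq: "x \<noteq> y" using edge_neq xy by blast
      define R where "R = W - nbh E x"
      define B where "B = W \<inter> nbh E x - {x, y}"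
      have ynb: "y \<in> nbh E x" "x \<in> nbh E x" using xy by (auto simp: nbh_def)
      have dU: "dominated E (insert x (insert y U)) x y" if "U \<subseteq> W" for U
        using xy that by (auto simp: dominated_def)
      have finR: "finite R" "finite B" using fin by (auto simp: R_def B_def)
      have RW: "R \<subset> W" using xy ynb by (auto simp: R_def)
      have "W = insert x (insert y (R \<union> B))" using xy by (auto simp: R_def B_def)
      moreover have "card (insert x (insert y (R \<union> B))) = card R + card B + 2"
      proof -
        have "x \<notin> R \<union> B" "y \<notin> R \<union> B" "R \<inter> B = {}" using ynb by (auto simp: R_def B_def)
        thus ?thesis using finR neq by (simp add: card_Un_disjoint)
      qed
      ultimately have cW: "card W = card R + card B + 2" by simp
      from P_split[OF fin xy(1)] less.prems(2) j have "P (W - {x}) j \<or> P R i" by (simp add: R_def)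
      thus ?thesis
      proof
        assume "P (W - {x}) j" thus ?thesis using del xy by blast
      next
        assume PR: "P R i"
        show ?thesis
        proof (cases "card R + 2 \<le> s")
          case True
          have "s - (card R + 2) \<le> card B" using cW s by simp
          then obtain S where S: "S \<subseteq> B" "card S = s - (card R + 2)" using obtain_subset_with_card_n by metis
          define U where "U = insert x (insert y (R \<union> S))"
          have "U \<subseteq> W" using S xy by (auto simp: U_def R_def B_def)
          have finU: "finite U" using \<open>U \<subseteq> W\<close> fin finite_subset by blast
          have "U - nbh E x = R" using ynb S by (auto simp: U_def R_def B_def)
          moreover have "dominated E U x y" unfolding U_def using S by (intro dU) (auto simp: R_def B_def)
          ultimately have "P U j" using P_dominated[OF finU] PR j by metis
          moreover have "card U = s"
          proof -
            have "x \<notin> R \<union> S" "y \<notin> R \<union> S" "R \<inter> S = {}" "finite S"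
              using ynb S finR finite_subset by (auto simp: R_def B_def)
            thus ?thesis using finR neq S True by (simp add: U_def card_Un_disjoint)
          qed
          ultimately show ?thesis using \<open>U \<subseteq> W\<close> by blast
        next
          case False
          have "2 * i \<le> s - 2" "s - 2 \<le> card R" using less.prems(3) j False by auto
          from rec[OF RW PR this] obtain T where T: "T \<subseteq> R" "card T = s - 2" "P T i" by blast
          define U where "U = insert x (insert y T)"
          have "U \<subseteq> W" using T xy by (auto simp: U_def R_def)
          have finU: "finite U" using \<open>U \<subseteq> W\<close> fin finite_subset by blast
          have "U - nbh E x = T" using ynb T by (auto simp: U_def R_def)
          moreover have "dominated E U x y" unfolding U_def using T by (intro dU) (auto simp: R_def)
          ultimately have "P U j" using P_dominated[OF finU] T j by metis
          moreover have "card U = s"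
          proof -
            have "x \<notin> T" "y \<notin> T" "finite T"
              using ynb T finR finite_subset by (auto simp: R_def)
            thus ?thesis using neq T j less.prems(3) by (simp add: U_def)
          qed
          ultimately show ?thesis using \<open>U \<subseteq> W\<close> by blast
        qed
      qed
    qed
  qed
qed

lemma size_convex_full:
  assumes "finite V"
    and "\<And>U x y. U \<subseteq> V \<Longrightarrow> x \<in> U \<Longrightarrow> y \<in> U \<Longrightarrow> {x, y} \<in> E \<Longrightarrow>
      (\<exists>x y. dominated E U x y) \<or> (\<forall>j. P U j \<longrightarrow> (\<exists>v\<in>U. P (U - {v}) j))"
  shows "size_convex V"
  unfolding size_convex_def
proof (intro allI impI)
  fix j a b c assume "a \<in> sizes V j" "b \<in> sizes V j" "a \<le> c" "c \<le> b"
  then obtain A B where AB: "A \<subseteq> V" "P A j" "card A = a" "B \<subseteq> V" "P B j" "card B = b" by (auto simp: sizes_def)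
  have fin: "finite A" "finite B" using AB assms(1) finite_subset by blast+
  have "2 * j \<le> c" using P_low[OF fin(1) AB(2)] AB \<open>a \<le> c\<close> by simp
  have "\<exists>U\<subseteq>B. card U = c \<and> P U j"
  proof (rule P_full[OF fin(2) AB(5) \<open>2 * j \<le> c\<close>])
    show "c \<le> card B" using AB \<open>c \<le> b\<close> by simp
    show "(\<exists>x y. dominated E U x y) \<or> (\<forall>j. P U j \<longrightarrow> (\<exists>v\<in>U. P (U - {v}) j))"
      if "U \<subseteq> B" "x \<in> U" "y \<in> U" "{x, y} \<in> E" for U x y
      using assms(2)[of U x y] that AB by blast
  qed
  thus "c \<in> sizes V j" using AB unfolding sizes_def by blast
qed

lemma sizes_1_convex:
  assumes "finite W" "P W 1" "2 \<le> s" "s \<le> card W"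
  shows "\<exists>U\<subseteq>W. card U = s \<and> P U 1"
  using assms
proof (induction "card W" arbitrary: W rule: less_induct)
  case less
  show ?case
  proof (cases "s = card W")
    case True thus ?thesis using less.prems by blast
  next
    case False
    hence s: "s < card W" using less.prems by simp
    have "\<exists>v\<in>W. P (W - {v}) 1"
    proof -
      have "W \<noteq> {}" using s by auto
      then obtain x where x: "x \<in> W" by blast
      from P_split[OF less.prems(1) x] less.prems(2) have "P (W - {x}) 1 \<or> P (W - nbh E x) 0" by simp
      thus ?thesis
      proof
        assume P0: "P (W - nbh E x) 0"
        hence sub: "W - nbh E x = {}" using P_0[of "W - nbh E x"] less.prems(1) by blast
        have "2 \<le> card (W - {x})" using s less.prems x by simp
        then obtain T where "T \<subseteq> W - {x}" "card T = 2" using obtain_subset_with_card_n by metis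
        then obtain y y' where y: "y \<in> W" "y' \<in> W" "y \<noteq> y'" "y \<noteq> x" "y' \<noteq> x" by (auto simp: card_2_iff)
        have "{x, y'} \<in> E" using y sub by (auto simp: nbh_def)
        hence "dominated E (W - {y}) x y'" using x y sub by (auto simp: dominated_def)
        moreover have "P ((W - {y}) - nbh E x) 0"
        proof -
          have e: "W - {y} - nbh E x = {}" using sub by auto
          show ?thesis unfolding e by (simp add: P_empty)
        qed
        ultimately have "P (W - {y}) 1" using P_dominated[of "W - {y}" x y' 0] less.prems(1) by simp
        thus ?thesis using y by blast
      qed (use x in blast)
    qed
    then obtain v where v: "v \<in> W" "P (W - {v}) 1" by blast
    have "\<exists>U\<subseteq>W - {v}. card U = s \<and> P U 1"
      by (rule less.hyps) (use v less.prems s in \<open>auto simp: card_gt_0_iff\<close>)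
    thus ?thesis by blast
  qed
qed

lemma size_convex_cone:
  assumes V: "finite V" "x \<notin> V" and indep: "\<And>u v. u \<in> V - nbh E x \<Longrightarrow> v \<in> V - nbh E x \<Longrightarrow> {u, v} \<notin> E"
    and size_convex: "size_convex V"
  shows "size_convex (insert x V)"
  unfolding size_convex_def
proof (intro allI impI)
  fix j a b c assume ab: "a \<in> sizes (insert x V) j" "b \<in> sizes (insert x V) j" "a \<le> c" "c \<le> b"
  obtain A B where AB: "A \<subseteq> insert x V" "P A j" "card A = a" "B \<subseteq> insert x V" "P B j" "card B = b"
    using ab by (auto simp: sizes_def)
  have fin: "finite A" "finite B" using AB V(1) finite_subset by blast+
  consider "j = 0" | "j = 1" | i where "j = Suc (Suc i)" by (metis One_nat_def not0_implies_Suc)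
  thus "c \<in> sizes (insert x V) j"
  proof cases
    case 1
    hence "B = {}" using P_0[OF fin(2)] AB by blast
    hence "c = a" using AB ab by simp
    thus ?thesis using ab by simp
  next
    case 2
    have "2 \<le> c" using P_low[OF fin(1) AB(2)] AB ab 2 by simp
    hence "\<exists>U\<subseteq>B. card U = c \<and> P U 1" using sizes_1_convex[OF fin(2)] AB ab 2 by simp
    thus ?thesis using AB 2 unfolding sizes_def by blast
  next
    case 3
    have red: "\<exists>n\<in>sizes V j. n \<le> card W \<and> card W \<le> Suc n" if W: "W \<subseteq> insert x V" "P W j" for W
    proof (cases "x \<in> W")
      case False
      hence "card W \<in> sizes V j" using W by (intro sizesI) auto
      thus ?thesis by auto
    next
      case True
      have finW: "finite W" using W V(1) finite_subset by blast
      have "\<not> P (W - nbh E x) (Suc i)"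
      proof
        assume P: "P (W - nbh E x) (Suc i)"
        have "W - nbh E x \<noteq> {}"
        proof
          assume e: "W - nbh E x = {}"
          show False using P unfolding e by (simp add: P_empty)
        qed
        then obtain u where u: "u \<in> W - nbh E x" by blast
        obtain v where "v \<in> W - nbh E x" "{u, v} \<in> E" using P_neighbour[OF _ P u] finW by blast
        moreover have "W - nbh E x \<subseteq> V - nbh E x" using W by (auto simp: nbh_def)
        ultimately show False using u indep by blast
      qed
      hence "P (W - {x}) j" using P_split[OF finW True] W(2) 3 by blast
      hence "card (W - {x}) \<in> sizes V j" using W by (intro sizesI) auto
      thus ?thesis using True finW by (intro bexI[of _ "card (W - {x})"]) (auto simp: card_gt_0_iff)
    qed
    obtain a' where a': "a' \<in> sizes V j" "a' \<le> a" "a \<le> Suc a'" using red AB by blast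
    obtain b' where b': "b' \<in> sizes V j" "b' \<le> b" "b \<le> Suc b'" using red AB by blast
    show ?thesis
    proof (cases "c = b")
      case True thus ?thesis using ab by simp
    next
      case False
      hence "c \<in> sizes V j" using size_convex a' b' ab unfolding size_convex_def by (meson le_antisym le_trans not_less_eq_eq)
      thus ?thesis unfolding sizes_def by blast
    qed
  qed
qed

end

lemma ipath_diff_nbh_1:
  assumes "ipath E (a # b # r)"
  shows "set (a # b # r) - nbh E b = set (tl r)"
proof -
  have "set (a # b # r) \<inter> nbh E b = set (take 3 (a # b # r))" by (rule ipath_nbh_1[OF assms])
  moreover have "distinct (a # b # r)" using assms by (simp add: ipath_def)
  ultimately show ?thesis by (cases r) auto
qed

definition cyc :: "'v set set \<Rightarrow> nat \<Rightarrow> (nat \<Rightarrow> 'v) \<Rightarrow> bool" where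
  "cyc E n f \<longleftrightarrow> 3 \<le> n \<and> inj_on f {..<n} \<and>
     (\<forall>i<n. \<forall>j<n. {f i, f j} \<in> E \<longleftrightarrow> j = Suc i mod n \<or> i = Suc j mod n)"

lemma cyc_adj: "cyc E n f \<Longrightarrow> i < n \<Longrightarrow> j < n \<Longrightarrow> {f i, f j} \<in> E \<longleftrightarrow> j = Suc i mod n \<or> i = Suc j mod n"
  by (simp add: cyc_def)

lemma cyc_rotate1:
  assumes "cyc E n f" shows "cyc E n (\<lambda>i. f (Suc i mod n))" "(\<lambda>i. f (Suc i mod n)) ` {..<n} = f ` {..<n}"
proof -
  have n: "3 \<le> n" and inj: "inj_on f {..<n}" using assms by (auto simp: cyc_def)
  have inj1: "inj_on (\<lambda>i. Suc i mod n) {..<n}"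
    by (auto simp: inj_on_def mod_Suc split: if_splits)
  have im: "(\<lambda>i. Suc i mod n) ` {..<n} = {..<n}"
    by (rule endo_inj_surj[OF _ _ inj1]) (use n in auto)
  show "(\<lambda>i. f (Suc i mod n)) ` {..<n} = f ` {..<n}" using im by (metis image_image)
  show "cyc E n (\<lambda>i. f (Suc i mod n))" unfolding cyc_def
  proof (intro conjI allI impI n)
    show "inj_on (\<lambda>i. f (Suc i mod n)) {..<n}"
      using comp_inj_on[OF inj1, of f] inj im by (simp add: comp_def)
    fix i j assume ij: "i < n" "j < n"
    have "({f (Suc i mod n), f (Suc j mod n)} \<in> E) \<longleftrightarrow>
       Suc j mod n = Suc (Suc i mod n) mod n \<or> Suc i mod n = Suc (Suc j mod n) mod n"
      using n by (intro cyc_adj[OF assms]) auto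
    thus "({f (Suc i mod n), f (Suc j mod n)} \<in> E) = (j = Suc i mod n \<or> i = Suc j mod n)"
      using ij n by (auto simp: mod_Suc split: if_splits)
  qed
qed

lemma cyc_rotate:
  assumes "cyc E n f" "v \<in> f ` {..<n}"
  obtains g where "cyc E n g" "g ` {..<n} = f ` {..<n}" "g 0 = v"
proof -
  have "\<exists>g. cyc E n g \<and> g ` {..<n} = f ` {..<n} \<and> g 0 = f k" if "cyc E n f" "k < n" for k f
    using that
  proof (induction k arbitrary: f)
    case (Suc k)
    have "\<exists>g. cyc E n g \<and> g ` {..<n} = (\<lambda>i. f (Suc i mod n)) ` {..<n} \<and> g 0 = f (Suc k mod n)"
      using Suc.prems by (intro Suc.IH cyc_rotate1) auto
    thus ?case using cyc_rotate1(2)[OF Suc.prems(1)] Suc.prems(2) by simp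
  qed blast
  thus ?thesis using assms that by blast
qed

lemma cyc_icyc:
  assumes "cyc E n f"
  shows "icyc E (f 0) (map f [1..<n])" "insert (f 0) (set (map f [1..<n])) = f ` {..<n}"
proof -
  have n: "3 \<le> n" and inj: "inj_on f {..<n}" using assms by (auto simp: cyc_def)
  have adj: "{f i, f j} \<in> E \<longleftrightarrow> j = Suc i mod n \<or> i = Suc j mod n" if "i < n" "j < n" for i j
    using assms that by (auto simp: cyc_def)
  have inj': "f i = f j \<longleftrightarrow> i = j" if "i < n" "j < n" for i j
    using inj that by (auto simp: inj_on_def)
  show "icyc E (f 0) (map f [1..<n])"
    unfolding icyc_def ipath_def
  proof (intro conjI allI impI)
    have "inj_on f {1..<n}" by (rule inj_on_subset[OF inj]) auto
    thus "distinct (map f [1..<n])" by (simp add: distinct_map)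
    show "f 0 \<notin> set (map f [1..<n])"
    proof
      assume "f 0 \<in> set (map f [1..<n])"
      then obtain x where "1 \<le> x" "x < n" "f 0 = f x" by auto
      thus False using inj'[of 0 x] by simp
    qed
    show "2 \<le> length (map f [1..<n])" using n by simp
    fix i assume i: "i < length (map f [1..<n])"
    hence fi: "map f [1..<n] ! i = f (Suc i)" and i': "Suc i < n" by auto
    have m: "Suc (Suc i) mod n = (if Suc (Suc i) = n then 0 else Suc (Suc i))" using i' by (simp add: mod_Suc)
    show "({f 0, map f [1..<n] ! i} \<in> E) = (i = 0 \<or> Suc i = length (map f [1..<n]))"
      unfolding fi using i' n adj[of 0 "Suc i"] m by (cases "Suc (Suc i) = n") auto
    fix j assume j: "j < length (map f [1..<n])"
    hence fj: "map f [1..<n] ! j = f (Suc j)" and j': "Suc j < n" by auto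
    have mj: "Suc (Suc j) mod n = (if Suc (Suc j) = n then 0 else Suc (Suc j))" using j' by (simp add: mod_Suc)
    show "({map f [1..<n] ! i, map f [1..<n] ! j} \<in> E) = (j = Suc i \<or> i = Suc j)"
      unfolding fi fj adj[OF i' j'] m mj using i' j' by (cases "Suc (Suc i) = n"; cases "Suc (Suc j) = n") auto
  qed
  show "insert (f 0) (set (map f [1..<n])) = f ` {..<n}"
  proof -
    have "{..<n} = insert 0 {1..<n}" using n by auto
    hence "f ` {..<n} = insert (f 0) (f ` {1..<n})" by (metis image_insert)
    thus ?thesis by simp
  qed
qed

lemma icyc_cyc:
  assumes "icyc E z xs" and nl: "\<And>x. {x} \<notin> E"
  shows "cyc E (Suc (length xs)) ((!) (z # xs))" "(!) (z # xs) ` {..<Suc (length xs)} = insert z (set xs)"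
proof -
  let ?n = "Suc (length xs)"
  have n: "3 \<le> ?n" and d: "distinct (z # xs)" using assms by (auto simp: icyc_def ipath_def)
  have p: "{xs ! i, xs ! j} \<in> E \<longleftrightarrow> j = Suc i \<or> i = Suc j" if "i < length xs" "j < length xs" for i j
    using assms that by (auto simp: icyc_def ipath_def)
  have c: "{z, xs ! i} \<in> E \<longleftrightarrow> i = 0 \<or> Suc i = length xs" if "i < length xs" for i
    using assms that by (auto simp: icyc_def)
  show "cyc E ?n ((!) (z # xs))" unfolding cyc_def
  proof (intro conjI allI impI n)
    show "inj_on ((!) (z # xs)) {..<?n}" using d by (intro inj_on_nth) auto
    fix i j assume ij: "i < ?n" "j < ?n"
    have ms: "Suc i mod ?n = (if i = length xs then 0 else Suc i)" "Suc j mod ?n = (if j = length xs then 0 else Suc j)"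
      using ij by (simp_all add: mod_Suc)
    have "({(z # xs) ! i, (z # xs) ! j} \<in> E) = (j = (if i = length xs then 0 else Suc i) \<or> i = (if j = length xs then 0 else Suc j))" (is ?G)
    proof (cases i; cases j)
      fix a b assume ab: "i = Suc a" "j = Suc b"
      hence q: "({(z # xs) ! i, (z # xs) ! j} \<in> E) \<longleftrightarrow> b = Suc a \<or> a = Suc b" using ij p[of a b] by simp
      show ?G
        unfolding q using ab ij by auto
    next
      fix b assume ab: "i = 0" "j = Suc b"
      hence q: "({(z # xs) ! i, (z # xs) ! j} \<in> E) \<longleftrightarrow> b = 0 \<or> Suc b = length xs" using ij c[of b] by simp
      show ?G
        unfolding q using ab ij n by auto
    next
      fix a assume ab: "i = Suc a" "j = 0"
      hence q: "({(z # xs) ! i, (z # xs) ! j} \<in> E) \<longleftrightarrow> a = 0 \<or> Suc a = length xs" using ij c[of a] by (simp add: insert_commute)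
      show ?G
        unfolding q using ab ij n by auto
    next
      assume ab: "i = 0" "j = 0"
      hence q: "({(z # xs) ! i, (z # xs) ! j} \<in> E) \<longleftrightarrow> False" using nl[of z] by simp
      show ?G
        unfolding q using ab n by auto
    qed
    thus "({(z # xs) ! i, (z # xs) ! j} \<in> E) = (j = Suc i mod ?n \<or> i = Suc j mod ?n)" unfolding ms .
  qed
  have "set (z # xs) = set (map ((!) (z # xs)) [0..<length (z # xs)])" by (simp only: map_nth)
  thus "(!) (z # xs) ` {..<?n} = insert z (set xs)" by (simp only: set_map set_upt atLeast0LessThan list.size list.set add_Suc_right add_0_right)
qed

lemma cyc_subset_eq:
  assumes f: "cyc E n f" and g: "cyc E m g" and sub: "f ` {..<n} \<subseteq> g ` {..<m}"
  shows "f ` {..<n} = g ` {..<m}"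
proof -
  let ?S = "f ` {..<n}"
  have n: "3 \<le> n" and inj: "inj_on f {..<n}" using f by (auto simp: cyc_def)
  have m: "3 \<le> m" and injg: "inj_on g {..<m}" using g by (auto simp: cyc_def)
  have gi: "g i = g j \<longleftrightarrow> i = j" if "i < m" "j < m" for i j using injg that by (auto simp: inj_on_def)
  have step: "g (Suc i mod m) \<in> ?S" if i: "i < m" "g i \<in> ?S" for i
  proof -
    obtain f' where f': "cyc E n f'" "f' ` {..<n} = ?S" "f' 0 = g i" using cyc_rotate[OF f i(2)] .
    have f'i: "inj_on f' {..<n}" using f' by (auto simp: cyc_def)
    have e1: "{f' 0, f' 1} \<in> E" using cyc_adj[OF f'(1), of 0 1] n by simp
    have e2: "{f' 0, f' (n - 1)} \<in> E" using cyc_adj[OF f'(1), of 0 "n - 1"] n by simp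
    have neq: "f' 1 \<noteq> f' (n - 1)"
    proof
      assume "f' 1 = f' (n - 1)"
      hence "1 = n - 1" by (rule inj_onD[OF f'i]) (use n in auto)
      thus False using n by simp
    qed
    have S: "f' 1 \<in> ?S" "f' (n - 1) \<in> ?S" using n unfolding f'(2)[symmetric] by auto
    then obtain a b where ab: "a < m" "f' 1 = g a" "b < m" "f' (n - 1) = g b" using sub by blast
    have "a = Suc i mod m \<or> i = Suc a mod m" "b = Suc i mod m \<or> i = Suc b mod m"
      using cyc_adj[OF g i(1) ab(1)] cyc_adj[OF g i(1) ab(3)] e1 e2 f'(3) ab by auto
    moreover have "a \<noteq> b" using neq ab by auto
    ultimately have "a = Suc i mod m \<or> b = Suc i mod m"
      using ab i m by (auto simp: mod_Suc split: if_splits)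
    thus ?thesis using S ab by auto
  qed
  have "0 < n" using n by simp
  hence "f 0 \<in> g ` {..<m}" using sub by blast
  then obtain g' where g': "g' < m" "f 0 = g g'" by blast
  have "g ((g' + t) mod m) \<in> ?S" for t
  proof (induction t)
    case 0
    have "f 0 \<in> ?S" using \<open>0 < n\<close> by simp
    thus ?case using g' by simp
  next
    case (Suc t)
    from step[OF _ Suc] m show ?case by (simp add: mod_Suc_eq)
  qed
  hence all: "g ((g' + (m - g' + i)) mod m) \<in> ?S" for i by blast
  have "g i \<in> ?S" if "i < m" for i
  proof -
    have "(g' + (m - g' + i)) mod m = i" using g'(1) that by simp
    thus ?thesis using all[of i] by simp
  qed
  thus ?thesis using sub by blast
qed

context hochster_pred
begin

lemma no_loop: "{x} \<notin> E"
  using edge_card[of "{x}"] by auto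

lemma P_Suc:
  assumes "finite W" "P W j" "W \<noteq> {}"
  obtains i where "j = Suc i"
  using assms P_0 by (cases j) blast+

lemma path_split:
  assumes p: "ipath E (a # b # r)" and W: "W \<subseteq> set (a # b # r)" "a \<in> W" "b \<in> W" and P: "P W (Suc i)"
  shows "P (W - nbh E b) i"
proof -
  have fin: "finite W" using W finite_subset by blast
  have "set (a # b # r) \<inter> nbh E a \<subseteq> {a, b}" using ipath_nbh_0[OF p] by auto
  hence "(W - {b}) \<inter> nbh E a \<subseteq> {a}" using W by blast
  moreover have "a \<in> W - {b}" using p W by (auto simp: ipath_def)
  ultimately have "\<not> P (W - {b}) (Suc i)" using P_isolated[of "W - {b}" a] fin by blast
  thus ?thesis using P_split[OF fin W(3) P] by blast
qed

lemma P_path_imp: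
  "ipath E xs \<Longrightarrow> P (set xs) j \<Longrightarrow> length xs = 3 * j \<or> Suc (length xs) = 3 * j"
proof (induction "length xs" arbitrary: xs j rule: less_induct)
  case less
  consider "xs = []" | a where "xs = [a]" | a b r where "xs = a # b # r" by (metis neq_Nil_conv)
  thus ?case
  proof cases
    case 1 thus ?thesis using less.prems P_empty by simp
  next
    case 2
    thus ?thesis using less.prems P_isolated[of "set xs" a j] by auto
  next
    case 3
    obtain i where j: "j = Suc i" using P_Suc[OF _ less.prems(2)] 3 by auto
    have p: "ipath E (a # b # r)" using less.prems 3 by simp
    have "P (set (a # b # r) - nbh E b) i" by (rule path_split[OF p]) (use less.prems 3 j in auto)
    hence P: "P (set (tl r)) i" unfolding ipath_diff_nbh_1[OF p] .
    have "ipath E (tl r)" using ipath_drop[OF p, of 3] by (simp add: drop_Suc numeral_3_eq_3)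
    from less.hyps[OF _ this P] have IH: "length (tl r) = 3 * i \<or> Suc (length (tl r)) = 3 * i" using 3 by simp
    show ?thesis
    proof (cases r)
      case Nil
      have "i = 0" using IH Nil by auto
      thus ?thesis using 3 Nil j by simp
    next
      case (Cons c r')
      thus ?thesis using IH 3 j by auto
    qed
  qed
qed

lemma P_path:
  "ipath E xs \<Longrightarrow> Suc (length xs) = 3 * j \<Longrightarrow> P (set xs) j"
proof (induction j arbitrary: xs)
  case (Suc i)
  have "2 \<le> length xs" using Suc.prems by simp
  then obtain a b r where xs: "xs = a # b # r" by (cases xs; cases "tl xs") auto
  have p: "ipath E (a # b # r)" using Suc.prems xs by simp
  have "P (set (tl r)) i"
  proof (cases i)
    case 0
    thus ?thesis using Suc.prems xs P_empty by simp
  next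
    case (Suc k)
    have "ipath E (tl r)" using ipath_drop[OF p, of 3] by (simp add: drop_Suc numeral_3_eq_3)
    thus ?thesis using Suc.IH Suc.prems xs Suc by simp
  qed
  hence P: "P (set xs - nbh E b) i" unfolding xs ipath_diff_nbh_1[OF p] .
  have "dominated E (set xs) b a"
  proof -
    have "set (a # b # r) \<inter> nbh E a \<subseteq> {a, b}" using ipath_nbh_0[OF p] by auto
    moreover have "{b, a} \<in> E" using p[unfolded ipath_def, THEN conjunct2, rule_format, of 1 0] by simp
    ultimately show ?thesis by (auto simp: dominated_def xs nbh_def)
  qed
  thus ?case using P_dominated[OF _ _ P] by simp
qed simp

lemma P_path_bound:
  "ipath E xs \<Longrightarrow> W \<subseteq> set xs \<Longrightarrow> P W j \<Longrightarrow> 3 * j \<le> Suc (length xs)"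
proof (induction "length xs" arbitrary: xs j W rule: less_induct)
  case less
  have fin: "finite W" using less.prems finite_subset by blast
  show ?case
  proof (cases xs)
    case Nil
    thus ?thesis using less.prems P_empty by simp
  next
    case (Cons a s)
    show ?thesis
    proof (cases "a \<in> W")
      case False
      have "3 * j \<le> Suc (length s)"
        by (rule less.hyps[of s W]) (use less.prems Cons False in \<open>auto dest: ipath_Cons\<close>)
      thus ?thesis using Cons by simp
    next
      case True
      obtain b where b: "b \<in> W" "{a, b} \<in> E" "a \<noteq> b" using P_neighbour[OF fin less.prems(3) True] .
      have "b \<in> set (a # s) \<inter> nbh E a" using b less.prems Cons by (auto simp: nbh_def)
      moreover have "ipath E (a # s)" using less.prems Cons by simp
      ultimately have "b \<in> set (take 2 (a # s))" using ipath_nbh_0 by metis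
      then obtain r where s: "s = b # r" using b by (cases s) auto
      show ?thesis
      proof (cases j)
        case (Suc i)
        have p: "ipath E (a # b # r)" using less.prems Cons s by simp
        have W: "W \<subseteq> set (a # b # r)" using less.prems Cons s by simp
        have "P (W - nbh E b) i" using path_split[OF p W True b(1)] less.prems Suc by simp
        moreover have "W - nbh E b \<subseteq> set (tl r)" using W ipath_diff_nbh_1[OF p] by blast
        moreover have "ipath E (tl r)" using ipath_drop[OF p, of 3] by (simp add: drop_Suc numeral_3_eq_3)
        ultimately have "3 * i \<le> Suc (length (tl r))" using less.hyps[of "tl r" "W - nbh E b" i] Cons s by simp
        thus ?thesis using Cons s Suc by (cases r) auto
      qed simp
    qed
  qed
qed

lemma P_icyc:
  assumes c: "icyc E z xs" and P: "P (insert z (set xs)) j"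
  shows "P (set xs) j \<or> length xs + 2 = 3 * j"
proof -
  let ?W = "insert z (set xs)"
  have p: "ipath E xs" and z: "z \<notin> set xs" and len: "2 \<le> length xs"
    and adj: "\<And>i. i < length xs \<Longrightarrow> {z, xs ! i} \<in> E \<longleftrightarrow> i = 0 \<or> Suc i = length xs"
    using c by (auto simp: icyc_def)
  obtain i where j: "j = Suc i" using P_Suc[OF _ P] by auto
  from P_split[of ?W z i] P j have "P (?W - {z}) j \<or> P (?W - nbh E z) i" by simp
  moreover have "?W - {z} = set xs" using z by auto
  moreover have "length xs = 3 * j - 1 \<or> length xs + 2 = 3 * j" if P: "P (?W - nbh E z) i"
  proof -
    define ys where "ys = butlast (tl xs)"
    have lys: "length ys = length xs - 2" by (simp add: ys_def)
    have ys: "ys ! k = xs ! Suc k" if "k < length xs - 2" for k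
      using that by (simp add: ys_def nth_butlast nth_tl)
    have "?W - nbh E z = set ys"
    proof (intro set_eqI iffI)
      fix w assume w: "w \<in> ?W - nbh E z"
      hence "w \<in> set xs" "{z, w} \<notin> E" by (auto simp: nbh_def)
      then obtain k where k: "k < length xs" "w = xs ! k" by (metis in_set_conv_nth)
      have "k \<noteq> 0" "Suc k \<noteq> length xs" using adj[OF k(1)] k \<open>{z, w} \<notin> E\<close> by auto
      then obtain l where "k = Suc l" by (cases k) auto
      hence "l < length ys" "w = ys ! l" using k \<open>Suc k \<noteq> length xs\<close> ys[of l] lys by auto
      thus "w \<in> set ys" by simp
    next
      fix w assume "w \<in> set ys"
      then obtain k where k: "k < length ys" "w = ys ! k" by (metis in_set_conv_nth)
      hence "w = xs ! Suc k" "Suc k < length xs" "Suc (Suc k) \<noteq> length xs" using ys lys by auto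
      thus "w \<in> ?W - nbh E z" using adj[of "Suc k"] z by (auto simp: nbh_def)
    qed
    moreover have "ipath E ys"
    proof -
      have "ipath E (take (length xs - 2) (drop 1 xs))" by (intro ipath_take ipath_drop p)
      thus ?thesis by (simp add: ys_def butlast_conv_take drop_Suc numeral_2_eq_2)
    qed
    ultimately have "length ys = 3 * i \<or> Suc (length ys) = 3 * i" using P_path_imp P by metis
    thus ?thesis using lys len j by auto
  qed
  moreover have "P (set xs) j" if "length xs = 3 * j - 1" using P_path[OF p, of j] that j by simp
  ultimately show ?thesis by metis
qed

text \<open>As the last vertex is not dominated by the one before it, there is a candidate for prolonging
  the path. If it is adjacent to an earlier vertex, the last such vertex yields an induced cycle.\<close>

lemma ipath_close:
  assumes "finite W" "\<And>x y. \<not> dominated E W x y" "ipath E xs" "set xs \<subseteq> W" "2 \<le> length xs"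
  shows "\<exists>ys z i. ipath E ys \<and> take (length xs) ys = xs \<and> set ys \<subseteq> W \<and> z \<in> W \<and> z \<notin> set ys \<and>
    icyc E z (drop i ys) \<and> 3 \<le> length (drop i ys)"
  using assms(3-)
proof (induction "card W - length xs" arbitrary: xs rule: less_induct)
  case less
  define k where "k = length xs - 1"
  have k: "k < length xs" "Suc k = length xs" "0 < k" "k - 1 < length xs" using less.prems by (auto simp: k_def)
  have d: "distinct xs" and p: "\<And>i j. i < length xs \<Longrightarrow> j < length xs \<Longrightarrow> {xs ! i, xs ! j} \<in> E \<longleftrightarrow> j = Suc i \<or> i = Suc j"
    using less.prems by (auto simp: ipath_def)
  have in_W: "xs ! i \<in> W" if "i < length xs" for i using less.prems(2) that by auto
  have e: "{xs ! (k - 1), xs ! k} \<in> E" using p[of "k - 1" k] k by simp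
  have "\<not> dominated E W (xs ! (k - 1)) (xs ! k)" using assms(2) .
  then obtain z where z: "z \<in> W" "z \<in> nbh E (xs ! k)" "z \<notin> nbh E (xs ! (k - 1))"
    using e in_W k unfolding dominated_def by blast
  have zk: "{xs ! k, z} \<in> E" using z e by (auto simp: nbh_def)
  have zk1: "{xs ! (k - 1), z} \<notin> E" "z \<noteq> xs ! (k - 1)" using z by (auto simp: nbh_def)
  have zxs: "z \<notin> set xs"
  proof
    assume "z \<in> set xs"
    then obtain i where i: "i < length xs" "z = xs ! i" by (metis in_set_conv_nth)
    hence "i = Suc k \<or> k = Suc i" using zk p[of k i] k by simp
    thus False using i k zk1 by auto
  qed
  show ?case
  proof (cases "\<exists>i<k. {z, xs ! i} \<in> E")
    case True
    define i where "i = Max {i. i < k \<and> {z, xs ! i} \<in> E}"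
    have fin: "finite {i. i < k \<and> {z, xs ! i} \<in> E}" by simp
    have "i \<in> {i. i < k \<and> {z, xs ! i} \<in> E}" unfolding i_def by (rule Max_in[OF fin]) (use True in auto)
    hence i: "i < k" "{z, xs ! i} \<in> E" by auto
    have mx: "l \<le> i" if "l < k" "{z, xs ! l} \<in> E" for l
      unfolding i_def using that by (intro Max_ge fin) auto
    have "i \<noteq> k - 1" using i zk1 by (auto simp: insert_commute)
    hence ik: "Suc i < k" using i by simp
    have len: "length (drop i xs) = Suc k - i" using k by simp
    have "icyc E z (drop i xs)" unfolding icyc_def
    proof (intro conjI allI impI)
      show "ipath E (drop i xs)" using less.prems by (intro ipath_drop)
      show "z \<notin> set (drop i xs)" using zxs by (auto dest: in_set_dropD)
      show "2 \<le> length (drop i xs)" using len ik by simp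
      fix l assume "l < length (drop i xs)"
      hence l: "l + i \<le> k" using len ik by simp
      hence dl: "drop i xs ! l = xs ! (l + i)" using k by (simp add: add.commute)
      show "({z, drop i xs ! l} \<in> E) = (l = 0 \<or> Suc l = length (drop i xs))"
        unfolding dl len
      proof
        assume "{z, xs ! (l + i)} \<in> E"
        thus "l = 0 \<or> Suc l = Suc k - i" using mx[of "l + i"] l ik by fastforce
      next
        assume "l = 0 \<or> Suc l = Suc k - i"
        thus "{z, xs ! (l + i)} \<in> E"
        proof
          assume "Suc l = Suc k - i"
          hence "l + i = k" using ik by simp
          thus ?thesis using zk by (simp add: insert_commute)
        qed (use i in simp)
      qed
    qed
    moreover have "3 \<le> length (drop i xs)" using len ik by simp
    ultimately show ?thesis using less.prems z zxs
      by (intro exI[of _ xs] exI[of _ z] exI[of _ i]) simp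
  next
    case False
    have adj: "{xs ! i, z} \<in> E \<longleftrightarrow> Suc i = length xs" if "i < length xs" for i
    proof (cases "i = k")
      case True thus ?thesis using zk k by simp
    next
      case neq: False
      hence "i < k" using that k by simp
      thus ?thesis using False k by (auto simp: insert_commute)
    qed
    have "ipath E (xs @ [z])" unfolding ipath_def
    proof (intro conjI allI impI)
      show "distinct (xs @ [z])" using d zxs by simp
      fix i j assume "i < length (xs @ [z])" "j < length (xs @ [z])"
      hence ij: "i < length xs \<or> i = length xs" "j < length xs \<or> j = length xs" by auto
      thus "({(xs @ [z]) ! i, (xs @ [z]) ! j} \<in> E) = (j = Suc i \<or> i = Suc j)"
        using p[of i j] adj[of i] adj[of j] no_loop[of z]
        by (elim disjE) (auto simp: nth_append insert_commute)
    qed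
    moreover have sub: "set (xs @ [z]) \<subseteq> W" using less.prems z by simp
    moreover have "card W - length (xs @ [z]) < card W - length xs"
    proof -
      have "length (xs @ [z]) = card (set (xs @ [z]))" using distinct_card[of "xs @ [z]"] d zxs by simp
      also have "\<dots> \<le> card W" using sub assms(1) by (rule card_mono[rotated])
      finally show ?thesis by simp
    qed
    ultimately obtain ys z' i where *: "ipath E ys" "take (length (xs @ [z])) ys = xs @ [z]" "set ys \<subseteq> W" "z' \<in> W" "z' \<notin> set ys"
      "icyc E z' (drop i ys)" "3 \<le> length (drop i ys)"
      using less.hyps[of "xs @ [z]"] less.prems by auto
    have "take (length xs) ys = take (length xs) (take (length (xs @ [z])) ys)" by simp
    also have "\<dots> = xs" unfolding *(2) by simp
    finally show ?thesis using * by blast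
  qed
qed

end

context hochster_pred
begin

lemma not_dominated_closes:
  assumes "finite U" "\<And>x y. \<not> dominated E U x y" "x \<in> U" "y \<in> U" "{x, y} \<in> E"
  obtains ys z i where "ipath E ys" "2 \<le> length ys" "ys ! 0 = x" "ys ! 1 = y" "set ys \<subseteq> U" "z \<in> U" "z \<notin> set ys"
    "cyc E (Suc (length (drop i ys))) ((!) (z # drop i ys))" "4 \<le> Suc (length (drop i ys))"
    "(!) (z # drop i ys) ` {..<Suc (length (drop i ys))} = insert z (set (drop i ys))"
proof -
  have "ipath E [x, y]" unfolding ipath_def
    using assms(5) edge_neq no_loop by (auto simp: less_Suc_eq insert_commute)
  from ipath_close[OF assms(1,2) this] assms(3,4)
  obtain ys z i where *: "ipath E ys" "take 2 ys = [x, y]" "set ys \<subseteq> U" "z \<in> U" "z \<notin> set ys"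
    "icyc E z (drop i ys)" "3 \<le> length (drop i ys)" by (auto simp: numeral_2_eq_2)
  have "length (take 2 ys) = 2" unfolding *(2) by simp
  hence "2 \<le> length ys" by simp
  moreover have "ys ! 0 = take 2 ys ! 0" "ys ! 1 = take 2 ys ! 1" by simp_all
  ultimately have "2 \<le> length ys" "ys ! 0 = x" "ys ! 1 = y" unfolding *(2) by simp_all
  thus ?thesis using that[OF *(1) _ _ _ *(3-5) icyc_cyc(1)[OF *(6) no_loop] _ icyc_cyc(2)[OF *(6) no_loop]] *(7) by simp
qed

lemma dominated_or_cycle:
  assumes fin: "finite U" and xy: "x \<in> U" "y \<in> U" "{x, y} \<in> E"
  shows "(\<exists>x y. dominated E U x y) \<or> (\<exists>m g. 4 \<le> m \<and> cyc E m g \<and> g ` {..<m} \<subseteq> U)"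
proof (rule disj_imp[THEN iffD2], rule impI)
  assume "\<not> (\<exists>x y. dominated E U x y)"
  hence nd: "\<And>x y. \<not> dominated E U x y" by blast
  obtain ys z i where *: "set ys \<subseteq> U" "z \<in> U"
    "cyc E (Suc (length (drop i ys))) ((!) (z # drop i ys))" "4 \<le> Suc (length (drop i ys))"
    "(!) (z # drop i ys) ` {..<Suc (length (drop i ys))} = insert z (set (drop i ys))"
    using not_dominated_closes[OF fin nd xy] by metis
  have "insert z (set (drop i ys)) \<subseteq> U" using *(1,2) set_drop_subset[of i ys] by blast
  hence "(!) (z # drop i ys) ` {..<Suc (length (drop i ys))} \<subseteq> U" unfolding *(5) .
  with *(3,4) show "\<exists>m g. 4 \<le> m \<and> cyc E m g \<and> g ` {..<m} \<subseteq> U" by (intro exI conjI)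
qed

lemma size_convex_no_cycles:
  assumes V: "finite V" and nc: "\<And>n f. 4 \<le> n \<Longrightarrow> cyc E n f \<Longrightarrow> \<not> f ` {..<n} \<subseteq> V"
  shows "size_convex V"
proof (rule size_convex_full[OF V])
  fix U x y assume U: "U \<subseteq> V" "x \<in> U" "y \<in> U" "{x, y} \<in> E"
  have "finite U" using U V finite_subset by blast
  from dominated_or_cycle[OF this U(2-4)] nc U(1)
  show "(\<exists>x y. dominated E U x y) \<or> (\<forall>j. P U j \<longrightarrow> (\<exists>v\<in>U. P (U - {v}) j))"
    by (meson order_trans)
qed

lemma ipath_dominated:
  assumes p: "ipath E xs" and U: "U \<subseteq> set xs" "x \<in> U" "y \<in> U" "{x, y} \<in> E"
  shows "\<exists>x y. dominated E U x y"
proof -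
  have d: "distinct xs" and adj: "\<And>i j. i < length xs \<Longrightarrow> j < length xs \<Longrightarrow> {xs ! i, xs ! j} \<in> E \<longleftrightarrow> j = Suc i \<or> i = Suc j"
    using p by (auto simp: ipath_def)
  obtain a b where ab: "a < length xs" "x = xs ! a" "b < length xs" "y = xs ! b" using U by (metis in_set_conv_nth subsetD)
  let ?Q = "\<lambda>i. Suc i < length xs \<and> xs ! i \<in> U \<and> xs ! Suc i \<in> U"
  have "?Q a \<or> ?Q b" using adj[OF ab(1,3)] U ab by auto
  hence ex: "\<exists>i. ?Q i" by blast
  define i where "i = (LEAST i. ?Q i)"
  have i: "?Q i" unfolding i_def using ex by (rule LeastI_ex)
  have least: "\<not> ?Q l" if "l < i" for l using that not_less_Least unfolding i_def by blast
  have "dominated E U (xs ! Suc i) (xs ! i)" unfolding dominated_def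
  proof (intro conjI subsetI)
    show "xs ! Suc i \<in> U" "xs ! i \<in> U" using i by auto
    show "{xs ! Suc i, xs ! i} \<in> E" using adj i by simp
    fix w assume w: "w \<in> U \<inter> nbh E (xs ! i)"
    then obtain l where l: "l < length xs" "w = xs ! l" using U by (metis IntD1 in_set_conv_nth subsetD)
    have "l = i \<or> l = Suc i \<or> i = Suc l" using w l i adj[of i l] d by (auto simp: nbh_def nth_eq_iff_index_eq)
    moreover have "i \<noteq> Suc l" using least[of l] w l i by auto
    ultimately show "w \<in> nbh E (xs ! Suc i)" using l i adj[of "Suc i" i] by (auto simp: nbh_def)
  qed
  thus ?thesis by blast
qed

lemma size_convex_path: "ipath E xs \<Longrightarrow> size_convex (set xs)"
  by (rule size_convex_full) (use ipath_dominated in blast)+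

lemma proper_subset_cyc:
  assumes f: "cyc E n f" and W: "W \<subset> f ` {..<n}"
  shows "P W j \<Longrightarrow> 3 * j \<le> n" "P W j \<Longrightarrow> 2 * j \<le> s \<Longrightarrow> s \<le> card W \<Longrightarrow> \<exists>U\<subseteq>W. card U = s \<and> P U j"
proof -
  have n: "3 \<le> n" using f by (simp add: cyc_def)
  have fin: "finite W" using W finite_subset by blast
  {
    assume P: "P W j"
    obtain v where v: "v \<in> f ` {..<n}" "v \<notin> W" using W by blast
    obtain g where g: "cyc E n g" "g ` {..<n} = f ` {..<n}" "g 0 = v" using cyc_rotate[OF f v(1)] .
    have "ipath E (map g [1..<n])" using cyc_icyc(1)[OF g(1)] by (simp add: icyc_def)
    moreover have "insert v (set (map g [1..<n])) = f ` {..<n}"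
      using cyc_icyc(2)[OF g(1)] unfolding g(2,3) .
    hence "W \<subseteq> insert v (set (map g [1..<n]))" using W by simp
    hence "W \<subseteq> set (map g [1..<n])" using v(2) by blast
    ultimately have "3 * j \<le> Suc (length (map g [1..<n]))" using P_path_bound P by blast
    thus "3 * j \<le> n" using n by simp
  }
  assume P: "P W j" "2 * j \<le> s" "s \<le> card W"
  show "\<exists>U\<subseteq>W. card U = s \<and> P U j"
  proof (rule P_full[OF fin P])
    fix U x y assume U: "U \<subseteq> W" "x \<in> U" "y \<in> U" "{x, y} \<in> E"
    have "\<exists>x y. dominated E U x y"
    proof (rule ccontr)
      assume nd: "\<not> ?thesis"
      have "finite U" using U fin finite_subset by blast
      from dominated_or_cycle[OF this U(2-4)] nd obtain m g where g: "cyc E m g" "g ` {..<m} \<subseteq> U" by blast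
      have sub: "g ` {..<m} \<subseteq> W" using g(2) U(1) by (rule order_trans)
      hence "g ` {..<m} \<subseteq> f ` {..<n}" using W by (meson order_trans psubset_imp_subset)
      from cyc_subset_eq[OF g(1) f this] show False using sub W by simp
    qed
    thus "(\<exists>x y. dominated E U x y) \<or> (\<forall>j. P U j \<longrightarrow> (\<exists>v\<in>U. P (U - {v}) j))" by blast
  qed
qed

lemma size_convex_cyc:
  assumes f: "cyc E n f" shows "size_convex (f ` {..<n})"
  unfolding size_convex_def
proof (intro allI impI)
  fix j a b c assume ab: "a \<in> sizes (f ` {..<n}) j" "b \<in> sizes (f ` {..<n}) j" "a \<le> c" "c \<le> b"
  have n: "3 \<le> n" and inj: "inj_on f {..<n}" using f by (auto simp: cyc_def)
  obtain A B where AB: "A \<subseteq> f ` {..<n}" "P A j" "card A = a" "B \<subseteq> f ` {..<n}" "P B j" "card B = b"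
    using ab by (auto simp: sizes_def)
  have fin: "finite A" "finite B" using AB finite_subset by blast+
  have low: "2 * j \<le> c" using P_low[OF fin(1) AB(2)] AB ab by simp
  show "c \<in> sizes (f ` {..<n}) j"
  proof (cases "c = b")
    case True thus ?thesis using ab by simp
  next
    case False
    hence cb: "c < b" using ab by simp
    show ?thesis
    proof (cases "B = f ` {..<n}")
      case False
      hence "B \<subset> f ` {..<n}" using AB by blast
      from proper_subset_cyc(2)[OF f this AB(5) low] cb AB
      obtain U where "U \<subseteq> B" "card U = c" "P U j" by auto
      thus ?thesis using AB unfolding sizes_def by blast
    next
      case True
      have cB: "card B = n" unfolding True using card_image[OF inj] by simp
      have "A \<noteq> B" using AB ab cb by auto
      hence "A \<subset> f ` {..<n}" using AB True by blast
      hence "3 * j \<le> n" using proper_subset_cyc(1)[OF f _ AB(2)] by blast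
      moreover define xs where "xs = map f [1..<n]"
      have ic: "icyc E (f 0) xs" "insert (f 0) (set xs) = B" using cyc_icyc[OF f] True by (auto simp: xs_def)
      moreover have len: "length xs = n - 1" by (simp add: xs_def)
      ultimately have "P (set xs) j" using P_icyc[OF ic(1), of j] AB(5) n by auto
      moreover have "set xs \<subset> f ` {..<n}" using ic True by (auto simp: icyc_def)
      moreover have "c \<le> card (set xs)"
      proof -
        have "card B \<le> Suc (card (set xs))" unfolding ic(2)[symmetric] by (rule card_insert_le_m1) simp_all
        thus ?thesis using cb AB by simp
      qed
      ultimately obtain U where "U \<subseteq> set xs" "card U = c" "P U j" using proper_subset_cyc(2)[OF f _ _ low] by blast
      thus ?thesis using \<open>set xs \<subset> f ` {..<n}\<close> unfolding sizes_def by blast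
    qed
  qed
qed

lemma size_convex_unicyclic:
  assumes V: "finite V" and f: "cyc E n f" and n: "\<And>k. 1 \<le> k \<Longrightarrow> n \<noteq> 3 * k + 2"
    and uniq: "\<And>m g. cyc E m g \<Longrightarrow> g ` {..<m} \<subseteq> V \<Longrightarrow> g ` {..<m} = f ` {..<n}"
  shows "size_convex V"
proof (rule size_convex_full[OF V])
  fix U x y assume U: "U \<subseteq> V" "x \<in> U" "y \<in> U" "{x, y} \<in> E"
  show "(\<exists>x y. dominated E U x y) \<or> (\<forall>j. P U j \<longrightarrow> (\<exists>v\<in>U. P (U - {v}) j))"
  proof (rule disjCI)
    assume "\<not> (\<forall>j. P U j \<longrightarrow> (\<exists>v\<in>U. P (U - {v}) j))"
    then obtain j where j: "P U j" "\<And>v. v \<in> U \<Longrightarrow> \<not> P (U - {v}) j" by blast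
    show "\<exists>x y. dominated E U x y"
    proof (rule ccontr)
      assume "\<not> ?thesis"
      hence nd: "\<And>x y. \<not> dominated E U x y" by blast
      have fin: "finite U" using U V finite_subset by blast
      let ?B = "f ` {..<n}"
      have close: "\<exists>ys z i. ipath E ys \<and> 2 \<le> length ys \<and> ys ! 0 = a \<and> ys ! 1 = b \<and> set ys \<subseteq> U \<and> z \<notin> set ys \<and>
          i < length ys \<and> insert z (set (drop i ys)) = ?B \<and> ?B \<subseteq> U" if ab: "a \<in> U" "b \<in> U" "{a, b} \<in> E" for a b
      proof -
        obtain ys z i where *: "ipath E ys" "2 \<le> length ys" "ys ! 0 = a" "ys ! 1 = b" "set ys \<subseteq> U" "z \<in> U" "z \<notin> set ys"
          "cyc E (Suc (length (drop i ys))) ((!) (z # drop i ys))" "4 \<le> Suc (length (drop i ys))"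
          "(!) (z # drop i ys) ` {..<Suc (length (drop i ys))} = insert z (set (drop i ys))"
          using not_dominated_closes[OF fin nd ab] by metis
        have sub: "insert z (set (drop i ys)) \<subseteq> U" using *(5,6) set_drop_subset[of i ys] by blast
        hence eq: "insert z (set (drop i ys)) = ?B" using uniq[OF *(8)] U(1) unfolding *(10) by blast
        have "i < length ys" using *(9) by simp
        thus ?thesis using * eq sub by metis
      qed
      have cross: False if bw: "b \<in> ?B" "b \<in> U" "w \<in> U" "w \<notin> ?B" "{b, w} \<in> E" for b w
      proof -
        obtain ys z i where *: "ipath E ys" "2 \<le> length ys" "ys ! 0 = b" "ys ! 1 = w" "z \<notin> set ys"
          "insert z (set (drop i ys)) = ?B" using close[OF bw(2,3,5)] by blast
        have d: "distinct ys" using *(1) by (simp add: ipath_def)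
        have bs: "b \<in> set ys" "w \<in> set ys" using *(2-4) by (auto simp: in_set_conv_nth intro: exI[of _ 0] exI[of _ 1])
        have "b \<in> insert z (set (drop i ys))" unfolding *(6) by (rule bw(1))
        moreover have "b \<noteq> z" using bs(1) *(5) by blast
        ultimately have "b \<in> set (drop i ys)" by simp
        then obtain l where "l < length (drop i ys)" "drop i ys ! l = b" by (metis in_set_conv_nth)
        hence "i + l < length ys" "ys ! (i + l) = ys ! 0" using *(3) by auto
        moreover have "0 < length ys" using *(2) by linarith
        ultimately have "i + l = 0" using nth_eq_iff_index_eq[OF d] by blast
        hence "set ys \<subseteq> ?B" using *(6) by auto
        thus False using bs bw by blast
      qed
      have BU: "?B \<subseteq> U" using close[OF U(2-4)] by blast
      have "U = ?B"
      proof (rule ccontr)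
        assume "U \<noteq> ?B"
        then obtain w where w: "w \<in> U" "w \<notin> ?B" using BU by blast
        obtain y where y: "y \<in> U" "{w, y} \<in> E" using P_neighbour[OF fin j(1) w(1)] by blast
        obtain ys z i where *: "ipath E ys" "2 \<le> length ys" "ys ! 0 = w" "set ys \<subseteq> U"
          "i < length ys" "insert z (set (drop i ys)) = ?B" using close[OF w(1) y] by blast
        have "ys ! k \<notin> ?B" if "k < length ys" for k
          using that
        proof (induction k)
          case (Suc k)
          have "{ys ! Suc k, ys ! k} \<in> E" using *(1) Suc.prems by (simp add: ipath_def)
          moreover have "ys ! Suc k \<in> U" "ys ! k \<in> U" using Suc.prems *(4) by auto
          moreover have "ys ! k \<notin> ?B" using Suc by simp
          ultimately show ?case using cross by blast
        qed (use w *(3) in simp)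
        hence "ys ! i \<notin> ?B" using *(5) by blast
        moreover have "ys ! i \<in> set (drop i ys)" using *(5) by (metis Cons_nth_drop_Suc list.set_intros(1))
        ultimately show False using *(6) by blast
      qed
      moreover define xs where "xs = map f [1..<n]"
      have ic: "icyc E (f 0) xs" "insert (f 0) (set xs) = ?B" using cyc_icyc[OF f] by (auto simp: xs_def)
      ultimately have "P (set xs) j \<or> length xs + 2 = 3 * j" using P_icyc[OF ic(1), of j] j(1) by simp
      moreover have "length xs + 2 \<noteq> 3 * j"
      proof
        assume *: "length xs + 2 = 3 * j"
        have "3 \<le> n" using f by (simp add: cyc_def)
        hence "n = 3 * (j - 1) + 2" "1 \<le> j - 1" using * by (auto simp: xs_def)
        thus False using n by blast
      qed
      moreover have "U - {f 0} = set xs" using \<open>U = ?B\<close> ic by (auto simp: icyc_def)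
      ultimately show False using j(2)[of "f 0"] \<open>U = ?B\<close> ic(2) by auto
    qed
  qed
qed

lemma size_convex_join:
  assumes "finite Y" "finite A" "size_convex A" "Y \<inter> A = {}" "\<And>y a. y \<in> Y \<Longrightarrow> a \<in> A \<Longrightarrow> {y, a} \<in> E"
    "\<And>y y'. y \<in> Y \<Longrightarrow> y' \<in> Y \<Longrightarrow> {y, y'} \<notin> E"
  shows "size_convex (Y \<union> A)"
  using assms
proof (induction Y rule: finite_induct)
  case (insert y Y)
  have "size_convex (insert y (Y \<union> A))"
  proof (rule size_convex_cone)
    show "size_convex (Y \<union> A)" using insert.prems by (intro insert.IH) auto
    show "finite (Y \<union> A)" "y \<notin> Y \<union> A" using insert by auto
    fix u v assume "u \<in> Y \<union> A - nbh E y" "v \<in> Y \<union> A - nbh E y"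
    hence "u \<in> Y" "v \<in> Y" using insert.prems(4) by (auto simp: nbh_def)
    thus "{u, v} \<notin> E" using insert.prems(5) by blast
  qed
  thus ?case by simp
qed simp

end

section \<open>Strand connectivity\<close>

lemma indep_subset_edge: "indep E S \<Longrightarrow> e \<in> E \<Longrightarrow> e \<subseteq> S \<Longrightarrow> False"
  by (auto simp: indep_def)

lemma ind_cplx_delete: "{T \<in> ind_cplx E W. x \<notin> T} = ind_cplx E (W - {x})"
  by (auto simp: ind_cplx_def)

lemma edge_insertE:
  assumes "card e = 2" "e \<subseteq> insert x T" "\<not> e \<subseteq> T"
  obtains w where "e = {x, w}" "w \<in> T" "w \<noteq> x"
proof -
  obtain a b where e: "e = {a, b}" "a \<noteq> b" using assms(1) by (auto simp: card_2_iff)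
  hence "a = x \<and> b \<in> T \<or> b = x \<and> a \<in> T" using assms by auto
  thus ?thesis using that[of b] that[of a] e by (auto simp: insert_commute)
qed

lemma indep_insert:
  assumes E: "\<And>e. e \<in> E \<Longrightarrow> card e = 2" and T: "indep E T" "T \<inter> nbh E x \<subseteq> {x}"
  shows "indep E (insert x T)"
  unfolding indep_def
proof (intro ballI notI)
  fix e assume e: "e \<in> E" "e \<subseteq> insert x T"
  have "\<not> e \<subseteq> T" using T(1) e(1) by (auto simp: indep_def)
  then obtain w where "e = {x, w}" "w \<in> T" "w \<noteq> x" using edge_insertE[OF E[OF e(1)] e(2)] by blast
  thus False using e(1) T(2) by (auto simp: nbh_def)
qed

lemma ind_cplx_link:
  assumes E: "\<And>e. e \<in> E \<Longrightarrow> card e = 2" and x: "x \<in> W"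
  shows "{T. x \<notin> T \<and> insert x T \<in> ind_cplx E W} = ind_cplx E (W - nbh E x)"
proof (intro set_eqI iffI)
  fix T assume "T \<in> {T. x \<notin> T \<and> insert x T \<in> ind_cplx E W}"
  hence T: "x \<notin> T" "insert x T \<subseteq> W" "indep E (insert x T)" by (auto simp: ind_cplx_def)
  have "w \<notin> nbh E x" if "w \<in> T" for w
    using indep_subset_edge[OF T(3), of "{x, w}"] that T(1) by (auto simp: nbh_def)
  thus "T \<in> ind_cplx E (W - nbh E x)" using T indep_mono[OF T(3), of T] by (auto simp: ind_cplx_def)
next
  fix T assume "T \<in> ind_cplx E (W - nbh E x)"
  hence T: "T \<subseteq> W" "T \<inter> nbh E x = {}" "indep E T" by (auto simp: ind_cplx_def)
  have "indep E (insert x T)" by (rule indep_insert[OF E T(3)]) (use T(2) in auto)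
  moreover have "x \<notin> T" using T(2) by (auto simp: nbh_def)
  ultimately show "T \<in> {T. x \<notin> T \<and> insert x T \<in> ind_cplx E W}" using T x by (simp add: ind_cplx_def)
qed

lemma hochster_pred_cohom_nz:
  assumes E: "\<And>e. e \<in> E \<Longrightarrow> card e = 2"
  shows "hochster_pred E (\<lambda>W. cohom_nz TYPE('k::field) (ind_cplx E W))"
proof
  have empty: "indep E {}" using E by (fastforce simp: indep_def)
  have e0: "ind_cplx E {} = {{}}" using empty by (auto simp: ind_cplx_def)
  show "card e = 2" if "e \<in> E" for e using E that .
  show "cohom_nz TYPE('k) (ind_cplx E {}) j \<longleftrightarrow> j = 0" for j
  proof (cases j)
    case 0
    thus ?thesis using cohom_nz_0_iff[OF simp_cplx_ind[of "{}" E]] e0 by simp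
  next
    case (Suc i)
    thus ?thesis unfolding e0 by (simp add: cohom_nz_def)
  qed
  show "\<not> cohom_nz TYPE('k) (ind_cplx E W) 0" if W: "finite W" "W \<noteq> {}" for W
  proof -
    obtain v where v: "v \<in> W" using W by blast
    have "indep E {v}" unfolding indep_def
    proof
      fix e assume "e \<in> E"
      hence "card e = 2" by (rule E)
      thus "\<not> e \<subseteq> {v}" using card_mono[of "{v}" e] by auto
    qed
    hence "{v} \<in> ind_cplx E W" using v by (simp add: ind_cplx_def)
    hence "ind_cplx E W \<noteq> {{}}" by auto
    thus ?thesis using cohom_nz_0_iff[OF simp_cplx_ind[OF W(1)]] by blast
  qed
  show "\<not> cohom_nz TYPE('k) (ind_cplx E W) j" if W: "finite W" "v \<in> W" "W \<inter> nbh E v \<subseteq> {v}" for W v j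
  proof (rule cohom_nz_cone[OF simp_cplx_ind[OF W(1)]])
    fix T assume T: "T \<in> ind_cplx E W"
    have "indep E (insert v T)"
      by (rule indep_insert[OF E]) (use T W(3) in \<open>auto simp: ind_cplx_def\<close>)
    thus "insert v T \<in> ind_cplx E W" using T W(2) by (simp add: ind_cplx_def)
  qed
  show "cohom_nz TYPE('k) (ind_cplx E (W - {x})) (Suc j) \<or> cohom_nz TYPE('k) (ind_cplx E (W - nbh E x)) j"
    if W: "finite W" "x \<in> W" "cohom_nz TYPE('k) (ind_cplx E W) (Suc j)" for W x j
  proof -
    have link: "{T. x \<notin> T \<and> insert x T \<in> ind_cplx E W} = ind_cplx E (W - nbh E x)"
      by (rule ind_cplx_link[OF E W(2)])
    show ?thesis
      using cohom_nz_delete_or_link[OF simp_cplx_ind[OF W(1)] W(3), of x] unfolding ind_cplx_delete link .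
  qed
  show "cohom_nz TYPE('k) (ind_cplx E W) (Suc j)"
    if W: "finite W" "dominated E W x y" "cohom_nz TYPE('k) (ind_cplx E (W - nbh E x)) j" for W x y j
  proof (rule cohom_nz_of_link[OF simp_cplx_ind[OF W(1)], where x = x and y = y])
    have xy: "x \<in> W" "y \<in> W" "{x, y} \<in> E" "W \<inter> nbh E y \<subseteq> nbh E x" using W(2) by (auto simp: dominated_def)
    have link: "{T. x \<notin> T \<and> insert x T \<in> ind_cplx E W} = ind_cplx E (W - nbh E x)"
      by (rule ind_cplx_link[OF E xy(1)])
    show "cohom_nz TYPE('k) {T. x \<notin> T \<and> insert x T \<in> ind_cplx E W} j" unfolding link by (rule W(3))
    show "x \<noteq> y" using E[OF xy(3)] by auto
    fix T assume T: "x \<notin> T" "insert x T \<in> ind_cplx E W"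
    hence T': "T \<in> ind_cplx E (W - nbh E x)" using link by blast
    have "indep E (insert y T)"
      by (rule indep_insert[OF E]) (use T' xy(4) in \<open>auto simp: ind_cplx_def\<close>)
    thus "insert y T \<in> ind_cplx E W" using T' xy(2) by (auto simp: ind_cplx_def)
  qed
qed

lemma strand_connected_if_size_convex:
  assumes G: "fin_simple_graph G"
    and size_convex: "hochster_pred.size_convex (\<lambda>W. cohom_nz TYPE('k::field) (ind_cplx (edges G) W)) (verts G)"
  shows "strand_connected (verts G) (edge_ideal G :: ('v, 'k) mpoly set)"
  unfolding strand_connected_def
proof (intro allI impI)
  fix F :: "('v, 'k) free_cplx" and j
  assume F: "minimal_graded_free_resolution (verts G) (edge_ideal G) F" and ne: "strand F j \<noteq> {}"
  let ?P = "\<lambda>W. cohom_nz TYPE('k) (ind_cplx (edges G) W)"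
  interpret hochster_pred "edges G" ?P
    by (rule hochster_pred_cohom_nz) (use G in \<open>auto simp: fin_simple_graph_def\<close>)
  have V: "finite (verts G)" using G by (simp add: fin_simple_graph_def)
  have mem: "i \<in> strand F j \<longleftrightarrow> (\<exists>W\<subseteq>verts G. int (card W) = int i + j \<and> i \<le> card W \<and> ?P W (card W - i))" for i
    unfolding strand_def using betti_iff[OF G F] by simp
  obtain i0 where "i0 \<in> strand F j" using ne by blast
  then obtain k where k: "j = int k" using mem[of i0] by (auto intro: that[of "nat j"])
  have mem': "i \<in> strand F j \<longleftrightarrow> i + k \<in> sizes (verts G) k" for i
  proof
    assume "i \<in> strand F j"
    then obtain W where W: "W \<subseteq> verts G" "int (card W) = int i + j" "?P W (card W - i)" using mem by blast
    hence "card W = i + k" using k by simp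
    thus "i + k \<in> sizes (verts G) k" using sizesI[OF W(1), of k] W(3) by simp
  next
    assume "i + k \<in> sizes (verts G) k"
    then obtain W where "W \<subseteq> verts G" "?P W k" "card W = i + k" by (auto simp: sizes_def)
    thus "i \<in> strand F j" using k unfolding mem by (intro exI[of _ W]) simp
  qed
  have fin: "finite (strand F j)"
  proof (rule finite_subset)
    show "strand F j \<subseteq> {..card (verts G)}"
    proof
      fix i assume "i \<in> strand F j"
      then obtain W where "W \<subseteq> verts G" "i \<le> card W" using mem by blast
      thus "i \<in> {..card (verts G)}" using card_mono[OF V, of W] by simp
    qed
  qed simp
  show "connected_strand (strand F j)"
    unfolding connected_strand_def
  proof (intro equalityI subsetI)
    fix i assume "i \<in> strand F j"
    thus "i \<in> {Min (strand F j)..Max (strand F j)}" using fin by simp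
  next
    fix i assume i: "i \<in> {Min (strand F j)..Max (strand F j)}"
    have "Min (strand F j) + k \<in> sizes (verts G) k" "Max (strand F j) + k \<in> sizes (verts G) k"
      using mem' Min_in[OF fin ne] Max_in[OF fin ne] by blast+
    hence "i + k \<in> sizes (verts G) k" using size_convex i unfolding size_convex_def atLeastAtMost_iff by (meson add_right_mono)
    thus "i \<in> strand F j" using mem' by blast
  qed
qed

section \<open>The graph classes\<close>

lemma cycle_graph_edge:
  assumes "i < n" "j < n"
  shows "{i, j} \<in> edges (cycle_graph n) \<longleftrightarrow> j = Suc i mod n \<or> i = Suc j mod n"
  using assms by (auto simp: cycle_graph_def doubleton_eq_iff)

lemma iso_cycle_graph:
  assumes "ugraph_iso H (cycle_graph n)" "3 \<le> n"
  obtains f where "cyc (edges H) n f" "f ` {..<n} = verts H"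
proof -
  obtain h where h: "bij_betw h (verts H) {..<n}"
    "\<And>x y. x \<in> verts H \<Longrightarrow> y \<in> verts H \<Longrightarrow> {x, y} \<in> edges H \<longleftrightarrow> {h x, h y} \<in> edges (cycle_graph n)"
    using assms(1) unfolding ugraph_iso_def by (auto simp: cycle_graph_def)
  define f where "f = inv_into (verts H) h"
  have f: "bij_betw f {..<n} (verts H)" unfolding f_def by (rule bij_betw_inv_into[OF h(1)])
  have hf: "h (f i) = i" "f i \<in> verts H" if "i < n" for i
    using bij_betw_inv_into_right[OF h(1)] bij_betwE[OF f] that by (auto simp: f_def)
  show ?thesis
  proof (rule that[of f])
    show "f ` {..<n} = verts H" using f by (rule bij_betw_imp_surj_on)
    show "cyc (edges H) n f" unfolding cyc_def
      using assms(2) bij_betw_imp_inj_on[OF f] h(2) hf cycle_graph_edge[of _ n] by auto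
  qed
qed

lemma cyc_iso_cycle_graph:
  assumes f: "cyc (edges G) n f" and sub: "f ` {..<n} \<subseteq> verts G"
  shows "ugraph_iso (induced G (f ` {..<n})) (cycle_graph n)"
proof -
  have inj: "inj_on f {..<n}" using f by (simp add: cyc_def)
  define h where "h = inv_into {..<n} f"
  have h: "bij_betw h (f ` {..<n}) {..<n}" unfolding h_def using inj by (intro bij_betw_inv_into inj_on_imp_bij_betw)
  have hf: "h (f i) = i" if "i < n" for i using inj that by (simp add: h_def)
  have "verts (induced G (f ` {..<n})) = f ` {..<n}" using sub by (auto simp: induced_def)
  moreover have "verts (cycle_graph n) = {..<n}" by (simp add: cycle_graph_def)
  moreover have "{x, y} \<in> edges (induced G (f ` {..<n})) \<longleftrightarrow> {h x, h y} \<in> edges (cycle_graph n)"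
    if xy: "x \<in> f ` {..<n}" "y \<in> f ` {..<n}" for x y
  proof -
    obtain i j where "i < n" "j < n" "x = f i" "y = f j" using xy by auto
    thus ?thesis using cyc_adj[OF f, of i j] cycle_graph_edge[of i n j] hf by (auto simp: induced_def)
  qed
  ultimately show ?thesis unfolding ugraph_iso_def using h by (intro exI[of _ h]) simp
qed

lemma iso_path_graph:
  assumes "ugraph_iso H (path_graph n)"
  obtains xs where "ipath (edges H) xs" "set xs = verts H"
proof -
  obtain h where h: "bij_betw h (verts H) {..<n}"
    "\<And>x y. x \<in> verts H \<Longrightarrow> y \<in> verts H \<Longrightarrow> {x, y} \<in> edges H \<longleftrightarrow> {h x, h y} \<in> edges (path_graph n)"
    using assms(1) unfolding ugraph_iso_def by (auto simp: path_graph_def)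
  define f where "f = inv_into (verts H) h"
  have f: "bij_betw f {..<n} (verts H)" unfolding f_def by (rule bij_betw_inv_into[OF h(1)])
  have hf: "h (f i) = i" "f i \<in> verts H" if "i < n" for i
    using bij_betw_inv_into_right[OF h(1)] bij_betwE[OF f] that by (auto simp: f_def)
  have e: "{i, j} \<in> edges (path_graph n) \<longleftrightarrow> j = Suc i \<or> i = Suc j" if "i < n" "j < n" for i j
    using that by (auto simp: path_graph_def doubleton_eq_iff)
  show ?thesis
  proof (rule that[of "map f [0..<n]"])
    show "set (map f [0..<n]) = verts H" using bij_betw_imp_surj_on[OF f] by (simp add: atLeast0LessThan)
    show "ipath (edges H) (map f [0..<n])" unfolding ipath_def
      using bij_betw_imp_inj_on[OF f] h(2) hf e by (auto simp: distinct_map atLeast0LessThan)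
  qed
qed

lemma verts_induced: "verts (induced G S) = verts G \<inter> S"
  by (simp add: induced_def)

lemma edges_induced: "e \<in> edges (induced G S) \<longleftrightarrow> e \<in> edges G \<and> e \<subseteq> S"
  by (simp add: induced_def)

lemma reachable_walk:
  assumes v: "\<And>i. i < m \<Longrightarrow> g i \<in> verts H" and e: "\<And>i. Suc i < m \<Longrightarrow> {g i, g (Suc i)} \<in> edges H"
    and "a < m" "b < m"
  shows "reachable H (g a) (g b)"
proof -
  let ?R = "{(u, v). {u, v} \<in> edges H}"
  have up: "(g i, g (i + k)) \<in> ?R\<^sup>*" if "i + k < m" for i k
    using that
  proof (induction k)
    case (Suc k)
    have "(g (i + k), g (i + Suc k)) \<in> ?R" using e[of "i + k"] Suc.prems by simp
    moreover have "(g i, g (i + k)) \<in> ?R\<^sup>*" by (rule Suc.IH) (use Suc.prems in simp)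
    ultimately show ?case by (rule rtrancl_into_rtrancl[rotated])
  qed simp
  have "sym ?R" by (auto simp: sym_def insert_commute)
  hence sym: "sym (?R\<^sup>*)" by (rule sym_rtrancl)
  have "(g a, g b) \<in> ?R\<^sup>*"
  proof (cases "a \<le> b")
    case True thus ?thesis using up[of a "b - a"] assms(4) by simp
  next
    case False
    hence "(g b, g a) \<in> ?R\<^sup>*" using up[of b "a - b"] assms(3) by simp
    thus ?thesis using sym by (rule symD[rotated])
  qed
  thus ?thesis using v assms(3,4) by (simp add: reachable_def)
qed

lemma nonseparable_cyc:
  assumes f: "cyc (edges G) n f" and sub: "f ` {..<n} \<subseteq> verts G"
  shows "nonseparable G (f ` {..<n})"
proof -
  let ?S = "f ` {..<n}" and ?H = "induced G (f ` {..<n})"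
  have n: "3 \<le> n" and inj: "inj_on f {..<n}" using f by (auto simp: cyc_def)
  have vH: "verts ?H = ?S" using sub by (auto simp: induced_def)
  have eH: "{g i, g (Suc i)} \<in> edges G" "{g i, g (Suc i)} \<subseteq> ?S"
    if "cyc (edges G) n g" "g ` {..<n} = ?S" "Suc i < n" for g i
  proof -
    show "{g i, g (Suc i)} \<in> edges G" using cyc_adj[OF that(1), of i "Suc i"] that(3) by simp
    show "{g i, g (Suc i)} \<subseteq> ?S" unfolding that(2)[symmetric] using that(3) by auto
  qed
  have "connected_ugraph ?H" unfolding connected_ugraph_def
  proof (intro conjI ballI)
    show "verts ?H \<noteq> {}" using n unfolding vH by (auto simp: lessThan_empty_iff)
    fix x y assume "x \<in> verts ?H" "y \<in> verts ?H"
    then obtain a b where "a < n" "b < n" "x = f a" "y = f b" by (auto simp: vH)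
    moreover have "reachable ?H (f a) (f b)"
    proof (rule reachable_walk[of n])
      show "f i \<in> verts ?H" if "i < n" for i using that by (simp add: vH)
      show "{f i, f (Suc i)} \<in> edges ?H" if "Suc i < n" for i
        using eH[OF f refl that] by (simp add: induced_def)
    qed (use calculation in auto)
    ultimately show "reachable ?H x y" by simp
  qed
  moreover have "\<not> cut_vertex ?H v" for v
  proof
    assume "cut_vertex ?H v"
    then obtain x y where v: "v \<in> ?S" and xy: "x \<in> ?S - {v}" "y \<in> ?S - {v}"
      "\<not> reachable (induced ?H (?S - {v})) x y" by (auto simp: cut_vertex_def vH)
    obtain g where g: "cyc (edges G) n g" "g ` {..<n} = ?S" "g 0 = v" using cyc_rotate[OF f v] .
    have injg: "inj_on g {..<n}" using g(1) by (simp add: cyc_def)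
    have gS: "g (Suc i) \<in> ?S - {v}" if "Suc i < n" for i
      using that inj_onD[OF injg, of "Suc i" 0] g(2,3) by auto
    have idx: "\<exists>i. Suc i < n \<and> w = g (Suc i)" if w: "w \<in> ?S - {v}" for w
    proof -
      obtain i where i: "i < n" "w = g i" using w unfolding g(2)[symmetric] by blast
      have "i \<noteq> 0"
      proof
        assume "i = 0"
        thus False using i(2) w g(3) by simp
      qed
      thus ?thesis using i by (cases i) auto
    qed
    obtain a b where ab: "Suc a < n" "x = g (Suc a)" "Suc b < n" "y = g (Suc b)"
      using idx[OF xy(1)] idx[OF xy(2)] by blast
    have "reachable (induced ?H (?S - {v})) (g (Suc a)) (g (Suc b))"
    proof (rule reachable_walk[of "n - 1" "\<lambda>i. g (Suc i)"])
      show "g (Suc i) \<in> verts (induced ?H (?S - {v}))" if "i < n - 1" for i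
        unfolding verts_induced[of ?H] vH using gS[of i] that by simp
      show "{g (Suc i), g (Suc (Suc i))} \<in> edges (induced ?H (?S - {v}))" if "Suc i < n - 1" for i
      proof -
        have i: "Suc (Suc i) < n" using that by simp
        have "{g (Suc i), g (Suc (Suc i))} \<subseteq> ?S - {v}" using gS[OF Suc_lessD[OF i]] gS[OF i] by blast
        thus ?thesis unfolding edges_induced using eH[OF g(1,2) i] by blast
      qed
    qed (use ab in auto)
    thus False using xy(3) unfolding ab(2,4) by contradiction
  qed
  moreover have "card ?S = n" using card_image[OF inj] by simp
  ultimately show ?thesis unfolding nonseparable_def using n sub by simp
qed

lemma cyc_induced:
  assumes g: "cyc (edges (induced G B)) m g" and B: "g ` {..<m} \<subseteq> B"
  shows "cyc (edges G) m g"
proof -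
  have "{g i, g j} \<subseteq> B" if "i < m" "j < m" for i j using that B by blast
  thus ?thesis using g by (simp add: cyc_def edges_induced)
qed

lemma nonseparable_in_block:
  assumes V: "finite (verts G)" and S: "nonseparable G S"
  obtains B where "is_block G B" "S \<subseteq> B"
proof -
  define N where "N = {B. nonseparable G B}"
  have "N \<subseteq> Pow (verts G)" by (auto simp: N_def nonseparable_def)
  hence "finite N" using V finite_subset by blast
  moreover have "S \<in> N" using S by (simp add: N_def)
  ultimately have "\<exists>B\<in>N. S \<subseteq> B \<and> (\<forall>B'\<in>N. B \<subseteq> B' \<longrightarrow> B = B')" by (rule finite_has_maximal2)
  then obtain B where "B \<in> N" "S \<subseteq> B" "\<forall>B'\<in>N. B \<subseteq> B' \<longrightarrow> B = B'" by blast
  thus ?thesis using that[of B] unfolding is_block_def N_def by blast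
qed

lemma cyc_cycle_block:
  assumes G: "fin_simple_graph G" and u: "unicyclic G" and f: "cyc (edges G) n f" and sub: "f ` {..<n} \<subseteq> verts G"
  shows "cycle_block G (f ` {..<n})"
proof -
  let ?S = "f ` {..<n}"
  have n: "3 \<le> n" and inj: "inj_on f {..<n}" using f by (auto simp: cyc_def)
  have V: "finite (verts G)" using G by (simp add: fin_simple_graph_def)
  obtain B where blk: "is_block G B" and SB: "?S \<subseteq> B"
    using nonseparable_in_block[OF V nonseparable_cyc[OF f sub]] .
  have BV: "B \<subseteq> verts G" using blk by (simp add: is_block_def nonseparable_def)
  have "finite B" using BV V finite_subset by blast
  hence "n \<le> card B" using card_mono[OF _ SB] card_image[OF inj] by simp
  hence "B \<notin> edges G" using G n by (auto simp: fin_simple_graph_def)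
  hence cb: "cycle_block G B" using u blk unfolding unicyclic_def by blast
  then obtain m where m: "3 \<le> m" "ugraph_iso (induced G B) (cycle_graph m)" unfolding cycle_block_def by blast
  obtain g where g: "cyc (edges (induced G B)) m g" "g ` {..<m} = verts (induced G B)" using iso_cycle_graph[OF m(2,1)] .
  have gB: "g ` {..<m} = B" using g(2) BV by (auto simp: induced_def)
  have "cyc (edges G) m g" using cyc_induced[OF g(1)] gB by simp
  from cyc_subset_eq[OF f this] SB gB have "?S = B" by simp
  thus ?thesis using cb by simp
qed

lemma add_cone_edge: "x \<notin> e \<Longrightarrow> e \<in> edges (add_cone x U H) \<longleftrightarrow> e \<in> edges H"
  by (auto simp: add_cone_def)

lemma cyc_add_cone:
  assumes "cyc (edges H) n f" "f ` {..<n} = verts H" "x \<notin> verts H"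
  shows "cyc (edges (add_cone x U H)) n f"
proof -
  have "{f i, f j} \<in> edges (add_cone x U H) \<longleftrightarrow> {f i, f j} \<in> edges H" if "i < n" "j < n" for i j
  proof -
    have "x \<notin> {f i, f j}" using that assms(2,3) by blast
    thus ?thesis by (rule add_cone_edge)
  qed
  thus ?thesis using assms(1) by (simp add: cyc_def)
qed

lemma fan_graph_eq:
  "foldr (\<lambda>x. add_cone x U) xs H =
    \<lparr>verts = set xs \<union> verts H, edges = edges H \<union> {{x, u} | x u. x \<in> set xs \<and> u \<in> U}\<rparr>"
proof (induction xs)
  case (Cons x xs)
  have "{{y, u} | y u. y \<in> set (x # xs) \<and> u \<in> U} = {{y, u} | y u. y \<in> set xs \<and> u \<in> U} \<union> {{x, u} | u. u \<in> U}"
    unfolding list.set(2) by blast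
  thus ?case using Cons.IH by (simp add: add_cone_def Un_assoc)
qed simp

lemma vertex_cover_verts:
  assumes "fin_simple_graph H" shows "vertex_cover H (verts H)"
  unfolding vertex_cover_def
proof (intro conjI ballI order.refl)
  fix e assume "e \<in> edges H"
  hence e: "e \<subseteq> verts H" "card e = 2" using assms by (auto simp: fin_simple_graph_def)
  have "e \<noteq> {}" using e(2) by auto
  thus "e \<inter> verts H \<noteq> {}" using e(1) by blast
qed

locale graph_hochster_pred = hochster_pred "edges G" P
  for G :: "'v ugraph" and P +
  assumes G: "fin_simple_graph G"
begin

lemma finite_verts: "finite (verts G)"
  using G by (simp add: fin_simple_graph_def)

lemma size_convex_chordal: "chordal G \<Longrightarrow> size_convex (verts G)"
proof (rule size_convex_no_cycles[OF finite_verts])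
  fix n f assume c: "chordal G" and f: "4 \<le> n" "cyc (edges G) n f"
  show "\<not> f ` {..<n} \<subseteq> verts G"
  proof
    assume sub: "f ` {..<n} \<subseteq> verts G"
    have "3 \<le> n" using f(1) by simp
    hence "has_induced_cycle G n"
      unfolding has_induced_cycle_def using sub cyc_iso_cycle_graph[OF f(2) sub] by (intro conjI exI)
    thus False using c f(1) unfolding chordal_def by simp
  qed
qed

lemma size_convex_cone_cycle:
  assumes H: "G = add_cone x U H" "ugraph_iso H (cycle_graph n)" "3 \<le> n" "x \<notin> verts H"
    and U: "vertex_cover H U"
  shows "size_convex (verts G)"
proof -
  obtain f where f: "cyc (edges H) n f" "f ` {..<n} = verts H" using iso_cycle_graph[OF H(2,3)] .
  have "cyc (edges G) n f" unfolding H(1) by (rule cyc_add_cone[OF f H(4)])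
  hence "size_convex (verts H)" using size_convex_cyc f(2) by metis
  hence "size_convex (insert x (verts H))"
  proof (rule size_convex_cone[rotated -1])
    show "finite (verts H)" using f(2) by (metis finite_imageI finite_lessThan)
    show "x \<notin> verts H" by (rule H(4))
    fix u v assume uv: "u \<in> verts H - nbh (edges G) x" "v \<in> verts H - nbh (edges G) x"
    have "U \<subseteq> nbh (edges G) x" by (auto simp: nbh_def H(1) add_cone_def)
    hence nU: "u \<notin> U" "v \<notin> U" using uv by auto
    show "{u, v} \<notin> edges G"
    proof
      assume "{u, v} \<in> edges G"
      hence "{u, v} \<in> edges H" using uv H(4) by (auto simp: H(1) add_cone_def doubleton_eq_iff)
      thus False using U nU by (auto simp: vertex_cover_def)
    qed
  qed
  thus ?thesis by (simp add: H(1) add_cone_def)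
qed

lemma size_convex_fan:
  assumes "is_fan m n G"
  shows "size_convex (verts G)"
proof -
  obtain H xs where H: "fin_simple_graph H" "ugraph_iso H (path_graph n)" "set xs \<inter> verts H = {}"
    and Geq: "G = foldr (\<lambda>x. add_cone x (verts H)) xs H" using assms by (auto simp: is_fan_def)
  have vG: "verts G = set xs \<union> verts H" and eG: "edges G = edges H \<union> {{x, u} | x u. x \<in> set xs \<and> u \<in> verts H}"
    unfolding Geq fan_graph_eq by simp_all
  have eH: "\<And>e. e \<in> edges H \<Longrightarrow> e \<subseteq> verts H" using H(1) by (auto simp: fin_simple_graph_def)
  obtain ps where ps: "ipath (edges H) ps" "set ps = verts H" using iso_path_graph[OF H(2)] .
  have "{ps ! i, ps ! j} \<in> edges G \<longleftrightarrow> {ps ! i, ps ! j} \<in> edges H" if "i < length ps" "j < length ps" for i j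
  proof -
    have "ps ! i \<notin> set xs" "ps ! j \<notin> set xs" using that ps(2) H(3) nth_mem by blast+
    thus ?thesis by (auto simp: eG doubleton_eq_iff)
  qed
  hence "ipath (edges G) ps" using ps(1) by (simp add: ipath_def)
  hence "size_convex (verts H)" using size_convex_path ps(2) by metis
  thus ?thesis unfolding vG
  proof (rule size_convex_join[rotated 2])
    show "finite (verts H)" using H(1) by (simp add: fin_simple_graph_def)
    show "{y, y'} \<notin> edges G" if "y \<in> set xs" "y' \<in> set xs" for y y'
      using that H(3) eH[of "{y, y'}"] by (auto simp: eG doubleton_eq_iff)
  qed (use H(3) in \<open>auto simp: eG\<close>)
qed

lemma size_convex_unicyclic_graph:
  assumes u: "unicyclic G" and c: "has_induced_cycle G n" and n: "\<And>k. 1 \<le> k \<Longrightarrow> n \<noteq> 3 * k + 2"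
  shows "size_convex (verts G)"
proof -
  obtain S where S: "3 \<le> n" "S \<subseteq> verts G" "ugraph_iso (induced G S) (cycle_graph n)"
    using c by (auto simp: has_induced_cycle_def)
  obtain f where f: "cyc (edges (induced G S)) n f" "f ` {..<n} = verts (induced G S)" using iso_cycle_graph[OF S(3,1)] .
  have fS: "f ` {..<n} = S" using f(2) S(2) by (auto simp: induced_def)
  have fG: "cyc (edges G) n f" using cyc_induced[OF f(1)] fS by simp
  show ?thesis
  proof (rule size_convex_unicyclic[OF finite_verts fG n])
    fix m g assume "cyc (edges G) m g" "g ` {..<m} \<subseteq> verts G"
    hence "cycle_block G (g ` {..<m})" using cyc_cycle_block[OF G u] by blast
    moreover have "cycle_block G (f ` {..<n})" using cyc_cycle_block[OF G u fG] fS S(2) by simp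
    ultimately show "g ` {..<m} = f ` {..<n}" using u unfolding unicyclic_def by blast
  qed
qed

end

theorem corollary3p7:
  fixes G :: "'v ugraph" and I :: "('v, 'k::field) mpoly set"
  assumes "fin_simple_graph G"
    and "I = edge_ideal G"
  shows "(chordal G \<longrightarrow> strand_connected (verts G) I) \<and>
    (\<forall>n\<ge>3. is_wheel n G \<longrightarrow> strand_connected (verts G) I) \<and>
    (\<forall>n\<ge>2. is_jahangir n G \<longrightarrow> strand_connected (verts G) I) \<and>
    (\<forall>m\<ge>1. \<forall>n\<ge>2. is_fan m n G \<longrightarrow> strand_connected (verts G) I) \<and>
    (\<forall>n. unicyclic G \<and> has_induced_cycle G n \<and> (\<forall>k\<ge>1. n \<noteq> 3 * k + 2) \<longrightarrow>
      strand_connected (verts G) I)"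
proof -
  have "hochster_pred (edges G) (\<lambda>W. cohom_nz TYPE('k) (ind_cplx (edges G) W))"
    by (rule hochster_pred_cohom_nz) (use assms(1) in \<open>auto simp: fin_simple_graph_def\<close>)
  then interpret graph_hochster_pred G "\<lambda>W. cohom_nz TYPE('k) (ind_cplx (edges G) W)"
    by (rule graph_hochster_pred.intro) (unfold_locales, rule assms(1))
  note sc = strand_connected_if_size_convex[OF assms(1), where 'k='k, folded assms(2)]
  show ?thesis
  proof (intro conjI allI impI)
    assume "chordal G"
    thus "strand_connected (verts G) I" by (rule sc[OF size_convex_chordal])
  next
    fix n :: nat assume n: "3 \<le> n" and "is_wheel n G"
    then obtain H x where H: "fin_simple_graph H" "ugraph_iso H (cycle_graph n)" "x \<notin> verts H" "G = add_cone x (verts H) H"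
      unfolding is_wheel_def by (elim exE conjE)
    have "vertex_cover H (verts H)" by (rule vertex_cover_verts[OF H(1)])
    hence "size_convex (verts G)" by (rule size_convex_cone_cycle[OF H(4,2) n H(3)])
    thus "strand_connected (verts G) I" by (rule sc)
  next
    fix n :: nat assume n: "2 \<le> n" and "is_jahangir n G"
    then obtain H x U where H: "ugraph_iso H (cycle_graph (2 * n))" "x \<notin> verts H" "vertex_cover H U" "G = add_cone x U H"
      unfolding is_jahangir_def by (elim exE conjE)
    have "3 \<le> 2 * n" using n by simp
    hence "size_convex (verts G)" by (rule size_convex_cone_cycle[OF H(4,1) _ H(2,3)])
    thus "strand_connected (verts G) I" by (rule sc)
  next
    fix m n assume "is_fan m n G"
    thus "strand_connected (verts G) I" by (rule sc[OF size_convex_fan])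
  next
    fix n assume u: "unicyclic G \<and> has_induced_cycle G n \<and> (\<forall>k\<ge>1. n \<noteq> 3 * k + 2)"
    have "n \<noteq> 3 * k + 2" if "1 \<le> k" for k using u that by simp
    moreover have "unicyclic G" "has_induced_cycle G n" using u by blast+
    ultimately have "size_convex (verts G)" by (intro size_convex_unicyclic_graph)
    thus "strand_connected (verts G) I" by (rule sc)
  qed
qed

end
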